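(* Let $\mathcal M$ be a Fourier multiplier operator of order $m_2>0$ as in the context, let $L_0>0$, and let $(\omega_0,A_0)\in(0,\infty)\times\mathbb R$ and $\psi$ satisfy assumption $(H)$ stated in the context. Assume that the equation $u_t+uu_x-(\mathcal M u)_x=0$ is globally well-posed in $H^s_{per}([0,L_0])$ for $s\ge \frac{m_2}{2}$ and that $E$, $F$, $M$ (defined in the context) are conserved by its flow. If $$\frac{1}{L_0}\int_0^{L_0}\psi(x)\,dx>\omega_0>0,$$ then $\psi$ is orbitally stable in $H^{m_2/2}_{per}([0,L_0])$ with respect to $u_t+uu_x-(\mathcal M u)_x=0$.
   Context: Setting. $\mathcal M$ acts on real-valued $L_0$-periodic functions by $\widehat{\mathcal M g}(\kappa)=\theta(\kappa)\widehat g(\kappa)$, $\kappa\in\mathbb Z$, where $\theta$ is measurable and locally bounded on $\mathbb R$ and there are $A_1,A_2>0$, $m_2>0$ with $A_1|\kappa|^{m_2}\le\theta(\kappa)\le A_2|\kappa|^{m_2}$ for all $\kappa\in\mathbb Z$ (so $\theta(0)=0$). $\mathcal M^{1/2}$ is the nonnegative self-adjoint square root of $\mathcal M$. Write $X^s=H^s_{per}([0,L_0])$. Profile equation: a traveling wave $u(x,t)=\psi(x-\omega t)$ satisfies $\mathcal M\psi+\omega\psi-\frac12\psi^2+A=0$ for some constant $A\in\mathbb R$. Assumption $(H)$: $(\omega_0,A_0)\in(0,\infty)\times\mathbb R$ is fixed; $\psi\in C^\infty_{per}([0,L_0])$ is a positive even periodic solution, with fixed period $L_0>0$, of $\mathcal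 M\psi+\omega_0\psi-\frac12\psi^2+A_0=0$; and the self-adjoint operator $\mathcal L_0=\mathcal M+\omega_0-\psi$ on $L^2_{per}([0,L_0])$ with domain $H^{m_2}_{per}([0,L_0])$ has only one negative eigenvalue, which is simple, and zero is a simple eigenvalue with eigenfunction $\frac{d}{dx}\psi$. Conserved quantities: $E(u)=\frac12\int_0^{L_0}\left[(\mathcal M^{1/2}u)^2-\frac13u^3\right]dx$, $F(u)=\frac12\int_0^{L_0}u^2dx$, $M(u)=\int_0^{L_0}u\,dx$. Orbital stability: put $\rho(u,\psi)=\inf_{y\in\mathbb R}\|u(\cdot+y)-\psi\|_{X^{m_2/2}}$. $\psi$ is orbitally stable if for all $\varepsilon>0$ there is $\delta>0$ such that if $\|u_0-\psi\|_{X^{m_2/2}}<\delta$ and $u(t)$ is the solution with $u(0)=u_0$, then $\rho(u(t),\psi)<\varepsilon$ for all $t\in\mathbb R$. *)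

theory Defs
  imports "HOL-Analysis.Analysis"
begin

(* Elements of L^2_per([0,L]) are represented by real-valued, Borel measurable, L-periodic
   functions on the line; two functions that agree almost everywhere represent the same
   element, so equality of elements is always expressed with AE. *)

definition L2_per :: "real \<Rightarrow> (real \<Rightarrow> real) set" where
  "L2_per L = {g. (\<forall>x. g (x + L) = g x) \<and> g \<in> borel_measurable borel \<and>
                  set_integrable lborel {0..L} (\<lambda>x. (g x)\<^sup>2)}"

definition fourier_coeff :: "real \<Rightarrow> (real \<Rightarrow> real) \<Rightarrow> int \<Rightarrow> complex" where
  "fourier_coeff L g k =
     (1 / of_real L) * (LINT x:{0..L}|lborel. of_real (g x) * cis (- (2 * pi * of_int k * x / L)))"

(* Used only for s >= 0, where H^s_per is a subspace of L^2_per. *)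
definition H_per :: "real \<Rightarrow> real \<Rightarrow> (real \<Rightarrow> real) set" where
  "H_per L s = {g \<in> L2_per L.
     (\<lambda>k::int. (1 + (of_int k)\<^sup>2) powr s * (cmod (fourier_coeff L g k))\<^sup>2) summable_on UNIV}"

definition H_norm :: "real \<Rightarrow> real \<Rightarrow> (real \<Rightarrow> real) \<Rightarrow> real" where
  "H_norm L s g =
     sqrt (L * (\<Sum>\<^sub>\<infinity>k::int. (1 + (of_int k)\<^sup>2) powr s * (cmod (fourier_coeff L g k))\<^sup>2))"

definition is_multiplier_image ::
    "real \<Rightarrow> (real \<Rightarrow> real) \<Rightarrow> (real \<Rightarrow> real) \<Rightarrow> (real \<Rightarrow> real) \<Rightarrow> bool" where
  "is_multiplier_image L \<theta> g h \<longleftrightarrow>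
     h \<in> L2_per L \<and>
     (\<forall>k::int. fourier_coeff L h k = of_real (\<theta> (of_int k)) * fourier_coeff L g k)"

(* The image is determined up to a null set; the choice of representative is immaterial. *)
definition multiplier_op :: "real \<Rightarrow> (real \<Rightarrow> real) \<Rightarrow> (real \<Rightarrow> real) \<Rightarrow> real \<Rightarrow> real" where
  "multiplier_op L \<theta> g = (SOME h. is_multiplier_image L \<theta> g h)"

(* The operator is diagonal in the Fourier basis with entries \<theta>(k) >= 0, so its nonnegative
   self-adjoint square root is the multiplier with symbol sqrt \<theta>. *)
definition multiplier_sqrt :: "real \<Rightarrow> (real \<Rightarrow> real) \<Rightarrow> (real \<Rightarrow> real) \<Rightarrow> real \<Rightarrow> real" where
  "multiplier_sqrt L \<theta> = multiplier_op L (\<lambda>\<kappa>. sqrt (\<theta> \<kappa>))"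

(* The last conjunct says that the multiplier acts on real-valued functions
   (which forces \<theta>(-k) = \<theta>(k) for integers k). *)
definition multiplier_of_order :: "real \<Rightarrow> real \<Rightarrow> (real \<Rightarrow> real) \<Rightarrow> bool" where
  "multiplier_of_order L m \<theta> \<longleftrightarrow>
     m > 0 \<and>
     \<theta> \<in> borel_measurable lebesgue \<and>
     (\<forall>K. compact K \<longrightarrow> bounded (\<theta> ` K)) \<and>
     (\<exists>A1>0. \<exists>A2>0. \<forall>k::int.
        A1 * \<bar>of_int k\<bar> powr m \<le> \<theta> (of_int k) \<and> \<theta> (of_int k) \<le> A2 * \<bar>of_int k\<bar> powr m) \<and>
     (\<forall>g\<in>H_per L m. \<exists>h. is_multiplier_image L \<theta> g h)"

definition smooth_per :: "real \<Rightarrow> (real \<Rightarrow> real) \<Rightarrow> bool" where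
  "smooth_per L \<psi> \<longleftrightarrow>
     (\<forall>x. \<psi> (x + L) = \<psi> x) \<and> (\<forall>n x. (deriv ^^ n) \<psi> field_differentiable (at x))"

definition profile_equation ::
    "real \<Rightarrow> (real \<Rightarrow> real) \<Rightarrow> real \<Rightarrow> real \<Rightarrow> (real \<Rightarrow> real) \<Rightarrow> bool" where
  "profile_equation L \<theta> \<omega> A \<psi> \<longleftrightarrow>
     (AE x in lborel. multiplier_op L \<theta> \<psi> x + \<omega> * \<psi> x - (1/2) * (\<psi> x)\<^sup>2 + A = 0)"

definition linearized_op ::
    "real \<Rightarrow> (real \<Rightarrow> real) \<Rightarrow> real \<Rightarrow> (real \<Rightarrow> real) \<Rightarrow> (real \<Rightarrow> real) \<Rightarrow> real \<Rightarrow> real" where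
  "linearized_op L \<theta> \<omega> \<psi> g = (\<lambda>x. multiplier_op L \<theta> g x + \<omega> * g x - \<psi> x * g x)"

definition eigenfunction ::
    "real \<Rightarrow> real \<Rightarrow> ((real \<Rightarrow> real) \<Rightarrow> real \<Rightarrow> real) \<Rightarrow> real \<Rightarrow> (real \<Rightarrow> real) \<Rightarrow> bool" where
  "eigenfunction L m T \<mu> g \<longleftrightarrow>
     g \<in> H_per L m \<and> \<not> (AE x in lborel. g x = 0) \<and> (AE x in lborel. T g x = \<mu> * g x)"

definition eigenvalue ::
    "real \<Rightarrow> real \<Rightarrow> ((real \<Rightarrow> real) \<Rightarrow> real \<Rightarrow> real) \<Rightarrow> real \<Rightarrow> bool" where
  "eigenvalue L m T \<mu> \<longleftrightarrow> (\<exists>g. eigenfunction L m T \<mu> g)"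

(* For a self-adjoint operator, algebraic and geometric multiplicity coincide. *)
definition simple_eigenvalue ::
    "real \<Rightarrow> real \<Rightarrow> ((real \<Rightarrow> real) \<Rightarrow> real \<Rightarrow> real) \<Rightarrow> real \<Rightarrow> bool" where
  "simple_eigenvalue L m T \<mu> \<longleftrightarrow>
     eigenvalue L m T \<mu> \<and>
     (\<forall>g h. eigenfunction L m T \<mu> g \<and> eigenfunction L m T \<mu> h \<longrightarrow>
        (\<exists>c. AE x in lborel. h x = c * g x))"

definition assumption_H ::
    "real \<Rightarrow> real \<Rightarrow> (real \<Rightarrow> real) \<Rightarrow> real \<Rightarrow> real \<Rightarrow> (real \<Rightarrow> real) \<Rightarrow> bool" where
  "assumption_H L m \<theta> \<omega> A \<psi> \<longleftrightarrow>
     \<omega> > 0 \<and>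
     smooth_per L \<psi> \<and> (\<forall>x. \<psi> x > 0) \<and> (\<forall>x. \<psi> (- x) = \<psi> x) \<and>
     profile_equation L \<theta> \<omega> A \<psi> \<and>
     (let T = linearized_op L \<theta> \<omega> \<psi> in
        (\<exists>\<mu><0. simple_eigenvalue L m T \<mu> \<and> (\<forall>\<nu><0. eigenvalue L m T \<nu> \<longrightarrow> \<nu> = \<mu>)) \<and>
        simple_eigenvalue L m T 0 \<and> eigenfunction L m T 0 (deriv \<psi>))"

definition E_density :: "real \<Rightarrow> (real \<Rightarrow> real) \<Rightarrow> (real \<Rightarrow> real) \<Rightarrow> real \<Rightarrow> real" where
  "E_density L \<theta> u = (\<lambda>x. (multiplier_sqrt L \<theta> u x)\<^sup>2 - (1/3) * (u x)^3)"

definition E_fun :: "real \<Rightarrow> (real \<Rightarrow> real) \<Rightarrow> (real \<Rightarrow> real) \<Rightarrow> real" where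
  "E_fun L \<theta> u = (1/2) * (LINT x:{0..L}|lborel. E_density L \<theta> u x)"

definition F_fun :: "real \<Rightarrow> (real \<Rightarrow> real) \<Rightarrow> real" where
  "F_fun L u = (1/2) * (LINT x:{0..L}|lborel. (u x)\<^sup>2)"

definition M_fun :: "real \<Rightarrow> (real \<Rightarrow> real) \<Rightarrow> real" where
  "M_fun L u = (LINT x:{0..L}|lborel. u x)"

(* u is in C(R; H^s_per) and satisfies u_t + (u^2/2)_x - (Mu)_x = 0 in the sense of periodic
   distributions, i.e. Fourier mode by Fourier mode.  Since u(t) is in L^2, u(t)^2 is integrable
   and u u_x is understood as (u^2/2)_x. *)
definition solution ::
    "real \<Rightarrow> (real \<Rightarrow> real) \<Rightarrow> real \<Rightarrow> (real \<Rightarrow> real \<Rightarrow> real) \<Rightarrow> bool" where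
  "solution L \<theta> s u \<longleftrightarrow>
     (\<forall>t. u t \<in> H_per L s) \<and>
     (\<forall>t. ((\<lambda>\<tau>. H_norm L s (\<lambda>x. u \<tau> x - u t x)) \<longlongrightarrow> 0) (at t)) \<and>
     (\<forall>t. \<forall>k::int.
        ((\<lambda>\<tau>. fourier_coeff L (u \<tau>) k) has_vector_derivative
          \<i> * of_real (2 * pi * of_int k / L) *
            (of_real (\<theta> (of_int k)) * fourier_coeff L (u t) k
              - (1/2) * fourier_coeff L (\<lambda>x. (u t x)\<^sup>2) k)) (at t))"

definition solution_from ::
    "real \<Rightarrow> (real \<Rightarrow> real) \<Rightarrow> real \<Rightarrow> (real \<Rightarrow> real) \<Rightarrow> (real \<Rightarrow> real \<Rightarrow> real) \<Rightarrow> bool" where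
  "solution_from L \<theta> s u0 u \<longleftrightarrow> solution L \<theta> s u \<and> (AE x in lborel. u 0 x = u0 x)"

(* Well-posedness in the sense of Hadamard: existence, uniqueness, and continuity of the
   data-to-solution map from H^s_per to C([-T,T]; H^s_per) for every T. *)
definition globally_well_posed :: "real \<Rightarrow> (real \<Rightarrow> real) \<Rightarrow> real \<Rightarrow> bool" where
  "globally_well_posed L \<theta> s \<longleftrightarrow>
     (\<forall>u0\<in>H_per L s. \<exists>u. solution_from L \<theta> s u0 u) \<and>
     (\<forall>u0\<in>H_per L s. \<forall>u v. solution_from L \<theta> s u0 u \<and> solution_from L \<theta> s u0 v \<longrightarrow>
        (\<forall>t. AE x in lborel. u t x = v t x)) \<and>
     (\<forall>u0\<in>H_per L s. \<forall>u. solution_from L \<theta> s u0 u \<longrightarrow>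
        (\<forall>T>0. \<forall>\<epsilon>>0. \<exists>\<delta>>0. \<forall>v0\<in>H_per L s. \<forall>v.
           solution_from L \<theta> s v0 v \<and> H_norm L s (\<lambda>x. v0 x - u0 x) < \<delta> \<longrightarrow>
           (\<forall>t\<in>{-T..T}. H_norm L s (\<lambda>x. v t x - u t x) < \<epsilon>)))"

(* Conservation of E includes that E is defined along the flow: for small m the space
   H^{m/2}_per need not embed in L^3, and the Lebesgue integral of a non-integrable
   function is 0 by convention.  F and M are always defined on L^2_per. *)
definition conserves_EFM :: "real \<Rightarrow> real \<Rightarrow> (real \<Rightarrow> real) \<Rightarrow> bool" where
  "conserves_EFM L m \<theta> \<longleftrightarrow>
     (\<forall>u. solution L \<theta> (m/2) u \<longrightarrow> (\<forall>t.
        set_integrable lborel {0..L} (E_density L \<theta> (u t)) \<and>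
        E_fun L \<theta> (u t) = E_fun L \<theta> (u 0) \<and>
        F_fun L (u t) = F_fun L (u 0) \<and>
        M_fun L (u t) = M_fun L (u 0)))"

definition orbit_dist :: "real \<Rightarrow> real \<Rightarrow> (real \<Rightarrow> real) \<Rightarrow> (real \<Rightarrow> real) \<Rightarrow> real" where
  "orbit_dist L s u \<psi> = (INF y. H_norm L s (\<lambda>x. u (x + y) - \<psi> x))"

definition orbitally_stable ::
    "real \<Rightarrow> (real \<Rightarrow> real) \<Rightarrow> real \<Rightarrow> (real \<Rightarrow> real) \<Rightarrow> bool" where
  "orbitally_stable L \<theta> s \<psi> \<longleftrightarrow>
     (\<forall>\<epsilon>>0. \<exists>\<delta>>0. \<forall>u0\<in>H_per L s. \<forall>u.
        H_norm L s (\<lambda>x. u0 x - \<psi> x) < \<delta> \<and> solution_from L \<theta> s u0 u \<longrightarrow>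
        (\<forall>t. orbit_dist L s (u t) \<psi> < \<epsilon>))"

end

(* The operator satisfies L_0 1 = \<omega> - \<psi>, so the hypothesis on the mean of \<psi> says <L_0 1, 1> < 0.  As L_0 has a single
   negative direction, its quadratic form is coercive on the functions orthogonal to \<psi>' and to \<psi> - \<omega>.  With
   G = E + \<omega> F + A M, for which \<psi> is a critical point with Hessian L_0, and Q = \<omega> M - F, whose derivative at \<psi>
   is \<omega> - \<psi>, the combination of |G(u) - G(\<psi>)| and (Q(u) - Q(\<psi>))^2 is therefore a conserved Lyapunov function that
   controls the distance of u to the orbit of \<psi>; a continuity argument in time concludes.  No embedding of H^{m/2}
   into L^3 is available for small m: it is extracted from the assumption that every initial datum has a
   solution of finite energy, by uniform boundedness. *)

theory Submission
  imports Defs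
begin

section \<open>The periodic measure space\<close>

text \<open>The spectral hypotheses concern strong eigenfunctions in \<open>H_per L m\<close>, while
  minimization takes place in \<open>H_per L (m / 2)\<close> and yields weak equations only; the
  regularity step \<open>weak_imp_strong\<close> joins the two. Since \<open>m\<close> is an
  arbitrary positive real, the spaces are handled through Fourier coefficients, with Riesz-Fischer,
  uniqueness, Rellich compactness and lower semicontinuity on that side. The constraint is never
  imposed exactly. Because \<open>bil v (\<lambda>x. 1) = ip v q\<close> with
  \<open>q = \<omega> - \<psi>\<close>, orthogonality to \<open>q\<close> is orthogonality to the
  negative direction 1 in the form itself. Coercivity carries a penalty
  \<open>N * (ip v q)^2\<close>, which is then read off from the change of \<open>Q\<close> up to a
  term of higher order in \<open>v\<close>. The other obstacle is the choice of translate.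
  Minimizing the L2 distance asks no differentiability of \<open>u\<close> and yields orthogonality
  to the derivative of the wave, but controls only an L2 norm. The wave lies in
  \<open>H_per L m\<close>, so interpolation upgrades this to \<open>H_per L (m / 2)\<close>, the
  norm in which the Lyapunov estimate is local.\<close>

definition per :: "real \<Rightarrow> real measure" where
  "per L = restrict_space lborel {0..L}"

abbreviation iper :: "real \<Rightarrow> (real \<Rightarrow> 'b :: {banach, second_countable_topology}) \<Rightarrow> 'b" where
  "iper L f \<equiv> integral\<^sup>L (per L) f"

lemma space_per [simp]: "space (per L) = {0..L}"
  by (simp add: per_def space_restrict_space)

lemma finite_measure_per: "finite_measure (per L)"
proof (rule finite_measureI)
  have "emeasure (per L) {0..L} = emeasure lborel {0..L}"
    unfolding per_def by (subst emeasure_restrict_space) auto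
  also have "\<dots> \<noteq> \<infinity>" by (cases "0 \<le> L") auto
  finally show "emeasure (per L) (space (per L)) \<noteq> \<infinity>" by simp
qed

lemma measure_per: "0 \<le> L \<Longrightarrow> measure (per L) {0..L} = L"
  unfolding per_def by (subst measure_restrict_space) auto

lemma borel_measurable_per:
  "f \<in> borel_measurable borel \<Longrightarrow> f \<in> borel_measurable (per L)"
  unfolding per_def by (rule measurable_restrict_space1) simp

lemma set_integral_eq_per:
  fixes f :: "real \<Rightarrow> 'b::{banach, second_countable_topology}"
  shows "set_lebesgue_integral lborel {0..L} f = iper L f"
  unfolding per_def set_lebesgue_integral_def by (subst integral_restrict_space) auto

lemma set_integrable_iff_per:
  fixes f :: "real \<Rightarrow> 'b::{banach, second_countable_topology}"
  shows "set_integrable lborel {0..L} f \<longleftrightarrow> integrable (per L) f"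
  unfolding per_def set_integrable_def by (subst integrable_restrict_space) auto

lemma AE_per_iff: "(AE x in per L. P x) \<longleftrightarrow> (AE x in lborel. x \<in> {0..L} \<longrightarrow> P x)"
  unfolding per_def by (rule AE_restrict_space_iff) simp

lemma AE_perI: "(AE x in lborel. P x) \<Longrightarrow> (AE x in per L. P x)"
  unfolding AE_per_iff by (erule AE_mp) auto

lemma integral_per_const: "0 \<le> L \<Longrightarrow> iper L (\<lambda>x. c) = L *\<^sub>R (c :: 'b :: {banach, second_countable_topology})"
  using lebesgue_integral_const[of "per L" c] by (simp add: measure_per)

section \<open>Periodicity and translation over one period\<close>

lemma periodic_int:
  fixes g :: "real \<Rightarrow> 'a"
  assumes "\<And>x. g (x + L) = g x"
  shows "g (x + of_int n * L) = g x"
proof -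
  have nat: "g (x + real n * L) = g x" for x n
  proof (induction n)
    case (Suc n)
    have "g (x + real (Suc n) * L) = g ((x + real n * L) + L)" by (simp add: algebra_simps)
    also have "\<dots> = g x" using assms Suc by simp
    finally show ?case .
  qed simp
  show ?thesis
  proof (cases "n \<ge> 0")
    case True
    then show ?thesis using nat[of x "nat n"] by simp
  next
    case False
    then show ?thesis using nat[of "x + of_int n * L" "nat (-n)"] by simp
  qed
qed

lemma period_reduce:
  fixes x :: real
  assumes L: "L > 0"
  obtains n :: int where "x + of_int n * L \<in> {0..L}"
proof -
  have "of_int \<lfloor>x / L\<rfloor> * L \<le> x" "x \<le> (of_int \<lfloor>x / L\<rfloor> + 1) * L"
    using L by (simp_all add: pos_le_divide_eq[symmetric] pos_divide_le_eq[symmetric])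
  then have "x + of_int (- \<lfloor>x / L\<rfloor>) * L \<in> {0..L}" by (simp add: algebra_simps)
  then show ?thesis by (rule that)
qed

text \<open>Every point of the line is brought into \<open>{0..L}\<close> by one of countably many
  translations, each of which preserves null sets. This lifts identities proved over one period to
  the AE statements on the whole line in the definitions.\<close>

lemma periodic_AE:
  fixes g :: "real \<Rightarrow> real"
  assumes L: "L > 0" and g: "\<And>x. g (x + L) = g x" and [measurable]: "g \<in> borel_measurable borel"
    and ae: "AE x in per L. g x = 0"
  shows "AE x in lborel. g x = 0"
proof -
  have 0: "AE x in lborel. x \<in> {0..L} \<longrightarrow> g x = 0"
    using ae by (simp add: AE_per_iff)
  have pm: "Measurable.pred borel (\<lambda>x. x \<in> {0..L} \<longrightarrow> g x = 0)" by measurable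
  have "AE x in lborel. (of_int n * L + 1 * x) \<in> {0..L} \<longrightarrow> g (of_int n * L + 1 * x) = 0" for n :: int
    by (rule AE_borel_affine[of 1 "\<lambda>x. x \<in> {0..L} \<longrightarrow> g x = 0", OF _ pm 0]) simp
  then have "AE x in lborel. \<forall>n::int. (of_int n * L + 1 * x) \<in> {0..L} \<longrightarrow> g (of_int n * L + 1 * x) = 0"
    by (simp only: AE_all_countable) blast
  then show ?thesis
  proof (rule AE_mp, intro AE_I2 impI)
    fix x assume *: "\<forall>n::int. (of_int n * L + 1 * x) \<in> {0..L} \<longrightarrow> g (of_int n * L + 1 * x) = 0"
    obtain n where "x + of_int n * L \<in> {0..L}" by (rule period_reduce[OF L])
    then have "of_int n * L + 1 * x \<in> {0..L}" by (simp add: algebra_simps)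
    then have "g (x + of_int n * L) = 0" using * by (simp add: add.commute)
    then show "g x = 0" using periodic_int[of g L x n] g by simp
  qed
qed

lemma emeasure_lborel_shift:
  fixes a b c :: real
  assumes [measurable]: "B \<in> sets borel" and B: "\<And>x. x + c \<in> B \<longleftrightarrow> x \<in> B"
  shows "emeasure lborel ({a + c..<b + c} \<inter> B) = emeasure lborel ({a..<b} \<inter> B)"
proof -
  have "emeasure lborel ({a + c..<b + c} \<inter> B) = emeasure (distr lborel borel ((+) c)) ({a + c..<b + c} \<inter> B)"
    by (simp add: lborel_distr_plus)
  also have "\<dots> = emeasure lborel ((+) c -` ({a + c..<b + c} \<inter> B))"
    by (subst emeasure_distr) auto
  also have "(+) c -` ({a + c..<b + c} \<inter> B) = {a..<b} \<inter> B"
    using B by (intro set_eqI) (simp add: add.commute[of c])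
  finally show ?thesis .
qed

text \<open>Write \<open>y = r + n * L\<close> with \<open>r\<close> in \<open>{0..L}\<close>, undo
  the shift by \<open>n * L\<close>, cut \<open>{r..<r + L}\<close> at \<open>L\<close> and move the
  overhang back by one period. Half-open intervals keep the pieces disjoint.\<close>

lemma emeasure_period:
  fixes L y :: real
  assumes L: "L > 0" and [measurable]: "B \<in> sets borel" and B: "\<And>x. x + L \<in> B \<longleftrightarrow> x \<in> B"
  shows "emeasure lborel ({y..<y + L} \<inter> B) = emeasure lborel ({0..<L} \<inter> B)"
proof -
  define n where "n = \<lfloor>y / L\<rfloor>"
  define r where "r = y - of_int n * L"
  have "of_int n * L \<le> y" "y \<le> (of_int n + 1) * L"
    using L unfolding n_def by (simp_all add: pos_le_divide_eq[symmetric] pos_divide_le_eq[symmetric])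
  then have r: "0 \<le> r" "r \<le> L" by (simp_all add: r_def algebra_simps)
  have Bn: "x + of_int n * L \<in> B \<longleftrightarrow> x \<in> B" for x n
    \<comment> \<open>Periodicity of a set is periodicity of its membership predicate, which is why
      \<open>periodic_int\<close> allows any value type.\<close>
    using periodic_int[of "\<lambda>x. x \<in> B" L x n] B by simp
  have "emeasure lborel ({y..<y + L} \<inter> B) = emeasure lborel ({r + of_int n * L..<(r + L) + of_int n * L} \<inter> B)"
    by (simp add: r_def algebra_simps)
  also have "\<dots> = emeasure lborel ({r..<r + L} \<inter> B)"
    by (rule emeasure_lborel_shift) (simp_all add: Bn)
  also have "{r..<r + L} \<inter> B = ({r..<L} \<inter> B) \<union> ({0 + L..<r + L} \<inter> B)"
    using r by auto
  also have "emeasure lborel \<dots> = emeasure lborel ({r..<L} \<inter> B) + emeasure lborel ({0 + L..<r + L} \<inter> B)"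
    by (rule plus_emeasure[symmetric]) auto
  also have "emeasure lborel ({0 + L..<r + L} \<inter> B) = emeasure lborel ({0..<r} \<inter> B)"
    by (rule emeasure_lborel_shift) (simp_all add: B)
  also have "emeasure lborel ({r..<L} \<inter> B) + emeasure lborel ({0..<r} \<inter> B) = emeasure lborel (({r..<L} \<inter> B) \<union> ({0..<r} \<inter> B))"
    by (rule plus_emeasure) auto
  also have "({r..<L} \<inter> B) \<union> ({0..<r} \<inter> B) = {0..<L} \<inter> B"
    using r by auto
  finally show ?thesis .
qed

text \<open>\<open>w\<close> wraps the line onto one period. A periodic function factors through
  \<open>w\<close>, so equality of these two push-forward measures settles integrals and
  integrability together, for vector values as well.\<close>

lemma distr_per_shift:
  assumes L: "L > 0"
  defines "w \<equiv> \<lambda>x. x - of_int \<lfloor>x / L\<rfloor> * L"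
  shows "distr (per L) borel (\<lambda>x. w (x + y)) = distr (per L) borel w"
proof (rule measure_eqI)
  have [measurable]: "w \<in> borel_measurable borel" unfolding w_def by measurable
  show "sets (distr (per L) borel (\<lambda>x. w (x + y))) = sets (distr (per L) borel w)" by simp
  fix A assume "A \<in> sets (distr (per L) borel (\<lambda>x. w (x + y)))"
  then have [measurable]: "A \<in> sets borel" by simp
  define B where "B = w -` A"
  have mB[measurable]: "B \<in> sets borel"
    unfolding B_def by (rule measurable_sets_borel) measurable
  have B: "x + L \<in> B \<longleftrightarrow> x \<in> B" for x
    using L by (simp add: B_def w_def add_divide_distrib algebra_simps)
  have *: "emeasure (distr (per L) borel (\<lambda>x. w (x + y))) A = emeasure lborel ({0..<L} \<inter> B)" for y
  proof -
    have [measurable]: "(\<lambda>x. w (x + y)) \<in> borel_measurable (per L)"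
      by (rule borel_measurable_per) measurable
    have "emeasure (distr (per L) borel (\<lambda>x. w (x + y))) A = emeasure (per L) ({0..L} \<inter> (\<lambda>x. x + y) -` B)"
      by (subst emeasure_distr) (auto simp: B_def intro!: arg_cong[where f="emeasure _"])
    also have "\<dots> = emeasure lborel ({0..L} \<inter> (\<lambda>x. x + y) -` B)"
      unfolding per_def by (subst emeasure_restrict_space) auto
    \<comment> \<open>The right endpoint is a null set; dropping it gives the half-open interval
      that can be cut and moved.\<close>
    also have "\<dots> = emeasure lborel ({0..<L} \<inter> (\<lambda>x. x + y) -` B)"
    proof (rule emeasure_eq_AE)
      have "AE x in lborel. x \<noteq> L" by (rule AE_lborel_singleton)
      then show "AE x in lborel. (x \<in> {0..L} \<inter> (\<lambda>x. x + y) -` B) = (x \<in> {0..<L} \<inter> (\<lambda>x. x + y) -` B)"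
        by (rule AE_mp) (auto intro!: AE_I2)
      have "(\<lambda>x. x + y) -` B \<in> sets borel"
        by (rule measurable_sets_borel[OF _ mB]) measurable
      then show "{0..L} \<inter> (\<lambda>x. x + y) -` B \<in> sets lborel" "{0..<L} \<inter> (\<lambda>x. x + y) -` B \<in> sets lborel"
        by auto
    qed
    also have "{0..<L} \<inter> (\<lambda>x. x + y) -` B = (+) y -` ({y..<y + L} \<inter> B)"
      by (intro set_eqI) (simp add: add.commute[of y])
    also have "emeasure lborel \<dots> = emeasure (distr lborel borel ((+) y)) ({y..<y + L} \<inter> B)"
      by (subst emeasure_distr) auto
    also have "\<dots> = emeasure lborel ({y..<y + L} \<inter> B)"
      by (simp add: lborel_distr_plus)
    also have "\<dots> = emeasure lborel ({0..<L} \<inter> B)"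
      by (rule emeasure_period) (use L B in auto)
    finally show ?thesis .
  qed
  show "emeasure (distr (per L) borel (\<lambda>x. w (x + y))) A = emeasure (distr (per L) borel w) A"
    using *[of y] *[of 0] by simp
qed

lemma
  fixes g :: "real \<Rightarrow> 'b::{banach, second_countable_topology}"
  assumes L: "L > 0" and g: "\<And>x. g (x + L) = g x" and [measurable]: "g \<in> borel_measurable borel"
  shows integral_per_shift: "iper L (\<lambda>x. g (x + y)) = iper L g"
    and integrable_per_shift: "integrable (per L) (\<lambda>x. g (x + y)) \<longleftrightarrow> integrable (per L) g"
proof -
  define w where "w = (\<lambda>x. x - of_int \<lfloor>x / L\<rfloor> * L)"
  have [measurable]: "w \<in> borel_measurable borel" unfolding w_def by measurable
  have gw: "g (w x) = g x" for x
    using periodic_int[of g L x "- \<lfloor>x / L\<rfloor>"] g by (simp add: w_def)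
  have m: "(\<lambda>x. w (x + y)) \<in> borel_measurable (per L)" "w \<in> borel_measurable (per L)"
    by (rule borel_measurable_per; measurable)+
  have eq: "distr (per L) borel (\<lambda>x. w (x + y)) = distr (per L) borel w"
    using distr_per_shift[OF L, of y] by (simp add: w_def)
  have "iper L (\<lambda>x. g (w (x + y))) = iper L (\<lambda>x. g (w x))"
    using arg_cong[OF eq, of "\<lambda>M. integral\<^sup>L M g"] m by (simp add: integral_distr)
  then show "iper L (\<lambda>x. g (x + y)) = iper L g" by (simp add: gw)
  have "integrable (per L) (\<lambda>x. g (w (x + y))) \<longleftrightarrow> integrable (per L) (\<lambda>x. g (w x))"
    using arg_cong[OF eq, of "\<lambda>M. integrable M g"] m by (simp add: integrable_distr_eq)
  then show "integrable (per L) (\<lambda>x. g (x + y)) \<longleftrightarrow> integrable (per L) g" by (simp add: gw)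
qed

section \<open>Square integrable periodic functions\<close>

lemma L2_per_iff:
  "g \<in> L2_per L \<longleftrightarrow> (\<forall>x. g (x + L) = g x) \<and> g \<in> borel_measurable borel \<and> integrable (per L) (\<lambda>x. (g x)\<^sup>2)"
  by (simp add: L2_per_def set_integrable_iff_per)

lemma L2_perD:
  assumes "g \<in> L2_per L"
  shows "g (x + L) = g x" "g \<in> borel_measurable borel" "integrable (per L) (\<lambda>x. (g x)\<^sup>2)"
  using assms by (auto simp: L2_per_iff)

lemma L2_per_mult_integrable:
  assumes g: "g \<in> L2_per L" and h: "h \<in> L2_per L"
  shows "integrable (per L) (\<lambda>x. g x * h x)"
proof (rule Bochner_Integration.integrable_bound)
  show "integrable (per L) (\<lambda>x. (g x)\<^sup>2 + (h x)\<^sup>2)"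
    using g h by (intro Bochner_Integration.integrable_add) (auto dest: L2_perD)
  show "(\<lambda>x. g x * h x) \<in> borel_measurable (per L)"
    using L2_perD(2)[OF g] L2_perD(2)[OF h] by (intro borel_measurable_per) measurable
  have "\<bar>a * b\<bar> \<le> a\<^sup>2 + b\<^sup>2" for a b :: real
  proof -
    have "0 \<le> (\<bar>a\<bar> - \<bar>b\<bar>)\<^sup>2" by simp
    also have "\<dots> = a\<^sup>2 + b\<^sup>2 - 2 * \<bar>a * b\<bar>" by (simp add: power2_diff abs_mult)
    finally show ?thesis by linarith
  qed
  then show "AE x in per L. norm (g x * h x) \<le> norm ((g x)\<^sup>2 + (h x)\<^sup>2)"
    by (intro AE_I2) simp
qed

lemma L2_per_const: "(\<lambda>x. c) \<in> L2_per L"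
  using finite_measure.integrable_const[OF finite_measure_per] by (simp add: L2_per_iff)

lemma L2_per_integrable: "g \<in> L2_per L \<Longrightarrow> integrable (per L) g"
  using L2_per_mult_integrable[of g L "\<lambda>x. 1"] L2_per_const[of 1 L] by simp

lemma L2_per_lin:
  assumes g: "g \<in> L2_per L" and h: "h \<in> L2_per L"
  shows "(\<lambda>x. a * g x + b * h x) \<in> L2_per L"
proof -
  have "integrable (per L) (\<lambda>x. a\<^sup>2 * (g x)\<^sup>2 + (2 * a * b) * (g x * h x) + b\<^sup>2 * (h x)\<^sup>2)"
    using g h L2_per_mult_integrable[OF g h]
    by (intro Bochner_Integration.integrable_add integrable_mult_right) (auto dest: L2_perD)
  also have "(\<lambda>x. a\<^sup>2 * (g x)\<^sup>2 + (2 * a * b) * (g x * h x) + b\<^sup>2 * (h x)\<^sup>2) = (\<lambda>x. (a * g x + b * h x)\<^sup>2)"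
    by (simp add: fun_eq_iff power2_eq_square algebra_simps)
  finally show ?thesis using L2_perD(1,2)[OF g] L2_perD(1,2)[OF h] by (simp add: L2_per_iff)
qed

lemma L2_per_add: "g \<in> L2_per L \<Longrightarrow> h \<in> L2_per L \<Longrightarrow> (\<lambda>x. g x + h x) \<in> L2_per L"
  using L2_per_lin[of g L h 1 1] by simp

lemma L2_per_diff: "g \<in> L2_per L \<Longrightarrow> h \<in> L2_per L \<Longrightarrow> (\<lambda>x. g x - h x) \<in> L2_per L"
  using L2_per_lin[of g L h 1 "-1"] by simp

lemma L2_per_cmult: "g \<in> L2_per L \<Longrightarrow> (\<lambda>x. a * g x) \<in> L2_per L"
  using L2_per_lin[of g L g a 0] by simp

lemma L2_per_bounded:
  assumes "\<And>x. f (x + L) = f x" "f \<in> borel_measurable borel" "\<And>x. \<bar>f x\<bar> \<le> C"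
  shows "f \<in> L2_per L"
proof -
  have "integrable (per L) (\<lambda>x. (f x)\<^sup>2)"
  proof (rule finite_measure.integrable_const_bound[OF finite_measure_per, where B="C\<^sup>2"])
    show "AE x in per L. norm ((f x)\<^sup>2) \<le> C\<^sup>2"
    proof (intro AE_I2)
      fix x show "norm ((f x)\<^sup>2) \<le> C\<^sup>2"
        using assms(3)[of x] abs_le_square_iff[of "f x" C] by auto
    qed
    show "(\<lambda>x. (f x)\<^sup>2) \<in> borel_measurable (per L)"
      using assms(2) by (intro borel_measurable_per) measurable
  qed
  then show ?thesis using assms by (simp add: L2_per_iff)
qed

lemma L2_per_mult_bounded:
  assumes "\<And>x. f (x + L) = f x" "f \<in> borel_measurable borel" "\<And>x. \<bar>f x\<bar> \<le> C" and g: "g \<in> L2_per L"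
  shows "(\<lambda>x. f x * g x) \<in> L2_per L"
proof -
  have "integrable (per L) (\<lambda>x. (f x * g x)\<^sup>2)"
  proof (rule Bochner_Integration.integrable_bound)
    show "integrable (per L) (\<lambda>x. C\<^sup>2 * (g x)\<^sup>2)" using L2_perD(3)[OF g] by simp
    show "(\<lambda>x. (f x * g x)\<^sup>2) \<in> borel_measurable (per L)"
      using assms(2) L2_perD(2)[OF g] by (intro borel_measurable_per) measurable
    have "(f x)\<^sup>2 \<le> C\<^sup>2" for x using assms(3)[of x] abs_le_square_iff[of "f x" C] by auto
    then show "AE x in per L. norm ((f x * g x)\<^sup>2) \<le> norm (C\<^sup>2 * (g x)\<^sup>2)"
      by (intro AE_I2) (simp add: power_mult_distrib mult_right_mono)
  qed
  then show ?thesis using assms L2_perD(1,2)[OF g] by (simp add: L2_per_iff)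
qed

lemma L2_per_shift:
  assumes "L > 0" and g: "g \<in> L2_per L"
  shows "(\<lambda>x. g (x + y)) \<in> L2_per L"
proof -
  note [measurable] = L2_perD(2)[OF g]
  have "integrable (per L) (\<lambda>x. (g (x + y))\<^sup>2)"
    by (subst integrable_per_shift[of L "\<lambda>x. (g x)\<^sup>2"]) (use assms L2_perD[OF g] in auto)
  moreover have "g (x + L + y) = g (x + y)" for x
    using L2_perD(1)[OF g, of "x + y"] by (simp add: algebra_simps)
  ultimately show ?thesis by (simp add: L2_per_iff)
qed

text \<open>Only nonnegativity of a binary quadratic form is used, so the same argument serves the
  L2 product and the weighted products of coefficient sequences.\<close>

lemma quadratic_cauchy_schwarz:
  fixes a b c :: real
  assumes q: "\<And>s t. 0 \<le> s\<^sup>2 * a + 2 * s * t * b + t\<^sup>2 * c"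
  shows "\<bar>b\<bar> \<le> sqrt a * sqrt c"
proof -
  have a: "a \<ge> 0" and c: "c \<ge> 0" using q[of 1 0] q[of 0 1] by simp_all
  have "b\<^sup>2 \<le> a * c"
  proof (cases "c = 0")
    case True
    have "b = 0"
    proof (rule ccontr)
      assume "b \<noteq> 0"
      \<comment> \<open>For \<open>c = 0\<close> the form at \<open>s = 1\<close> is affine in
        \<open>t\<close>; this \<open>t\<close> makes it equal to -1.\<close>
      then show False using q[of 1 "- (a + 1) / (2 * b)"] True a by (simp add: field_simps)
    qed
    then show ?thesis using True by simp
  next
    case False
    then have "c > 0" using c by simp
    \<comment> \<open>At \<open>(c, -b)\<close> the form equals \<open>c\<close> times its
      determinant.\<close>
    have "0 \<le> c * (a * c - b\<^sup>2)" using q[of c "-b"] by (simp add: power2_eq_square algebra_simps)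
    then show ?thesis using \<open>c > 0\<close> by (simp add: zero_le_mult_iff)
  qed
  then have "\<bar>b\<bar> \<le> sqrt (a * c)" by (metis real_sqrt_abs real_sqrt_le_iff)
  then show ?thesis by (simp add: real_sqrt_mult)
qed

lemma L2_cauchy_schwarz:
  assumes g: "g \<in> L2_per L" and h: "h \<in> L2_per L"
  shows "\<bar>iper L (\<lambda>x. g x * h x)\<bar>
    \<le> sqrt (iper L (\<lambda>x. (g x)\<^sup>2)) * sqrt (iper L (\<lambda>x. (h x)\<^sup>2))"
proof -
  define a where "a = iper L (\<lambda>x. (g x)\<^sup>2)"
  define b where "b = iper L (\<lambda>x. g x * h x)"
  define c where "c = iper L (\<lambda>x. (h x)\<^sup>2)"
  have q: "0 \<le> s\<^sup>2 * a + 2 * s * t * b + t\<^sup>2 * c" for s t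
  proof -
    have "0 \<le> iper L (\<lambda>x. (s * g x + t * h x)\<^sup>2)" by simp
    also have "(\<lambda>x. (s * g x + t * h x)\<^sup>2) = (\<lambda>x. s\<^sup>2 * (g x)\<^sup>2 + (2 * s * t) * (g x * h x) + t\<^sup>2 * (h x)\<^sup>2)"
      by (simp add: fun_eq_iff power2_eq_square algebra_simps)
    also have "iper L \<dots> = s\<^sup>2 * a + (2 * s * t) * b + t\<^sup>2 * c"
      using L2_per_mult_integrable[OF g h] L2_perD(3)[OF g] L2_perD(3)[OF h]
      by (simp add: a_def b_def c_def)
    finally show ?thesis .
  qed
  show ?thesis using quadratic_cauchy_schwarz[OF q] by (simp add: a_def b_def c_def)
qed

lemma L2_norm_L1:
  assumes L: "L > 0" and g: "g \<in> L2_per L"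
  shows "iper L (\<lambda>x. \<bar>g x\<bar>) \<le> sqrt L * sqrt (iper L (\<lambda>x. (g x)\<^sup>2))"
proof -
  have a: "(\<lambda>x. \<bar>g x\<bar>) \<in> L2_per L" using g by (auto simp: L2_per_iff)
  have "iper L (\<lambda>x. 1::real) = L" using L integral_per_const[of L "1::real"] by simp
  then show ?thesis using L2_cauchy_schwarz[OF a L2_per_const[of 1]] by (simp add: mult.commute)
qed

section \<open>Fourier series and the Riesz--Fischer theorem\<close>

definition emode :: "real \<Rightarrow> int \<Rightarrow> real \<Rightarrow> complex" where
  "emode L k x = cis (2 * pi * of_int k * x / L)"

lemma norm_emode [simp]: "cmod (emode L k x) = 1"
  by (simp add: emode_def)

lemma continuous_on_emode: "continuous_on S (emode L k)"
proof -
  have "emode L k = (\<lambda>x. cis ((2 * pi * of_int k / L) * x))" by (simp add: emode_def fun_eq_iff)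
  moreover have "continuous_on S (\<lambda>x. cis ((2 * pi * of_int k / L) * x))"
    by (intro continuous_on_cis continuous_on_mult_left continuous_on_id)
  ultimately show ?thesis by simp
qed

lemma emode_measurable [measurable]: "emode L k \<in> borel_measurable borel"
  by (intro borel_measurable_continuous_onI continuous_on_emode)

lemma emode_mult: "emode L j x * emode L k x = emode L (j + k) x"
  by (simp add: emode_def cis_mult add_divide_distrib algebra_simps)

lemma emode_minus: "emode L (- k) x = cnj (emode L k x)"
  by (simp add: emode_def cis_cnj)

lemma emode_zero [simp]: "emode L 0 x = 1"
  by (simp add: emode_def)

lemma emode_add_arg: "emode L k (x + y) = emode L k x * emode L k y"
  by (simp add: emode_def cis_mult add_divide_distrib algebra_simps)

lemma emode_period: "L \<noteq> 0 \<Longrightarrow> emode L k (x + L) = emode L k x"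
  by (simp add: emode_add_arg) (simp add: emode_def cis_multiple_2pi[of "of_int k"])

lemma fourier_coeff_eq:
  "fourier_coeff L g k = (1 / of_real L) * iper L (\<lambda>x. of_real (g x) * emode L (- k) x)"
  unfolding fourier_coeff_def set_integral_eq_per emode_def by simp

lemma integral_emode_mult:
  assumes "L > 0"
  shows "iper L (\<lambda>x. of_real (g x) * emode L k x) = of_real L * cnj (fourier_coeff L g k)"
proof -
  have "cnj (fourier_coeff L g k) = (1 / of_real L) * iper L (\<lambda>x. cnj (of_real (g x) * emode L (- k) x))"
    unfolding fourier_coeff_eq by (simp del: complex_cnj_mult)
  then show ?thesis using assms by (simp add: emode_minus)
qed

lemma fourier_coeff_minus: "fourier_coeff L g (- k) = cnj (fourier_coeff L g k)"
proof -
  have "cnj (fourier_coeff L g k) = (1 / of_real L) * iper L (\<lambda>x. cnj (of_real (g x) * emode L (- k) x))"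
    unfolding fourier_coeff_eq by (simp del: complex_cnj_mult)
  also have "(\<lambda>x. cnj (of_real (g x) * emode L (- k) x)) = (\<lambda>x. of_real (g x) * emode L (- (- k)) x)"
    by (simp add: emode_minus)
  finally show ?thesis by (simp only: fourier_coeff_eq[of L g "- k"])
qed

lemma integrable_emode_mult:
  assumes "integrable (per L) g"
  shows "integrable (per L) (\<lambda>x. of_real (g x) * emode L k x)"
proof (rule Bochner_Integration.integrable_bound[OF assms])
  have [measurable]: "g \<in> borel_measurable (per L)" using assms by (rule borel_measurable_integrable)
  have [measurable]: "emode L k \<in> borel_measurable (per L)" by (rule borel_measurable_per) (rule emode_measurable)
  show "(\<lambda>x. of_real (g x) * emode L k x) \<in> borel_measurable (per L)" by measurable
  show "AE x in per L. norm (of_real (g x) * emode L k x) \<le> norm (g x)"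
    by (intro AE_I2) (simp add: norm_mult)
qed

lemma fourier_coeff_lin:
  assumes g: "integrable (per L) g" and h: "integrable (per L) h"
  shows "fourier_coeff L (\<lambda>x. a * g x + b * h x) k = of_real a * fourier_coeff L g k + of_real b * fourier_coeff L h k"
proof -
  have "iper L (\<lambda>x. of_real (a * g x + b * h x) * emode L (- k) x)
    = iper L (\<lambda>x. of_real a * (of_real (g x) * emode L (- k) x) + of_real b * (of_real (h x) * emode L (- k) x))"
    by (simp add: algebra_simps)
  also have "\<dots> = of_real a * iper L (\<lambda>x. of_real (g x) * emode L (- k) x)
      + of_real b * iper L (\<lambda>x. of_real (h x) * emode L (- k) x)"
    using integrable_emode_mult[OF g, of "-k"] integrable_emode_mult[OF h, of "-k"] by simp
  finally show ?thesis by (simp add: fourier_coeff_eq algebra_simps)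
qed

lemma fourier_coeff_diff:
  assumes "integrable (per L) g" "integrable (per L) h"
  shows "fourier_coeff L (\<lambda>x. g x - h x) k = fourier_coeff L g k - fourier_coeff L h k"
  using fourier_coeff_lin[OF assms, of 1 "-1" k] by simp

lemma fourier_coeff_cmult: "fourier_coeff L (\<lambda>x. a * g x) k = of_real a * fourier_coeff L g k"
  by (simp add: fourier_coeff_eq mult.assoc)

lemma fourier_coeff_cong_AE:
  assumes "AE x in per L. g x = h x" "g \<in> borel_measurable borel" "h \<in> borel_measurable borel"
  shows "fourier_coeff L g k = fourier_coeff L h k"
proof -
  note [measurable] = assms(2,3)
  have "iper L (\<lambda>x. of_real (g x) * emode L (- k) x) = iper L (\<lambda>x. of_real (h x) * emode L (- k) x)"
  proof (rule integral_cong_AE)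
    show "(\<lambda>x. of_real (g x) * emode L (- k) x) \<in> borel_measurable (per L)"
      "(\<lambda>x. of_real (h x) * emode L (- k) x) \<in> borel_measurable (per L)"
      by (rule borel_measurable_per; measurable)+
    show "AE x in per L. of_real (g x) * emode L (- k) x = of_real (h x) * emode L (- k) x"
      using assms(1) by (rule AE_mp) (auto intro!: AE_I2)
  qed
  then show ?thesis by (simp add: fourier_coeff_eq)
qed

lemma norm_fourier_coeff_le:
  assumes "L > 0"
  shows "cmod (fourier_coeff L g k) \<le> (1 / L) * iper L (\<lambda>x. \<bar>g x\<bar>)"
proof -
  have "cmod (iper L (\<lambda>x. of_real (g x) * emode L (- k) x)) \<le> iper L (\<lambda>x. cmod (of_real (g x) * emode L (- k) x))"
    by (rule integral_norm_bound)
  also have "\<dots> = iper L (\<lambda>x. \<bar>g x\<bar>)" by (simp add: norm_mult)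
  finally show ?thesis using assms by (simp add: fourier_coeff_eq norm_mult norm_divide field_simps)
qed

lemma fourier_coeff_shift:
  assumes L: "L > 0" and g: "\<And>x. g (x + L) = g x" and [measurable]: "g \<in> borel_measurable borel"
  shows "fourier_coeff L (\<lambda>x. g (x + y)) k = emode L k y * fourier_coeff L g k"
proof -
  have "iper L (\<lambda>x. of_real (g (x + y)) * emode L (- k) x)
      = iper L (\<lambda>x. emode L k y * (of_real (g (x + y)) * emode L (- k) (x + y)))"
  proof (rule Bochner_Integration.integral_cong[OF refl])
    fix x
    have "emode L k y * emode L (- k) y = 1" by (simp add: emode_mult)
    then have "emode L k y * (emode L (- k) x * emode L (- k) y) = emode L (- k) x"
      by (metis mult.commute mult.left_commute mult_1)
    then show "of_real (g (x + y)) * emode L (- k) x = emode L k y * (of_real (g (x + y)) * emode L (- k) (x + y))"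
      by (simp add: emode_add_arg mult.left_commute)
  qed
  also have "\<dots> = emode L k y * iper L (\<lambda>x. of_real (g (x + y)) * emode L (- k) (x + y))"
    by simp
  also have "iper L (\<lambda>x. of_real (g (x + y)) * emode L (- k) (x + y)) = iper L (\<lambda>x. of_real (g x) * emode L (- k) x)"
    by (rule integral_per_shift[OF L, of "\<lambda>x. of_real (g x) * emode L (- k) x"])
      (use L in \<open>auto simp: g emode_period\<close>)
  finally show ?thesis by (simp add: fourier_coeff_eq)
qed

lemma integral_per_FTC:
  fixes f :: "real \<Rightarrow> 'a :: euclidean_space"
  assumes "0 \<le> L" "\<And>x. (F has_vector_derivative f x) (at x)" "continuous_on UNIV f"
  shows "iper L f = F L - F 0"
proof -
  have "integral\<^sup>L lborel (\<lambda>x. indicator {0 .. L} x *\<^sub>R f x) = F L - F 0"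
    using assms by (intro integral_FTC_atLeastAtMost)
      (auto intro: has_vector_derivative_at_within continuous_on_subset)
  then show ?thesis by (simp add: set_integral_eq_per[symmetric] set_lebesgue_integral_def)
qed

lemma emode_has_vector_derivative:
  "(emode L k has_vector_derivative \<i> * of_real (2 * pi * of_int k / L) * emode L k x) (at x)"
proof -
  have "((\<lambda>x. cis (2 * pi * of_int k * x / L)) has_derivative
      (\<lambda>t. (t * (2 * pi * of_int k / L)) *\<^sub>R (\<i> * cis (2 * pi * of_int k * x / L)))) (at x)"
  proof (rule has_derivative_cis)
    have "((\<lambda>x. (2 * pi * of_int k / L) * x) has_derivative (\<lambda>t. (2 * pi * of_int k / L) * t)) (at x)"
      by (intro derivative_intros)
    then show "((\<lambda>x. 2 * pi * of_int k * x / L) has_derivative (\<lambda>t. t * (2 * pi * of_int k / L))) (at x)"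
      by (simp add: mult_ac)
  qed
  then show ?thesis
    by (simp add: has_vector_derivative_def emode_def[abs_def] scaleR_conv_of_real mult_ac)
qed

lemma integral_emode:
  assumes L: "L > 0"
  shows "iper L (emode L k) = (if k = 0 then of_real L else 0)"
proof (cases "k = 0")
  case True
  then show ?thesis using L integral_per_const[of L "1::complex"]
    by (simp add: emode_def[abs_def] scaleR_conv_of_real)
next
  case False
  define a :: complex where "a = \<i> * of_real (2 * pi * of_int k / L)"
  have a: "a \<noteq> 0" using False L by (simp add: a_def)
  have "iper L (emode L k) = (1 / a) * emode L k L - (1 / a) * emode L k 0"
  proof (rule integral_per_FTC[OF less_imp_le[OF L]])
    fix x
    have "((\<lambda>x. (1 / a) * emode L k x) has_vector_derivative (1 / a) * (a * emode L k x)) (at x)"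
      unfolding a_def by (intro has_vector_derivative_mult_right emode_has_vector_derivative)
    then show "((\<lambda>x. (1 / a) * emode L k x) has_vector_derivative emode L k x) (at x)"
      using a by simp
  next
    show "continuous_on UNIV (emode L k)" by (rule continuous_on_emode)
  qed
  also have "emode L k L = emode L k 0" using emode_period[of L k 0] L by simp
  finally show ?thesis using False by simp
qed

section \<open>Trigonometric polynomials and Bessel's inequality\<close>

definition trig :: "real \<Rightarrow> int set \<Rightarrow> (int \<Rightarrow> complex) \<Rightarrow> real \<Rightarrow> real" where
  "trig L F c x = (\<Sum>k\<in>F. Re (c k * emode L k x))"

lemma trig_bounded: "\<bar>trig L F c x\<bar> \<le> (\<Sum>k\<in>F. cmod (c k))"
  unfolding trig_def
proof (rule order_trans[OF sum_abs sum_mono])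
  fix k
  show "\<bar>Re (c k * emode L k x)\<bar> \<le> cmod (c k)"
    using abs_Re_le_cmod[of "c k * emode L k x"] by (simp add: norm_mult)
qed

lemma trig_L2: "L > 0 \<Longrightarrow> trig L F c \<in> L2_per L"
proof (rule L2_per_bounded[OF _ _ trig_bounded])
  show "trig L F c \<in> borel_measurable borel" unfolding trig_def by measurable
qed (simp add: trig_def emode_period)

lemma integral_mult_trig:
  assumes L: "L > 0" and g: "g \<in> L2_per L" and F: "finite F"
  shows "iper L (\<lambda>x. g x * trig L F c x) = L * (\<Sum>k\<in>F. Re (c k * cnj (fourier_coeff L g k)))"
proof -
  have int: "integrable (per L) (\<lambda>x. c k * (of_real (g x) * emode L k x))" for k
    using integrable_emode_mult[OF L2_per_integrable[OF g]] by simp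
  have "iper L (\<lambda>x. g x * trig L F c x)
      = iper L (\<lambda>x. \<Sum>k\<in>F. Re (c k * (of_real (g x) * emode L k x)))"
    by (simp add: trig_def sum_distrib_left algebra_simps)
  also have "\<dots> = (\<Sum>k\<in>F. iper L (\<lambda>x. Re (c k * (of_real (g x) * emode L k x))))"
    by (rule Bochner_Integration.integral_sum) (rule integrable_Re[OF int])
  also have "\<dots> = (\<Sum>k\<in>F. L * Re (c k * cnj (fourier_coeff L g k)))"
  proof (rule sum.cong[OF refl])
    fix k
    have "iper L (\<lambda>x. Re (c k * (of_real (g x) * emode L k x)))
      = Re (c k * iper L (\<lambda>x. of_real (g x) * emode L k x))"
      using integral_Re[OF int[of k]] by simp
    also have "\<dots> = Re (of_real L * (c k * cnj (fourier_coeff L g k)))"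
      by (simp only: integral_emode_mult[OF L] mult.left_commute)
    finally show "iper L (\<lambda>x. Re (c k * (of_real (g x) * emode L k x))) = L * Re (c k * cnj (fourier_coeff L g k))"
      by (simp only: Re_complex_of_real times_complex.sel Im_complex_of_real mult_zero_left diff_zero)
  qed
  finally show ?thesis by (simp add: sum_distrib_left)
qed

text \<open>\<open>trig\<close> takes real parts so that it is always a real function. For a
  symmetric set of modes and Hermitian coefficients the sum is already real, and the real parts
  disappear.\<close>

lemma fourier_coeff_trig:
  assumes L: "L > 0" and F: "finite F" "uminus ` F = F" and c: "\<And>k. c (- k) = cnj (c k)"
  shows "fourier_coeff L (trig L F c) j = (if j \<in> F then c j else 0)"
proof -
  have re: "of_real (Re (c k * emode L k x)) = (c k * emode L k x + c (- k) * emode L (- k) x) / 2" for k x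
    by (simp add: c emode_minus complex_eq_iff)
  have sym: "(\<Sum>k\<in>F. c (- k) * emode L (- k) x) = (\<Sum>k\<in>F. c k * emode L k x)" for x
    using sum.reindex[of uminus F "\<lambda>k. c k * emode L k x"] F by simp
  have "of_real (trig L F c x) = (\<Sum>k\<in>F. c k * emode L k x)" for x
    unfolding trig_def of_real_sum re by (simp add: sum_divide_distrib[symmetric] sum.distrib sym)
  then have "iper L (\<lambda>x. of_real (trig L F c x) * emode L (- j) x)
    = iper L (\<lambda>x. \<Sum>k\<in>F. c k * emode L (k - j) x)"
    by (simp add: sum_distrib_right mult.assoc emode_mult)
  also have "\<dots> = (\<Sum>k\<in>F. c k * iper L (emode L (k - j)))"
  proof (subst Bochner_Integration.integral_sum)
    fix k
    show "integrable (per L) (\<lambda>x. c k * emode L (k - j) x)"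
      using integrable_emode_mult[OF L2_per_integrable[OF L2_per_const[of 1]], of L "k - j"] by simp
  qed simp
  also have "\<dots> = (\<Sum>k\<in>F. if k = j then of_real L * c j else 0)"
    by (intro sum.cong) (auto simp: integral_emode[OF L])
  also have "\<dots> = (if j \<in> F then of_real L * c j else 0)" using F by simp
  finally show ?thesis using L by (simp add: fourier_coeff_eq)
qed

lemma integral_trig_sq:
  assumes L: "L > 0" and F: "finite F" "uminus ` F = F" and c: "\<And>k. c (- k) = cnj (c k)"
  shows "iper L (\<lambda>x. (trig L F c x)\<^sup>2) = L * (\<Sum>k\<in>F. (cmod (c k))\<^sup>2)"
proof -
  have "iper L (\<lambda>x. trig L F c x * trig L F c x) = L * (\<Sum>k\<in>F. Re (c k * cnj (fourier_coeff L (trig L F c) k)))"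
    by (rule integral_mult_trig[OF L trig_L2[OF L] F(1)])
  also have "(\<Sum>k\<in>F. Re (c k * cnj (fourier_coeff L (trig L F c) k))) = (\<Sum>k\<in>F. (cmod (c k))\<^sup>2)"
    by (intro sum.cong refl) (simp add: fourier_coeff_trig[of L F c, OF L F c] complex_mult_cnj cmod_power2)
  finally show ?thesis by (simp add: power2_eq_square)
qed

lemma integral_diff_trig_sq:
  assumes L: "L > 0" and F: "finite F" "uminus ` F = F" and g: "g \<in> L2_per L"
    and c: "\<And>k. k \<in> F \<Longrightarrow> fourier_coeff L g k = c k" and c': "\<And>k. c (- k) = cnj (c k)"
  shows "iper L (\<lambda>x. (g x - trig L F c x)\<^sup>2)
    = iper L (\<lambda>x. (g x)\<^sup>2) - L * (\<Sum>k\<in>F. (cmod (c k))\<^sup>2)"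
proof -
  note t = trig_L2[OF L, of F c]
  have "iper L (\<lambda>x. (g x - trig L F c x)\<^sup>2)
    = iper L (\<lambda>x. (g x)\<^sup>2 - 2 * (g x * trig L F c x) + (trig L F c x)\<^sup>2)"
    by (simp add: power2_diff algebra_simps)
  also have "\<dots> = iper L (\<lambda>x. (g x)\<^sup>2) - 2 * iper L (\<lambda>x. g x * trig L F c x)
      + iper L (\<lambda>x. (trig L F c x)\<^sup>2)"
    using L2_perD(3)[OF g] L2_perD(3)[OF t] L2_per_mult_integrable[OF g t] by simp
  also have "iper L (\<lambda>x. g x * trig L F c x) = L * (\<Sum>k\<in>F. (cmod (c k))\<^sup>2)"
    unfolding integral_mult_trig[OF L g F(1)]
    by (intro arg_cong[where f="\<lambda>x. L * x"] sum.cong refl) (simp add: c complex_mult_cnj cmod_power2)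
  finally show ?thesis by (simp add: integral_trig_sq[of L F c, OF L F c'])
qed

lemma bessel:
  assumes L: "L > 0" and g: "g \<in> L2_per L" and F: "finite F"
  shows "L * (\<Sum>k\<in>F. (cmod (fourier_coeff L g k))\<^sup>2) \<le> iper L (\<lambda>x. (g x)\<^sup>2)"
proof -
  \<comment> \<open>The modes are symmetrized so that the partial sum is a real function with the
    right coefficients; the added modes only enlarge the left side.\<close>
  define G where "G = F \<union> uminus ` F"
  have G: "finite G" "uminus ` G = G" using F by (auto simp: G_def image_Un image_image)
  have "0 \<le> iper L (\<lambda>x. (g x - trig L G (fourier_coeff L g) x)\<^sup>2)" by simp
  also have "\<dots> = iper L (\<lambda>x. (g x)\<^sup>2) - L * (\<Sum>k\<in>G. (cmod (fourier_coeff L g k))\<^sup>2)"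
    by (rule integral_diff_trig_sq[OF L G g]) (auto simp: fourier_coeff_minus)
  finally have "L * (\<Sum>k\<in>G. (cmod (fourier_coeff L g k))\<^sup>2) \<le> iper L (\<lambda>x. (g x)\<^sup>2)" by simp
  moreover have "(\<Sum>k\<in>F. (cmod (fourier_coeff L g k))\<^sup>2) \<le> (\<Sum>k\<in>G. (cmod (fourier_coeff L g k))\<^sup>2)"
    by (rule sum_mono2) (use G in \<open>auto simp: G_def\<close>)
  ultimately show ?thesis using L by (meson mult_left_mono less_imp_le order_trans)
qed

lemma fourier_coeff_square_summable:
  assumes L: "L > 0" and g: "g \<in> L2_per L"
  shows "(\<lambda>k. (cmod (fourier_coeff L g k))\<^sup>2) summable_on UNIV"
proof (rule nonneg_bdd_above_summable_on)
  show "bdd_above (sum (\<lambda>k. (cmod (fourier_coeff L g k))\<^sup>2) ` {F. F \<subseteq> UNIV \<and> finite F})"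
  proof (rule bdd_aboveI2)
    fix F :: "int set" assume "F \<in> {F. F \<subseteq> UNIV \<and> finite F}"
    then show "sum (\<lambda>k. (cmod (fourier_coeff L g k))\<^sup>2) F \<le> iper L (\<lambda>x. (g x)\<^sup>2) / L"
      using bessel[OF L g, of F] L by (simp add: field_simps)
  qed
qed simp

text \<open>The tail is estimated over every finite set avoiding the window, which is what
  differences of partial sums require.\<close>

lemma summable_on_tail:
  fixes f :: "int \<Rightarrow> real"
  assumes f: "f summable_on UNIV" and "\<And>k. f k \<ge> 0" and "\<epsilon> > 0"
  shows "\<exists>N. \<forall>F. finite F \<and> F \<inter> {- int N..int N} = {} \<longrightarrow> sum f F \<le> \<epsilon>"
proof -
  obtain G where G: "finite G" "dist (sum f G) (infsum f UNIV) \<le> \<epsilon>"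
    using infsum_finite_approximation[OF f \<open>\<epsilon> > 0\<close>] by auto
  obtain N where N: "G \<subseteq> {- int N..int N}"
  proof
    show "G \<subseteq> {- int (nat (\<Sum>k\<in>G. \<bar>k\<bar>))..int (nat (\<Sum>k\<in>G. \<bar>k\<bar>))}"
    proof
      fix k assume "k \<in> G"
      then have "\<bar>k\<bar> \<le> (\<Sum>k\<in>G. \<bar>k\<bar>)" using G by (intro member_le_sum) auto
      then show "k \<in> {- int (nat (\<Sum>k\<in>G. \<bar>k\<bar>))..int (nat (\<Sum>k\<in>G. \<bar>k\<bar>))}" by auto
    qed
  qed
  show ?thesis
  proof (intro exI[of _ N] allI impI)
    fix F assume F: "finite F \<and> F \<inter> {- int N..int N} = {}"
    then have "sum f F + sum f G = sum f (F \<union> G)"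
      using N G by (intro sum.union_disjoint[symmetric]) auto
    also have "\<dots> \<le> infsum f UNIV"
      using F G assms by (intro finite_sum_le_infsum) auto
    finally show "sum f F \<le> \<epsilon>" using G(2) by (simp add: dist_real_def abs_le_iff)
  qed
qed

text \<open>Partial sums are taken along windows growing so fast that their L2 distances decay
  geometrically; then they converge almost everywhere, and Fatou's lemma shows that the limit is
  also the L2 limit. The norm identity is part of the statement because \<open>parseval\<close> is
  derived from it.\<close>

theorem riesz_fischer:
  assumes L: "L > 0" and sq: "(\<lambda>k::int. (cmod (c k))\<^sup>2) summable_on UNIV"
    and c: "\<And>k. c (- k) = cnj (c k)"
  obtains g where "g \<in> L2_per L" "\<And>k. fourier_coeff L g k = c k"
    "iper L (\<lambda>x. (g x)\<^sup>2) = L * (\<Sum>\<^sub>\<infinity>k. (cmod (c k))\<^sup>2)"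
proof -
  have "\<forall>j. \<exists>N. \<forall>F. finite F \<and> F \<inter> {- int N..int N} = {} \<longrightarrow> (\<Sum>k\<in>F. (cmod (c k))\<^sup>2) \<le> (1/4)^j"
    by (intro allI summable_on_tail[OF sq]) auto
  then obtain N where N: "\<And>j F. finite F \<Longrightarrow> F \<inter> {- int (N j)..int (N j)} = {} \<Longrightarrow> (\<Sum>k\<in>F. (cmod (c k))\<^sup>2) \<le> (1/4)^j"
    by metis
  \<comment> \<open>Summing the \<open>N i\<close> makes the windows increase; adding
    \<open>j\<close> ensures that each mode is eventually inside.\<close>
  define r where "r j = (\<Sum>i\<le>j. N i) + j" for j :: nat
  define S where "S j = {- int (r j)..int (r j)}" for j
  have Nr: "N j \<le> r j" for j
    unfolding r_def using member_le_sum[of j "{..j}" N] by auto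
  have rmono: "r i \<le> r j" if "i \<le> j" for i j
    unfolding r_def using that by (intro add_mono sum_mono2) auto
  have S: "finite (S j)" "uminus ` S j = S j" for j by (auto simp: S_def)
  have Smono: "S i \<subseteq> S j" if "i \<le> j" for i j using rmono[OF that] by (auto simp: S_def)
  define q where "q j = trig L (S j) c" for j
  have qL2: "q j \<in> L2_per L" for j unfolding q_def by (rule trig_L2[OF L])
  have [measurable]: "q j \<in> borel_measurable borel" for j using L2_perD(2)[OF qL2] .
  have [measurable]: "q j \<in> borel_measurable (per L)" for j by (rule borel_measurable_per) measurable
  have qdiff: "iper L (\<lambda>x. (q i x - q j x)\<^sup>2) \<le> L * (1/4)^j" if "j \<le> i" for i j
  proof -
    have "q i x - q j x = trig L (S i - S j) c x" for x
      unfolding q_def trig_def using sum_diff[OF S(1) Smono[OF that], of "\<lambda>k. Re (c k * emode L k x)"] by simp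
    moreover have "uminus ` (S i - S j) = S i - S j"
      using S(2)[of i] S(2)[of j] by (simp add: image_set_diff)
    moreover have "(\<Sum>k\<in>S i - S j. (cmod (c k))\<^sup>2) \<le> (1/4)^j"
      using Nr[of j] by (intro N) (auto simp: S_def)
    ultimately show ?thesis using L integral_trig_sq[of L "S i - S j" c] S(1) c by (simp add: mult_left_mono)
  qed
  \<comment> \<open>The root of \<open>(1/4)^j\<close> is \<open>(1/2)^j\<close>, so the increments
    are summable in L1 and therefore pointwise almost everywhere.\<close>
  have qdiff1: "iper L (\<lambda>x. \<bar>q (Suc j) x - q j x\<bar>) \<le> L * (1/2)^j" for j
  proof -
    have "iper L (\<lambda>x. \<bar>q (Suc j) x - q j x\<bar>) \<le> sqrt L * sqrt (iper L (\<lambda>x. (q (Suc j) x - q j x)\<^sup>2))"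
      by (rule L2_norm_L1[OF L L2_per_diff[OF qL2 qL2]])
    also have "\<dots> \<le> sqrt L * sqrt (L * (1/4)^j)"
      using L qdiff[of j "Suc j"] by (intro mult_left_mono real_sqrt_le_mono) auto
    also have "\<dots> = L * sqrt ((1/4)^j)" using L by (simp add: real_sqrt_mult)
    also have "sqrt ((1/4)^j) = (1/2::real)^j"
      by (rule real_sqrt_unique) (simp_all add: power_mult_distrib[symmetric] power2_eq_square)
    finally show ?thesis .
  qed
  have ae: "AE x in per L. convergent (\<lambda>j. q j x)"
  proof -
    have "(\<integral>\<^sup>+ x. (\<Sum>j. ennreal \<bar>q (Suc j) x - q j x\<bar>) \<partial>per L) = (\<Sum>j. \<integral>\<^sup>+ x. ennreal \<bar>q (Suc j) x - q j x\<bar> \<partial>per L)"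
      by (rule nn_integral_suminf) measurable
    also have "\<dots> \<le> (\<Sum>j. ennreal (L * (1/2)^j))"
    proof (rule suminf_le)
      fix j
      have "(\<integral>\<^sup>+ x. ennreal \<bar>q (Suc j) x - q j x\<bar> \<partial>per L) = ennreal (iper L (\<lambda>x. \<bar>q (Suc j) x - q j x\<bar>))"
        by (rule nn_integral_eq_integral) (use L2_per_integrable[OF L2_per_diff[OF qL2 qL2]] in auto)
      then show "(\<integral>\<^sup>+ x. ennreal \<bar>q (Suc j) x - q j x\<bar> \<partial>per L) \<le> ennreal (L * (1/2)^j)"
        using qdiff1[of j] by (simp add: ennreal_leI)
    qed auto
    also have "\<dots> = ennreal (\<Sum>j. L * (1/2)^j)"
      using L by (intro suminf_ennreal2) (auto intro!: summable_mult summable_geometric)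
    finally have "(\<integral>\<^sup>+ x. (\<Sum>j. ennreal \<bar>q (Suc j) x - q j x\<bar>) \<partial>per L) \<noteq> \<infinity>"
      by (auto simp: top_unique)
    then have "AE x in per L. (\<Sum>j. ennreal \<bar>q (Suc j) x - q j x\<bar>) \<noteq> \<infinity>"
      by (intro nn_integral_PInf_AE) measurable
    then show ?thesis
    proof (rule AE_mp, intro AE_I2 impI)
      fix x assume "(\<Sum>j. ennreal \<bar>q (Suc j) x - q j x\<bar>) \<noteq> \<infinity>"
      then have "summable (\<lambda>j. \<bar>q (Suc j) x - q j x\<bar>)"
        by (intro summable_suminf_not_top) auto
      then have "summable (\<lambda>j. q (Suc j) x - q j x)" by (rule summable_rabs_cancel)
      then have "convergent (\<lambda>n. \<Sum>j<n. q (Suc j) x - q j x)" by (simp add: summable_iff_convergent)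
      then have "convergent (\<lambda>n. q n x - q 0 x)" by (simp add: sum_lessThan_telescope[of "\<lambda>j. q j x"])
      then have "convergent (\<lambda>n. (q n x - q 0 x) + q 0 x)" by (intro convergent_add convergent_const)
      then show "convergent (\<lambda>j. q j x)" by simp
    qed
  qed
  \<comment> \<open>Where the sequence diverges, \<open>lim\<close> has a default value, the same at
    \<open>x\<close> and at \<open>x + L\<close>; periodicity thus holds everywhere and not only
    almost everywhere.\<close>
  define g where "g x = lim (\<lambda>j. q j x)" for x
  have mg[measurable]: "g \<in> borel_measurable borel" unfolding g_def by measurable
  have [measurable]: "g \<in> borel_measurable (per L)" by (rule borel_measurable_per) measurable
  have gper: "g (x + L) = g x" for x unfolding g_def using L2_perD(1)[OF qL2] by simp
  have aeg: "AE x in per L. (\<lambda>j. q j x) \<longlonglongrightarrow> g x"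
    using ae by (rule AE_mp) (auto intro!: AE_I2 simp: g_def convergent_LIMSEQ_iff)
  have nn: "(\<integral>\<^sup>+ x. ennreal ((g x - q j x)\<^sup>2) \<partial>per L) \<le> ennreal (L * (1/4)^j)" for j
  proof -
    have "(\<integral>\<^sup>+ x. ennreal ((g x - q j x)\<^sup>2) \<partial>per L) = (\<integral>\<^sup>+ x. liminf (\<lambda>i. ennreal ((q i x - q j x)\<^sup>2)) \<partial>per L)"
    proof (rule nn_integral_cong_AE)
      show "AE x in per L. ennreal ((g x - q j x)\<^sup>2) = liminf (\<lambda>i. ennreal ((q i x - q j x)\<^sup>2))"
        using aeg
      proof (rule AE_mp, intro AE_I2 impI)
        fix x assume "(\<lambda>j. q j x) \<longlonglongrightarrow> g x"
        then have "(\<lambda>i. ennreal ((q i x - q j x)\<^sup>2)) \<longlonglongrightarrow> ennreal ((g x - q j x)\<^sup>2)"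
          by (intro tendsto_intros tendsto_ennrealI)
        then show "ennreal ((g x - q j x)\<^sup>2) = liminf (\<lambda>i. ennreal ((q i x - q j x)\<^sup>2))"
          using lim_imp_Liminf[OF trivial_limit_sequentially] by metis
      qed
    qed
    also have "\<dots> \<le> liminf (\<lambda>i. \<integral>\<^sup>+ x. ennreal ((q i x - q j x)\<^sup>2) \<partial>per L)"
      by (rule nn_integral_liminf) measurable
    also have "\<dots> \<le> ennreal (L * (1/4)^j)"
    proof (rule Liminf_le[OF trivial_limit_sequentially])
      show "\<forall>\<^sub>F i in sequentially. (\<integral>\<^sup>+ x. ennreal ((q i x - q j x)\<^sup>2) \<partial>per L) \<le> ennreal (L * (1/4)^j)"
      proof (rule eventually_sequentiallyI[of j])
        fix i assume "j \<le> i"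
        have "(\<integral>\<^sup>+ x. ennreal ((q i x - q j x)\<^sup>2) \<partial>per L) = ennreal (iper L (\<lambda>x. (q i x - q j x)\<^sup>2))"
          by (rule nn_integral_eq_integral) (use L2_perD(3)[OF L2_per_diff[OF qL2 qL2]] in auto)
        then show "(\<integral>\<^sup>+ x. ennreal ((q i x - q j x)\<^sup>2) \<partial>per L) \<le> ennreal (L * (1/4)^j)"
          using qdiff[OF \<open>j \<le> i\<close>] by (simp add: ennreal_leI)
      qed
    qed
    finally show ?thesis .
  qed
  have gq: "(\<lambda>x. g x - q j x) \<in> L2_per L" for j
  proof -
    have "integrable (per L) (\<lambda>x. (g x - q j x)\<^sup>2)"
      unfolding integrable_iff_bounded using nn[of j] by (auto intro: le_less_trans)
    then show ?thesis using gper L2_perD(1)[OF qL2] by (simp add: L2_per_iff)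
  qed
  have gqn: "iper L (\<lambda>x. (g x - q j x)\<^sup>2) \<le> L * (1/4)^j" for j
  proof -
    have "ennreal (iper L (\<lambda>x. (g x - q j x)\<^sup>2)) = (\<integral>\<^sup>+ x. ennreal ((g x - q j x)\<^sup>2) \<partial>per L)"
      by (rule nn_integral_eq_integral[symmetric]) (use L2_perD(3)[OF gq] in auto)
    then have "ennreal (iper L (\<lambda>x. (g x - q j x)\<^sup>2)) \<le> ennreal (L * (1/4)^j)"
      using nn[of j] by simp
    then show ?thesis using L by (subst (asm) ennreal_le_iff) auto
  qed
  have gL2: "g \<in> L2_per L" using L2_per_add[OF gq[of 0] qL2[of 0]] by simp
  have coef: "fourier_coeff L g k = c k" for k
  proof -
    have bound: "cmod (fourier_coeff L g k - c k) \<le> (1/2)^j" if "nat \<bar>k\<bar> \<le> j" for j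
    proof -
      have "j \<le> r j" by (simp add: r_def)
      then have "nat \<bar>k\<bar> \<le> r j" using that by linarith
      then have "k \<in> S j" by (auto simp: S_def)
      then have "fourier_coeff L (q j) k = c k" unfolding q_def using fourier_coeff_trig[of L "S j" c k] S L c by simp
      then have "fourier_coeff L g k - c k = fourier_coeff L (\<lambda>x. g x - q j x) k"
        using fourier_coeff_diff[OF L2_per_integrable[OF gL2] L2_per_integrable[OF qL2]] by simp
      also have "cmod \<dots> \<le> (1 / L) * iper L (\<lambda>x. \<bar>g x - q j x\<bar>)"
        by (rule norm_fourier_coeff_le[OF L])
      also have "\<dots> \<le> (1 / L) * (sqrt L * sqrt (L * (1/4)^j))"
        using L gqn[of j] by (intro mult_left_mono order_trans[OF L2_norm_L1[OF L gq]] real_sqrt_le_mono) auto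
      also have "\<dots> = sqrt ((1/4)^j)" using L by (simp add: real_sqrt_mult mult.assoc[symmetric])
      also have "sqrt ((1/4)^j) = (1/2::real)^j"
        by (rule real_sqrt_unique) (simp_all add: power_mult_distrib[symmetric] power2_eq_square)
      finally show ?thesis .
    qed
    have "(\<lambda>j. (1/2::real)^j) \<longlonglongrightarrow> 0" by (intro LIMSEQ_power_zero) simp
    then have "cmod (fourier_coeff L g k - c k) \<le> 0"
      by (rule LIMSEQ_le_const) (use bound in blast)
    then show ?thesis by simp
  qed
  have "iper L (\<lambda>x. (g x)\<^sup>2) \<le> L * (\<Sum>\<^sub>\<infinity>k. (cmod (c k))\<^sup>2)"
  proof -
    have "iper L (\<lambda>x. (g x)\<^sup>2) \<le> L * (\<Sum>\<^sub>\<infinity>k. (cmod (c k))\<^sup>2) + L * (1/4)^j" for j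
    proof -
      have "iper L (\<lambda>x. (g x - q j x)\<^sup>2) = iper L (\<lambda>x. (g x)\<^sup>2) - L * (\<Sum>k\<in>S j. (cmod (c k))\<^sup>2)"
        unfolding q_def by (rule integral_diff_trig_sq[OF L S gL2]) (auto simp: coef c)
      moreover have "(\<Sum>k\<in>S j. (cmod (c k))\<^sup>2) \<le> (\<Sum>\<^sub>\<infinity>k. (cmod (c k))\<^sup>2)"
        using S by (intro finite_sum_le_infsum[OF sq]) auto
      moreover have "L * (\<Sum>k\<in>S j. (cmod (c k))\<^sup>2) \<le> L * (\<Sum>\<^sub>\<infinity>k. (cmod (c k))\<^sup>2)"
        using calculation(2) L by (intro mult_left_mono) auto
      ultimately show ?thesis using gqn[of j] by linarith
    qed
    moreover have "(\<lambda>j. L * (\<Sum>\<^sub>\<infinity>k. (cmod (c k))\<^sup>2) + L * (1/4)^j) \<longlonglongrightarrow> L * (\<Sum>\<^sub>\<infinity>k. (cmod (c k))\<^sup>2) + L * 0"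
      by (intro tendsto_intros LIMSEQ_power_zero) simp
    ultimately show ?thesis using LIMSEQ_le_const by fastforce
  qed
  moreover have "L * (\<Sum>\<^sub>\<infinity>k. (cmod (c k))\<^sup>2) \<le> iper L (\<lambda>x. (g x)\<^sup>2)"
  proof -
    have "(\<Sum>\<^sub>\<infinity>k. (cmod (c k))\<^sup>2) \<le> iper L (\<lambda>x. (g x)\<^sup>2) / L"
      by (rule infsum_le_finite_sums[OF sq]) (use bessel[OF L gL2] coef L in \<open>simp add: field_simps\<close>)
    then show ?thesis using L by (simp add: field_simps)
  qed
  ultimately show ?thesis using that[OF gL2 coef] by simp
qed

section \<open>Uniqueness of Fourier coefficients\<close>

text \<open>On the unit circle the conjugate of \<open>z\<close> is its inverse, so a real
  polynomial in the real and imaginary parts is a Laurent polynomial in \<open>cis t\<close>; the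
  factor \<open>cis (- (real N * t))\<close> supplies the negative powers.\<close>

lemma real_polynomial_function_cis:
  fixes p :: "complex \<Rightarrow> real"
  assumes "real_polynomial_function p"
  shows "\<exists>N q. \<forall>t. of_real (p (cis t)) = cis (- (real N * t)) * poly q (cis t)"
  using assms
proof (induction rule: real_polynomial_function.induct)
  case (linear f)
  interpret bounded_linear f by fact
  have cis1: "cis (- t) * cis t = 1" for t by (simp add: cis_mult)
  have f: "f z = Re z * f 1 + Im z * f \<i>" for z
  proof -
    have "z = Re z *\<^sub>R 1 + Im z *\<^sub>R \<i>" by (simp add: complex_eq_iff)
    then have "f z = f (Re z *\<^sub>R 1 + Im z *\<^sub>R \<i>)" by simp
    also have "\<dots> = Re z * f 1 + Im z * f \<i>" by (simp only: add scaleR real_scaleR_def)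
    finally show ?thesis .
  qed
  \<comment> \<open>\<open>Re z\<close> is the half sum of \<open>z\<close> and its conjugate, and
    \<open>Im z\<close> is \<open>- \<i>\<close> times their half difference. The constant
    coefficient belongs to the conjugate, the quadratic one to \<open>z\<close>.\<close>
  have "of_real (f (cis t)) = cis (- (real 1 * t)) *
      poly [:(of_real (f 1) + \<i> * of_real (f \<i>)) / 2, 0, (of_real (f 1) - \<i> * of_real (f \<i>)) / 2:] (cis t)" for t
  proof -
    have "cis (- (real 1 * t)) * poly [:(of_real (f 1) + \<i> * of_real (f \<i>)) / 2, 0, (of_real (f 1) - \<i> * of_real (f \<i>)) / 2:] (cis t)
      = cis (- t) * ((of_real (f 1) + \<i> * of_real (f \<i>)) / 2) + (cis (- t) * cis t) * cis t * ((of_real (f 1) - \<i> * of_real (f \<i>)) / 2)"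
      by (simp add: algebra_simps)
    also have "\<dots> = of_real (f (cis t))"
      unfolding cis1 by (simp add: f[of "cis t"] complex_eq_iff field_simps)
    finally show ?thesis by simp
  qed
  then show ?case by blast
next
  case (const c)
  show ?case by (rule exI[of _ 0], rule exI[of _ "[:of_real c:]"]) simp
next
  case (add f g)
  then obtain N q M r where *: "\<And>t. of_real (f (cis t)) = cis (- (real N * t)) * poly q (cis t)"
    "\<And>t. of_real (g (cis t)) = cis (- (real M * t)) * poly r (cis t)" by blast
  have "of_real (f (cis t) + g (cis t)) = cis (- (real (N + M) * t)) * poly (monom 1 M * q + monom 1 N * r) (cis t)" for t
  proof -
    have "cis (- (real (N + M) * t)) * cis t ^ M = cis (- (real N * t))" "cis (- (real (N + M) * t)) * cis t ^ N = cis (- (real M * t))"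
      by (simp_all add: Complex.DeMoivre cis_mult algebra_simps)
    then show ?thesis by (simp add: * poly_monom distrib_left mult.assoc[symmetric])
  qed
  then show ?case by blast
next
  case (mult f g)
  then obtain N q M r where *: "\<And>t. of_real (f (cis t)) = cis (- (real N * t)) * poly q (cis t)"
    "\<And>t. of_real (g (cis t)) = cis (- (real M * t)) * poly r (cis t)" by blast
  have "of_real (f (cis t) * g (cis t)) = cis (- (real (N + M) * t)) * poly (q * r) (cis t)" for t
  proof -
    have "cis (- (real (N + M) * t)) = cis (- (real N * t)) * cis (- (real M * t))"
      by (simp add: cis_mult algebra_simps)
    then show ?thesis by (simp add: * mult_ac)
  qed
  then show ?case by blast
qed

context
  fixes L :: real and g :: "real \<Rightarrow> real"
  assumes L: "L > 0" and g: "g \<in> L2_per L" and z: "\<And>k. fourier_coeff L g k = 0"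
begin

text \<open>The class of test functions on the circle is enlarged from polynomials to indicators of
  Borel sets. Here each Laurent monomial is a Fourier mode, against which \<open>g\<close>
  integrates to zero.\<close>

lemma zero_coeff_polynomial:
  fixes p :: "complex \<Rightarrow> real"
  assumes "real_polynomial_function p"
  shows "iper L (\<lambda>x. g x * p (emode L 1 x)) = 0"
proof -
  obtain N q where *: "\<And>t. of_real (p (cis t)) = cis (- (real N * t)) * poly q (cis t)"
    using real_polynomial_function_cis[OF assms] by blast
  have e: "of_real (p (emode L 1 x)) = (\<Sum>i\<le>degree q. coeff q i * emode L (int i - int N) x)" for x
  proof -
    have "cis (- (real N * (2 * pi * x / L))) * cis (2 * pi * x / L) ^ i = emode L (int i - int N) x" for i
      by (simp add: emode_def Complex.DeMoivre cis_mult algebra_simps diff_divide_distrib)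
    then have "of_real (p (cis (2 * pi * x / L))) = (\<Sum>i\<le>degree q. coeff q i * emode L (int i - int N) x)"
      by (simp add: * poly_altdef sum_distrib_left mult.left_commute)
    then show ?thesis by (simp add: emode_def)
  qed
  have int: "integrable (per L) (\<lambda>x. of_real (g x) * emode L k x)" for k
    by (rule integrable_emode_mult[OF L2_per_integrable[OF g]])
  have "of_real (iper L (\<lambda>x. g x * p (emode L 1 x)))
    = iper L (\<lambda>x. (of_real (g x * p (emode L 1 x))) :: complex)"
    by (rule integral_complex_of_real[symmetric])
  also have "\<dots> = iper L (\<lambda>x. \<Sum>i\<le>degree q. coeff q i * (of_real (g x) * emode L (int i - int N) x))"
    by (simp add: e sum_distrib_left mult.left_commute)
  also have "\<dots> = (\<Sum>i\<le>degree q. coeff q i * iper L (\<lambda>x. of_real (g x) * emode L (int i - int N) x))"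
    using int by (subst Bochner_Integration.integral_sum) auto
  also have "\<dots> = 0" by (simp add: integral_emode_mult[OF L] z)
  finally show ?thesis by simp
qed

lemma integrable_mult_bounded_per:
  assumes [measurable]: "h \<in> borel_measurable borel" and C: "\<And>x. \<bar>h x\<bar> \<le> C"
  shows "integrable (per L) (\<lambda>x. g x * h x)"
proof (rule Bochner_Integration.integrable_bound)
  show "integrable (per L) (\<lambda>x. C * \<bar>g x\<bar>)" using L2_per_integrable[OF g] by simp
  have [measurable]: "g \<in> borel_measurable borel" using L2_perD(2)[OF g] .
  show "(\<lambda>x. g x * h x) \<in> borel_measurable (per L)"
    by (intro borel_measurable_per) measurable
  have "C \<ge> 0" using C abs_ge_zero order_trans by blast
  then show "AE x in per L. norm (g x * h x) \<le> norm (C * \<bar>g x\<bar>)"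
    using C by (intro AE_I2) (simp add: abs_mult mult.commute[of "\<bar>g _\<bar>"] mult_right_mono)
qed

text \<open>Stone-Weierstrass on the unit circle. Pulling back by \<open>emode L 1\<close> makes
  every approximant periodic, which polynomials on \<open>{0..L}\<close> would not be.\<close>

lemma zero_coeff_continuous:
  fixes \<phi> :: "complex \<Rightarrow> real"
  assumes "continuous_on UNIV \<phi>"
  shows "iper L (\<lambda>x. g x * \<phi> (emode L 1 x)) = 0"
proof -
  have bound: "\<bar>iper L (\<lambda>x. g x * \<phi> (emode L 1 x))\<bar> \<le> e * (iper L (\<lambda>x. \<bar>g x\<bar>))" if e: "e > 0" for e
  proof -
    obtain p where p: "real_polynomial_function p" "\<And>x. x \<in> sphere 0 1 \<Longrightarrow> \<bar>\<phi> x - p x\<bar> < e"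
      using Stone_Weierstrass_real_polynomial_function[OF compact_sphere continuous_on_subset[OF assms subset_UNIV] e] by blast
    have pc: "continuous_on UNIV p" using p(1) by (simp add: continuous_on_polymonial_function real_polynomial_function_eq)
    have [measurable]: "p \<in> borel_measurable borel" "\<phi> \<in> borel_measurable borel" "g \<in> borel_measurable borel"
      using pc assms L2_perD(2)[OF g] by (auto intro: borel_measurable_continuous_onI)
    have le: "\<bar>\<phi> (emode L 1 x) - p (emode L 1 x)\<bar> \<le> e" for x using p(2)[of "emode L 1 x"] by simp
    have i: "integrable (per L) (\<lambda>x. g x * (\<phi> (emode L 1 x) - p (emode L 1 x)))"
      by (rule integrable_mult_bounded_per[OF _ le]) measurable
    have "compact (p ` sphere 0 1)" by (intro compact_continuous_image continuous_on_subset[OF pc]) auto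
    then obtain B where B: "\<And>x. x \<in> sphere 0 1 \<Longrightarrow> \<bar>p x\<bar> \<le> B"
      by (force dest!: compact_imp_bounded simp: bounded_iff)
    have ip: "integrable (per L) (\<lambda>x. g x * p (emode L 1 x))"
      by (rule integrable_mult_bounded_per[of _ B]) (measurable, simp add: B)
    have "iper L (\<lambda>x. g x * \<phi> (emode L 1 x))
      = iper L (\<lambda>x. g x * (\<phi> (emode L 1 x) - p (emode L 1 x)) + g x * p (emode L 1 x))"
      by (simp add: algebra_simps)
    also have "\<dots> = iper L (\<lambda>x. g x * (\<phi> (emode L 1 x) - p (emode L 1 x)))"
      using i ip zero_coeff_polynomial[OF p(1)] by simp
    also have "\<bar>\<dots>\<bar> \<le> iper L (\<lambda>x. \<bar>g x * (\<phi> (emode L 1 x) - p (emode L 1 x))\<bar>)"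
      by (rule integral_abs_bound)
    also have "\<dots> \<le> iper L (\<lambda>x. e * \<bar>g x\<bar>)"
    proof (rule integral_mono)
      show "integrable (per L) (\<lambda>x. \<bar>g x * (\<phi> (emode L 1 x) - p (emode L 1 x))\<bar>)"
        using integrable_norm[OF i] by simp
      show "integrable (per L) (\<lambda>x. e * \<bar>g x\<bar>)" using L2_per_integrable[OF g] by simp
      show "\<bar>g x * (\<phi> (emode L 1 x) - p (emode L 1 x))\<bar> \<le> e * \<bar>g x\<bar>" for x
        using le[of x] by (simp add: abs_mult mult.commute[of "\<bar>g _\<bar>"] mult_right_mono)
    qed
    finally show ?thesis by simp
  qed
  show ?thesis
  proof (rule ccontr)
    assume nz: "iper L (\<lambda>x. g x * \<phi> (emode L 1 x)) \<noteq> 0"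
    define J where "J = iper L (\<lambda>x. \<bar>g x\<bar>)"
    define I where "I = \<bar>iper L (\<lambda>x. g x * \<phi> (emode L 1 x))\<bar>"
    have "J \<ge> 0" "I > 0" using nz by (auto simp: J_def I_def)
    \<comment> \<open>With this \<open>e\<close> the bound reads
      \<open>I \<le> I * J / (2 * (J + 1))\<close>, impossible for positive \<open>I\<close>; the 1
      covers \<open>J = 0\<close>.\<close>
    moreover from this have "0 < I / (2 * (J + 1))" by simp
    from bound[OF this] have "I \<le> I / (2 * (J + 1)) * J" by (simp only: I_def J_def)
    then have "2 * (J + 1) * I \<le> I * J" using \<open>J \<ge> 0\<close> by (simp add: field_simps)
    then have "I * (J + 2) \<le> 0" by (simp add: algebra_simps)
    ultimately show False by (simp add: mult_le_0_iff)
  qed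
qed

text \<open>The cutoffs built from the distance to \<open>K\<close> are continuous, bounded by 1 and
  decrease to the indicator, so dominated convergence applies. The empty set is excluded because its
  \<open>infdist\<close> is 0 by convention.\<close>

lemma zero_coeff_closed:
  fixes K :: "complex set"
  assumes K: "closed K" "K \<noteq> {}"
  shows "iper L (\<lambda>x. g x * indicator K (emode L 1 x)) = 0"
proof -
  define \<phi> where "\<phi> n z = max 0 (1 - real n * infdist z K)" for n z
  have cont: "continuous_on UNIV (\<phi> n)" for n unfolding \<phi>_def
    by (intro continuous_intros)
  have lim: "(\<lambda>n. \<phi> n z) \<longlonglongrightarrow> indicator K z" for z
  proof (cases "z \<in> K")
    case True
    then show ?thesis by (simp add: \<phi>_def)
  next
    case False
    then have "infdist z K > 0"
      using in_closed_iff_infdist_zero[OF K] infdist_nonneg[of z K] by (metis less_eq_real_def)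
    then obtain n0 where n0: "1 \<le> real n0 * infdist z K"
      using reals_Archimedean3 less_imp_le by metis
    have "\<phi> n z = 0" if "n \<ge> n0" for n
    proof -
      have "real n0 * infdist z K \<le> real n * infdist z K" using that infdist_nonneg by (intro mult_right_mono) auto
      then show ?thesis using n0 by (simp add: \<phi>_def)
    qed
    then show ?thesis using False
      by (intro tendsto_eventually) (auto simp: eventually_sequentially intro!: exI[of _ n0])
  qed
  have [measurable]: "\<phi> n \<in> borel_measurable borel" for n using cont by (rule borel_measurable_continuous_onI)
  have [measurable]: "g \<in> borel_measurable borel" using L2_perD(2)[OF g] .
  have [measurable]: "K \<in> sets borel" using K by auto
  have "(\<lambda>n. iper L (\<lambda>x. g x * \<phi> n (emode L 1 x))) \<longlonglongrightarrow> iper L (\<lambda>x. g x * indicator K (emode L 1 x))"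
  proof (rule integral_dominated_convergence[where w="\<lambda>x. \<bar>g x\<bar>"])
    show "(\<lambda>x. g x * indicator K (emode L 1 x)) \<in> borel_measurable (per L)" by (intro borel_measurable_per) measurable
    show "(\<lambda>x. g x * \<phi> n (emode L 1 x)) \<in> borel_measurable (per L)" for n by (intro borel_measurable_per) measurable
    show "integrable (per L) (\<lambda>x. \<bar>g x\<bar>)" using L2_per_integrable[OF g] by simp
    show "AE x in per L. (\<lambda>n. g x * \<phi> n (emode L 1 x)) \<longlonglongrightarrow> g x * indicator K (emode L 1 x)"
      by (intro AE_I2 tendsto_mult tendsto_const lim)
    have "\<bar>\<phi> n z\<bar> \<le> 1" for n z by (simp add: \<phi>_def infdist_nonneg)
    then show "AE x in per L. norm (g x * \<phi> n (emode L 1 x)) \<le> \<bar>g x\<bar>" for n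
      by (intro AE_I2) (simp add: abs_mult mult_left_le)
  qed
  then have "(\<lambda>n. 0) \<longlonglongrightarrow> iper L (\<lambda>x. g x * indicator K (emode L 1 x))"
    by (simp add: zero_coeff_continuous[OF cont])
  then show ?thesis by (simp add: LIMSEQ_const_iff)
qed

text \<open>\<open>s\<close> has to be interior because the endpoints 0 and \<open>L\<close> have
  the same image.\<close>

lemma emode_inj:
  assumes "emode L 1 s = emode L 1 t" "0 < s" "s < L" "0 \<le> t" "t \<le> L"
  shows "s = t"
proof -
  have "sin (2 * pi * s / L) = sin (2 * pi * t / L) \<and> cos (2 * pi * s / L) = cos (2 * pi * t / L)"
    using assms(1) by (simp add: emode_def complex_eq_iff)
  then obtain n :: int where "2 * pi * s / L = 2 * pi * t / L + 2 * pi * n"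
    unfolding sin_cos_eq_iff by blast
  then have "2 * pi * s = 2 * pi * (t + L * n)" using L by (simp add: field_simps)
  then have n: "s = t + L * n" by simp
  have "L * n < L * 1" "L * (-1) < L * n" using assms n by linarith+
  then have "of_int n < (1::real)" "(-1::real) < of_int n" using L by (simp_all only: mult_less_cancel_left_pos)
  then have "n = 0" by linarith
  then show ?thesis using n by simp
qed

text \<open>The image of the interval is a compact arc, and its preimage in \<open>{0..L}\<close> is
  the interval again except possibly at the identified endpoints, a null set.\<close>

lemma zero_coeff_interval:
  assumes "a \<le> b"
  shows "iper L (\<lambda>x. g x * indicator {a..b} x) = 0"
proof (cases "{a..b} \<inter> {0..L} = {}")
  case True
  have "iper L (\<lambda>x. g x * indicator {a..b} x) = iper L (\<lambda>x. 0)"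
    by (rule Bochner_Integration.integral_cong) (use True in \<open>auto simp: indicator_def\<close>)
  then show ?thesis by simp
next
  case False
  define K where "K = emode L 1 ` ({a..b} \<inter> {0..L})"
  have "compact K" unfolding K_def
    by (intro compact_continuous_image continuous_on_emode) auto
  then have K: "closed K" "K \<noteq> {}" using False by (auto simp: K_def compact_imp_closed)
  have [measurable]: "g \<in> borel_measurable borel" "K \<in> sets borel" using L2_perD(2)[OF g] K by auto
  have "iper L (\<lambda>x. g x * indicator {a..b} x) = iper L (\<lambda>x. g x * indicator K (emode L 1 x))"
  proof (rule integral_cong_AE)
    have "AE x in lborel. x \<noteq> 0 \<and> x \<noteq> L" using AE_lborel_singleton[of 0] AE_lborel_singleton[of L] by (rule AE_conjI)
    then show "AE x in per L. g x * indicator {a..b} x = g x * indicator K (emode L 1 x)"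
      unfolding AE_per_iff
    proof (rule AE_mp, intro AE_I2 impI)
      fix x assume x: "x \<noteq> 0 \<and> x \<noteq> L" "x \<in> {0..L}"
      have "emode L 1 x \<in> K \<longleftrightarrow> x \<in> {a..b}"
      proof
        assume "emode L 1 x \<in> K"
        then obtain y where "y \<in> {a..b}" "y \<in> {0..L}" "emode L 1 x = emode L 1 y" by (auto simp: K_def)
        then show "x \<in> {a..b}" using emode_inj[of x y] x by auto
      qed (use x in \<open>auto simp: K_def\<close>)
      then show "g x * indicator {a..b} x = g x * indicator K (emode L 1 x)" by (simp add: indicator_def)
    qed
  qed (intro borel_measurable_per; measurable)+
  then show ?thesis using zero_coeff_closed[OF K] by simp
qed

lemma integrable_mult_indicator_per:
  "A \<in> sets borel \<Longrightarrow> integrable (per L) (\<lambda>x. g x * indicator A x)"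
  by (rule integrable_mult_bounded_per[of _ 1]) (auto simp: indicator_def)

lemma zero_coeff_borel:
  assumes "A \<in> sets borel"
  shows "iper L (\<lambda>x. g x * indicator A x) = 0"
  using assms
proof (induction rule: borel_set_induct)
  case (interval a b)
  then show ?case by (rule zero_coeff_interval)
next
  case (compl A)
  note iA = integrable_mult_indicator_per[OF compl(1)]
  have "iper L (\<lambda>x. g x * indicator (- A) x) = iper L (\<lambda>x. g x - g x * indicator A x)"
    by (intro Bochner_Integration.integral_cong) (auto simp: indicator_def)
  also have "\<dots> = iper L g"
    using iA compl L2_per_integrable[OF g] by simp
  also have "\<dots> = 0"
    using zero_coeff_continuous[of "\<lambda>x. 1"] by simp
  finally show ?case .
next
  case (union f)
  have [measurable]: "g \<in> borel_measurable borel" "\<And>i. f i \<in> sets borel" using L2_perD(2)[OF g] union by auto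
  have "(\<lambda>n. iper L (\<lambda>x. g x * indicator (\<Union>i<n. f i) x)) \<longlonglongrightarrow> iper L (\<lambda>x. g x * indicator (\<Union>i. f i) x)"
  proof (rule integral_dominated_convergence[where w="\<lambda>x. \<bar>g x\<bar>"])
    show "AE x in per L. (\<lambda>n. g x * indicator (\<Union>i<n. f i) x) \<longlonglongrightarrow> g x * indicator (\<Union>i. f i) x"
      by (intro AE_I2 tendsto_mult tendsto_const LIMSEQ_indicator_UN)
    show "AE x in per L. norm (g x * indicator (\<Union>i<n. f i) x) \<le> \<bar>g x\<bar>" for n
      by (intro AE_I2) (simp add: indicator_def)
  qed (use L2_per_integrable[OF g] in \<open>auto intro!: borel_measurable_per\<close>)
  moreover have "iper L (\<lambda>x. g x * indicator (\<Union>i<n. f i) x) = 0" for n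
  proof -
    have int: "integrable (per L) (\<lambda>x. g x * indicator (f i) x)" for i
      by (rule integrable_mult_indicator_per) measurable
    have "(indicator (\<Union>i<n. f i) x :: real) = (\<Sum>i<n. indicator (f i) x)" for x
      by (rule indicator_UN_disjoint[OF finite_lessThan disjoint_family_on_mono[OF subset_UNIV union(1)]])
    then have "iper L (\<lambda>x. g x * indicator (\<Union>i<n. f i) x)
        = (\<Sum>i<n. iper L (\<lambda>x. g x * indicator (f i) x))"
      by (simp only: sum_distrib_left Bochner_Integration.integral_sum[OF int])
    then show ?thesis by (simp only: union.IH sum.neutral_const)
  qed
  ultimately show ?case by (simp add: LIMSEQ_const_iff)
qed simp

theorem zero_coeff_AE: "AE x in per L. g x = 0"
proof (rule sigma_finite_measure.density_zero)
  show "sigma_finite_measure (per L)" using finite_measure_per by (simp add: finite_measure_def)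
  show "integrable (per L) g" using L2_per_integrable[OF g] .
  fix A assume "A \<in> sets (per L)"
  then have "A \<in> sets borel" by (auto simp: per_def sets_restrict_space)
  then show "set_lebesgue_integral (per L) A g = 0"
    using zero_coeff_borel by (simp add: set_lebesgue_integral_def mult.commute)
qed

end

section \<open>Parseval identity, weighted norms, and Rellich compactness\<close>

lemma L2_per_eq_AE:
  assumes L: "L > 0" and g: "g \<in> L2_per L" and h: "h \<in> L2_per L"
    and eq: "\<And>k. fourier_coeff L g k = fourier_coeff L h k"
  shows "AE x in lborel. g x = h x"
proof -
  have d: "(\<lambda>x. g x - h x) \<in> L2_per L" by (rule L2_per_diff[OF g h])
  have "AE x in per L. g x - h x = 0"
    by (rule zero_coeff_AE[OF L d]) (simp add: fourier_coeff_diff L2_per_integrable g h eq)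
  then have "AE x in lborel. g x - h x = 0"
    by (intro periodic_AE[OF L]) (use L2_perD[OF d] in auto)
  then show ?thesis by simp
qed

text \<open>The function that Riesz-Fischer builds from the coefficients of \<open>g\<close> has the
  right norm, and uniqueness of coefficients identifies it with \<open>g\<close>.\<close>

lemma parseval:
  assumes L: "L > 0" and g: "g \<in> L2_per L"
  shows "iper L (\<lambda>x. (g x)\<^sup>2) = L * (\<Sum>\<^sub>\<infinity>k. (cmod (fourier_coeff L g k))\<^sup>2)"
proof -
  obtain h where h: "h \<in> L2_per L" "\<And>k. fourier_coeff L h k = fourier_coeff L g k"
    "iper L (\<lambda>x. (h x)\<^sup>2) = L * (\<Sum>\<^sub>\<infinity>k. (cmod (fourier_coeff L g k))\<^sup>2)"
    using riesz_fischer[OF L fourier_coeff_square_summable[OF L g] fourier_coeff_minus] by blast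
  have "AE x in per L. g x = h x"
    by (intro AE_perI L2_per_eq_AE[OF L g h(1)]) (simp add: h)
  then have "iper L (\<lambda>x. (g x)\<^sup>2) = iper L (\<lambda>x. (h x)\<^sup>2)"
    using L2_perD(2)[OF g] L2_perD(2)[OF h(1)]
    by (intro integral_cong_AE borel_measurable_per borel_measurable_power) auto
  then show ?thesis using h(3) by simp
qed

section \<open>Weighted inner products of coefficient sequences\<close>

definition wfin :: "(int \<Rightarrow> real) \<Rightarrow> (int \<Rightarrow> complex) \<Rightarrow> bool" where
  "wfin a c \<longleftrightarrow> (\<lambda>k. a k * (cmod (c k))\<^sup>2) summable_on UNIV"

text \<open>The weight is left general: 1 gives L2, \<open>sobw s\<close> the Sobolev norm and
  \<open>th\<close> the form of the multiplier. Real parts make it a real bilinear form on complex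
  sequences.\<close>

definition wip :: "(int \<Rightarrow> real) \<Rightarrow> (int \<Rightarrow> complex) \<Rightarrow> (int \<Rightarrow> complex) \<Rightarrow> real" where
  "wip a c d = (\<Sum>\<^sub>\<infinity>k. a k * Re (c k * cnj (d k)))"

lemma wip_self: "wip a c c = (\<Sum>\<^sub>\<infinity>k. a k * (cmod (c k))\<^sup>2)"
  unfolding wip_def by (rule infsum_cong) (simp add: complex_mult_cnj cmod_power2)

lemma wip_commute: "wip a c d = wip a d c"
  unfolding wip_def by (rule infsum_cong) (simp add: algebra_simps)

context
  fixes a :: "int \<Rightarrow> real"
  assumes a: "\<And>k. a k \<ge> 0"
begin

lemma wip_nonneg: "wip a c c \<ge> 0"
  unfolding wip_self by (rule infsum_nonneg) (simp add: a)

lemma wfin_lin: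
  assumes "wfin a c" "wfin a d"
  shows "wfin a (\<lambda>k. of_real s * c k + of_real t * d k)"
proof -
  have "(\<lambda>k. (2 * s\<^sup>2) * (a k * (cmod (c k))\<^sup>2) + (2 * t\<^sup>2) * (a k * (cmod (d k))\<^sup>2)) summable_on UNIV"
    using assms by (intro summable_on_add summable_on_cmult_right) (auto simp: wfin_def)
  then show ?thesis unfolding wfin_def
  proof (rule summable_on_comparison_test)
    fix k
    have "cmod (of_real s * c k + of_real t * d k) \<le> \<bar>s\<bar> * cmod (c k) + \<bar>t\<bar> * cmod (d k)"
      by (rule order_trans[OF norm_triangle_ineq]) (simp add: norm_mult)
    then have "(cmod (of_real s * c k + of_real t * d k))\<^sup>2 \<le> (\<bar>s\<bar> * cmod (c k) + \<bar>t\<bar> * cmod (d k))\<^sup>2"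
      by (rule power_mono) simp
    also have "\<dots> \<le> 2 * (\<bar>s\<bar> * cmod (c k))\<^sup>2 + 2 * (\<bar>t\<bar> * cmod (d k))\<^sup>2"
      using zero_le_power2[of "\<bar>s\<bar> * cmod (c k) - \<bar>t\<bar> * cmod (d k)"] by (simp add: power2_sum power2_diff)
    finally have "(cmod (of_real s * c k + of_real t * d k))\<^sup>2 \<le> 2 * s\<^sup>2 * (cmod (c k))\<^sup>2 + 2 * t\<^sup>2 * (cmod (d k))\<^sup>2"
      by (simp add: power_mult_distrib mult.assoc)
    from mult_left_mono[OF this a[of k]]
    show "a k * (cmod (of_real s * c k + of_real t * d k))\<^sup>2 \<le> 2 * s\<^sup>2 * (a k * (cmod (c k))\<^sup>2) + 2 * t\<^sup>2 * (a k * (cmod (d k))\<^sup>2)"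
      by (simp add: algebra_simps)
  qed (simp add: a)
qed

lemma wip_summable:
  assumes "wfin a c" "wfin a d"
  shows "(\<lambda>k. a k * Re (c k * cnj (d k))) summable_on UNIV"
proof -
  have "(\<lambda>k. norm (a k * Re (c k * cnj (d k)))) summable_on UNIV"
  proof (rule Infinite_Sum.abs_summable_on_comparison_test')
    show "(\<lambda>k. a k * (cmod (c k))\<^sup>2 + a k * (cmod (d k))\<^sup>2) summable_on UNIV"
      using assms by (intro summable_on_add) (auto simp: wfin_def)
    fix k
    have "\<bar>Re (c k * cnj (d k))\<bar> \<le> cmod (c k) * cmod (d k)"
      using abs_Re_le_cmod[of "c k * cnj (d k)"] by (simp add: norm_mult)
    also have "\<dots> \<le> (cmod (c k))\<^sup>2 + (cmod (d k))\<^sup>2"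
      using zero_le_power2[of "cmod (c k) - cmod (d k)"] zero_le_power2[of "cmod (c k)"] zero_le_power2[of "cmod (d k)"]
      by (simp only: power2_diff)
    finally have "\<bar>Re (c k * cnj (d k))\<bar> \<le> (cmod (c k))\<^sup>2 + (cmod (d k))\<^sup>2" .
    from mult_left_mono[OF this a[of k]]
    show "norm (a k * Re (c k * cnj (d k))) \<le> a k * (cmod (c k))\<^sup>2 + a k * (cmod (d k))\<^sup>2"
      using a[of k] by (simp only: abs_mult real_norm_def distrib_left abs_of_nonneg)
  qed
  then show ?thesis by (rule abs_summable_summable)
qed

lemma wip_lin_left:
  assumes "wfin a c" "wfin a d" "wfin a e"
  shows "wip a (\<lambda>k. of_real s * c k + of_real t * d k) e = s * wip a c e + t * wip a d e"
proof -
  have "wip a (\<lambda>k. of_real s * c k + of_real t * d k) e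
    = (\<Sum>\<^sub>\<infinity>k. s * (a k * Re (c k * cnj (e k))) + t * (a k * Re (d k * cnj (e k))))"
    unfolding wip_def by (rule infsum_cong) (simp add: algebra_simps)
  also have "\<dots> = s * wip a c e + t * wip a d e"
    unfolding wip_def using wip_summable[OF assms(1,3)] wip_summable[OF assms(2,3)]
    by (subst infsum_add) (auto intro: summable_on_cmult_right simp: infsum_cmult_right')
  finally show ?thesis .
qed

lemma wip_lin_self:
  assumes "wfin a c" "wfin a d"
  shows "wip a (\<lambda>k. of_real s * c k + of_real t * d k) (\<lambda>k. of_real s * c k + of_real t * d k)
    = s\<^sup>2 * wip a c c + 2 * s * t * wip a c d + t\<^sup>2 * wip a d d"
proof -
  note f = wfin_lin[OF assms, of s t]
  show ?thesis
    using wip_lin_left[OF assms f, of s t] wip_lin_left[OF assms assms(1), of s t] wip_lin_left[OF assms assms(2), of s t]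
      wip_commute[of a c "\<lambda>k. of_real s * c k + of_real t * d k"]
      wip_commute[of a d "\<lambda>k. of_real s * c k + of_real t * d k"] wip_commute[of a d c]
    by (simp add: power2_eq_square algebra_simps)
qed

lemma wip_cauchy_schwarz:
  assumes "wfin a c" "wfin a d"
  shows "\<bar>wip a c d\<bar> \<le> sqrt (wip a c c) * sqrt (wip a d d)"
proof (rule quadratic_cauchy_schwarz)
  fix s t
  show "0 \<le> s\<^sup>2 * wip a c c + 2 * s * t * wip a c d + t\<^sup>2 * wip a d d"
    using wip_nonneg wip_lin_self[OF assms, of s t] by metis
qed

lemma wip_triangle:
  assumes "wfin a c" "wfin a d"
  shows "sqrt (wip a (\<lambda>k. c k + d k) (\<lambda>k. c k + d k)) \<le> sqrt (wip a c c) + sqrt (wip a d d)"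
proof (rule real_le_lsqrt)
  have "wip a (\<lambda>k. c k + d k) (\<lambda>k. c k + d k) = wip a c c + 2 * wip a c d + wip a d d"
    using wip_lin_self[OF assms, of 1 1] by simp
  also have "\<dots> \<le> wip a c c + 2 * (sqrt (wip a c c) * sqrt (wip a d d)) + wip a d d"
    using wip_cauchy_schwarz[OF assms] by simp
  also have "\<dots> = (sqrt (wip a c c) + sqrt (wip a d d))\<^sup>2"
    using wip_nonneg by (simp add: power2_sum)
  finally show "wip a (\<lambda>k. c k + d k) (\<lambda>k. c k + d k) \<le> (sqrt (wip a c c) + sqrt (wip a d d))\<^sup>2" .
qed (use wip_nonneg in simp)

lemma wfin_bounded:
  assumes "\<And>F. finite F \<Longrightarrow> (\<Sum>k\<in>F. a k * (cmod (c k))\<^sup>2) \<le> R"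
  shows "wfin a c" "wip a c c \<le> R"
proof -
  show 1: "wfin a c" unfolding wfin_def
    by (rule nonneg_bdd_above_summable_on) (use a assms in \<open>auto intro!: bdd_aboveI2[where M=R]\<close>)
  show "wip a c c \<le> R" unfolding wip_self
    by (rule infsum_le_finite_sums) (use 1 assms in \<open>auto simp: wfin_def\<close>)
qed

lemma wsum_le_wip: "wfin a c \<Longrightarrow> finite F \<Longrightarrow> (\<Sum>k\<in>F. a k * (cmod (c k))\<^sup>2) \<le> wip a c c"
  unfolding wip_self wfin_def by (rule finite_sum_le_infsum) (auto simp: a)

text \<open>Finite partial sums pass to the limit and are bounded by the full sums, as in Fatou's
  lemma. The bounds \<open>R n\<close> may vary, so that minimizing sequences are covered.\<close>

lemma wip_lsc:
  assumes conv: "\<And>k. (\<lambda>n. c n k) \<longlonglongrightarrow> d k" and fin: "\<And>n. wfin a (c n)"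
    and R: "\<And>n. wip a (c n) (c n) \<le> R n" "R \<longlonglongrightarrow> R0"
  shows "wfin a d" "wip a d d \<le> R0"
proof -
  have "(\<Sum>k\<in>F. a k * (cmod (d k))\<^sup>2) \<le> R0" if "finite F" for F
  proof (rule LIMSEQ_le[OF _ R(2)])
    show "(\<lambda>n. \<Sum>k\<in>F. a k * (cmod (c n k))\<^sup>2) \<longlonglongrightarrow> (\<Sum>k\<in>F. a k * (cmod (d k))\<^sup>2)"
      by (intro tendsto_intros conv)
    show "\<exists>N. \<forall>n\<ge>N. (\<Sum>k\<in>F. a k * (cmod (c n k))\<^sup>2) \<le> R n"
      using wsum_le_wip[OF fin that] R(1) order_trans by blast
  qed
  then show "wfin a d" "wip a d d \<le> R0" using wfin_bounded by blast+
qed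

end

lemma wfin_mono:
  assumes "wfin b c" "\<And>k. 0 \<le> a k" "\<And>k. a k \<le> C * b k"
  shows "wfin a c" "wip a c c \<le> C * wip b c c"
proof -
  have s: "(\<lambda>k. C * (b k * (cmod (c k))\<^sup>2)) summable_on UNIV"
    using assms by (auto simp: wfin_def intro: summable_on_cmult_right)
  have le: "a k * (cmod (c k))\<^sup>2 \<le> C * (b k * (cmod (c k))\<^sup>2)" for k
    using mult_right_mono[OF assms(3)[of k], of "(cmod (c k))\<^sup>2"] by (simp add: mult.assoc)
  show f: "wfin a c" unfolding wfin_def
    by (rule summable_on_comparison_test[OF s]) (use le assms in auto)
  show "wip a c c \<le> C * wip b c c"
    unfolding wip_self infsum_cmult_right'[symmetric]
    by (rule infsum_mono) (use f s le in \<open>auto simp: wfin_def\<close>)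
qed

lemma wfin_add_weight:
  assumes "wfin a c" "wfin b c"
  shows "wfin (\<lambda>k. a k + b k) c" "wip (\<lambda>k. a k + b k) c c = wip a c c + wip b c c"
  using assms unfolding wfin_def wip_self by (auto simp: distrib_right intro: summable_on_add infsum_add)

lemma wfin_fourier: "L > 0 \<Longrightarrow> g \<in> L2_per L \<Longrightarrow> wfin (\<lambda>k. 1) (fourier_coeff L g)"
  using fourier_coeff_square_summable by (simp add: wfin_def)

lemma parseval_self:
  "L > 0 \<Longrightarrow> g \<in> L2_per L \<Longrightarrow> iper L (\<lambda>x. (g x)\<^sup>2) = L * wip (\<lambda>k. 1) (fourier_coeff L g) (fourier_coeff L g)"
  by (simp add: parseval wip_self)

lemma fourier_coeff_L2_lin:
  "g \<in> L2_per L \<Longrightarrow> h \<in> L2_per L \<Longrightarrow>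
    fourier_coeff L (\<lambda>x. a * g x + b * h x) = (\<lambda>k. of_real a * fourier_coeff L g k + of_real b * fourier_coeff L h k)"
  by (rule ext) (intro fourier_coeff_lin L2_per_integrable)

text \<open>Polarization of \<open>parseval_self\<close>.\<close>

lemma parseval_ip:
  assumes L: "L > 0" and g: "g \<in> L2_per L" and h: "h \<in> L2_per L"
  shows "iper L (\<lambda>x. g x * h x) = L * wip (\<lambda>k. 1) (fourier_coeff L g) (fourier_coeff L h)"
proof -
  let ?G = "fourier_coeff L g" and ?H = "fourier_coeff L h"
  have "iper L (\<lambda>x. (1 * g x + 1 * h x)\<^sup>2) = iper L (\<lambda>x. (g x)\<^sup>2 + 2 * (g x * h x) + (h x)\<^sup>2)"
    by (simp add: power2_sum algebra_simps)
  also have "\<dots> = iper L (\<lambda>x. (g x)\<^sup>2) + 2 * iper L (\<lambda>x. g x * h x) + iper L (\<lambda>x. (h x)\<^sup>2)"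
    using L2_per_mult_integrable[OF g h] L2_perD(3)[OF g] L2_perD(3)[OF h] by simp
  finally have 1: "iper L (\<lambda>x. (1 * g x + 1 * h x)\<^sup>2) = \<dots>" .
  have "iper L (\<lambda>x. (1 * g x + 1 * h x)\<^sup>2) = L * (1\<^sup>2 * wip (\<lambda>k. 1) ?G ?G + 2 * 1 * 1 * wip (\<lambda>k. 1) ?G ?H + 1\<^sup>2 * wip (\<lambda>k. 1) ?H ?H)"
    unfolding parseval_self[OF L L2_per_lin[OF g h]] fourier_coeff_L2_lin[OF g h]
    by (subst wip_lin_self) (use wfin_fourier[OF L] g h in auto)
  then show ?thesis using 1 unfolding parseval_self[OF L g] parseval_self[OF L h]
    by (simp add: distrib_left)
qed

section \<open>Periodic Sobolev spaces\<close>

definition sobw :: "real \<Rightarrow> int \<Rightarrow> real" where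
  "sobw s k = (1 + (of_int k)\<^sup>2) powr s"

lemma sobw_pos: "sobw s k > 0"
  unfolding sobw_def by (simp add: add_pos_nonneg less_imp_neq[THEN not_sym])

lemma sobw_nonneg [simp]: "sobw s k \<ge> 0"
  using sobw_pos[of s k] by simp

lemma sobw_ge_1: "s \<ge> 0 \<Longrightarrow> sobw s k \<ge> 1"
  unfolding sobw_def by (rule ge_one_powr_ge_zero) auto

lemma H_per_iff: "g \<in> H_per L s \<longleftrightarrow> g \<in> L2_per L \<and> wfin (sobw s) (fourier_coeff L g)"
  by (simp add: H_per_def wfin_def sobw_def)

lemma H_norm_eq: "H_norm L s g = sqrt (L * wip (sobw s) (fourier_coeff L g) (fourier_coeff L g))"
  by (simp add: H_norm_def wip_self sobw_def)

lemma H_norm_sq: "L > 0 \<Longrightarrow> (H_norm L s g)\<^sup>2 = L * wip (sobw s) (fourier_coeff L g) (fourier_coeff L g)"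
  by (simp add: H_norm_eq wip_nonneg)

lemma H_norm_nonneg: "L > 0 \<Longrightarrow> H_norm L s g \<ge> 0"
  by (simp add: H_norm_eq wip_nonneg)

lemma H_per_L2: "g \<in> H_per L s \<Longrightarrow> g \<in> L2_per L"
  by (simp add: H_per_iff)

lemma H_per_lin: "g \<in> H_per L s \<Longrightarrow> h \<in> H_per L s \<Longrightarrow> (\<lambda>x. a * g x + b * h x) \<in> H_per L s"
  by (auto simp: H_per_iff L2_per_lin fourier_coeff_L2_lin intro: wfin_lin)

lemma H_per_add: "g \<in> H_per L s \<Longrightarrow> h \<in> H_per L s \<Longrightarrow> (\<lambda>x. g x + h x) \<in> H_per L s"
  using H_per_lin[of g L s h 1 1] by simp

lemma H_per_diff: "g \<in> H_per L s \<Longrightarrow> h \<in> H_per L s \<Longrightarrow> (\<lambda>x. g x - h x) \<in> H_per L s"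
  using H_per_lin[of g L s h 1 "-1"] by simp

lemma H_per_cmult: "g \<in> H_per L s \<Longrightarrow> (\<lambda>x. a * g x) \<in> H_per L s"
  using H_per_lin[of g L s g a 0] by simp

lemma H_norm_triangle:
  assumes L: "L > 0" and g: "g \<in> H_per L s" and h: "h \<in> H_per L s"
  shows "H_norm L s (\<lambda>x. g x + h x) \<le> H_norm L s g + H_norm L s h"
proof -
  have "fourier_coeff L (\<lambda>x. g x + h x) = (\<lambda>k. fourier_coeff L g k + fourier_coeff L h k)"
    using fourier_coeff_L2_lin[of g L h 1 1] g h by (simp add: H_per_L2)
  then show ?thesis using wip_triangle[of "sobw s" "fourier_coeff L g" "fourier_coeff L h"] g h L
    by (simp add: H_norm_eq H_per_iff real_sqrt_mult distrib_left[symmetric])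
qed

lemma H_norm_cmult:
  assumes "L > 0"
  shows "H_norm L s (\<lambda>x. a * g x) = \<bar>a\<bar> * H_norm L s g"
proof -
  have "wip (sobw s) (fourier_coeff L (\<lambda>x. a * g x)) (fourier_coeff L (\<lambda>x. a * g x)) = a\<^sup>2 * wip (sobw s) (fourier_coeff L g) (fourier_coeff L g)"
    unfolding wip_self infsum_cmult_right'[symmetric]
    by (rule infsum_cong) (simp add: fourier_coeff_cmult norm_mult power_mult_distrib algebra_simps)
  then show ?thesis by (simp add: H_norm_eq real_sqrt_mult)
qed

lemma H_norm_diff_commute: "L > 0 \<Longrightarrow> H_norm L s (\<lambda>x. g x - h x) = H_norm L s (\<lambda>x. h x - g x)"
  using H_norm_cmult[of L s "-1" "\<lambda>x. g x - h x"] by simp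

lemma H_per_const: "(\<lambda>x. c) \<in> H_per L s" if L: "L > 0"
proof -
  have z: "fourier_coeff L (\<lambda>x. c) k = 0" if "k \<noteq> 0" for k
    using that L integral_emode[OF L, of "-k"] by (simp add: fourier_coeff_eq)
  have "(\<lambda>k. sobw s k * (cmod (fourier_coeff L (\<lambda>x. c) k))\<^sup>2) summable_on {0}" by simp
  then have "(\<lambda>k. sobw s k * (cmod (fourier_coeff L (\<lambda>x. c) k))\<^sup>2) summable_on UNIV"
    by (rule summable_on_cong_neutral[THEN iffD1, rotated -1]) (auto simp: z)
  then show ?thesis by (simp add: H_per_iff L2_per_const wfin_def)
qed

lemma L2_norm_le_H_norm:
  assumes L: "L > 0" and s: "s \<ge> 0" and g: "g \<in> H_per L s"
  shows "iper L (\<lambda>x. (g x)\<^sup>2) \<le> (H_norm L s g)\<^sup>2"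
proof -
  have "wip (\<lambda>k. 1) (fourier_coeff L g) (fourier_coeff L g) \<le> 1 * wip (sobw s) (fourier_coeff L g) (fourier_coeff L g)"
    by (rule wfin_mono(2)) (use g sobw_ge_1[OF s] in \<open>auto simp: H_per_iff\<close>)
  then show ?thesis using L g by (simp add: parseval_self H_per_L2 H_norm_sq)
qed

lemma H_per_shift:
  assumes L: "L > 0" and g: "g \<in> H_per L s"
  shows "(\<lambda>x. g (x + y)) \<in> H_per L s" "H_norm L s (\<lambda>x. g (x + y)) = H_norm L s g"
proof -
  have "fourier_coeff L (\<lambda>x. g (x + y)) k = emode L k y * fourier_coeff L g k" for k
    by (rule fourier_coeff_shift[OF L]) (use L2_perD[OF H_per_L2[OF g]] in auto)
  then have n: "cmod (fourier_coeff L (\<lambda>x. g (x + y)) k) = cmod (fourier_coeff L g k)" for k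
    by (simp add: norm_mult)
  show "(\<lambda>x. g (x + y)) \<in> H_per L s" using g by (simp add: H_per_iff wfin_def n L2_per_shift[OF L])
  show "H_norm L s (\<lambda>x. g (x + y)) = H_norm L s g" by (simp add: H_norm_eq wip_self n)
qed

text \<open>Tychonoff replaces a diagonal argument: a product of discs is compact, and over the
  countable index set compactness is sequential.\<close>

lemma coeff_subsequence:
  fixes c :: "nat \<Rightarrow> int \<Rightarrow> complex"
  assumes "\<And>n k. cmod (c n k) \<le> M"
  obtains r d where "strict_mono (r :: nat \<Rightarrow> nat)" "\<And>k. (\<lambda>n. c (r n) k) \<longlonglongrightarrow> d k"
proof -
  define S :: "(int \<Rightarrow> complex) set" where "S = PiE UNIV (\<lambda>k. cball 0 M)"
  have "compactin (product_topology (\<lambda>k::int. euclidean) UNIV) S"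
    unfolding S_def compactin_PiE by (simp add: compactin_euclidean_iff)
  then have "compact S" by (simp add: euclidean_product_topology compactin_euclidean_iff)
  then have "seq_compact S" by (rule compact_imp_seq_compact)
  moreover have "\<forall>n. c n \<in> S" using assms by (simp add: S_def PiE_iff)
  ultimately obtain d r where d: "strict_mono (r :: nat \<Rightarrow> nat)" "(c \<circ> r) \<longlonglongrightarrow> d"
    by (metis seq_compactE)
  have "(\<lambda>n. c (r n) k) \<longlonglongrightarrow> d k" for k
    using continuous_on_tendsto_compose[OF continuous_on_product_coordinates[of k] d(2)] by (simp add: o_def)
  with d(1) show ?thesis by (rule that)
qed

text \<open>The weight tends to infinity, so the tails are uniformly small.\<close>
lemma rellich:
  assumes L: "L > 0" and s: "s > 0" and v: "\<And>n. v n \<in> H_per L s" and R: "\<And>n. H_norm L s (v n) \<le> R"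
  obtains r w where "strict_mono (r :: nat \<Rightarrow> nat)" "w \<in> H_per L s" "H_norm L s w \<le> R"
    "\<And>k. (\<lambda>n. fourier_coeff L (v (r n)) k) \<longlonglongrightarrow> fourier_coeff L w k"
    "(\<lambda>n. iper L (\<lambda>x. (v (r n) x - w x)\<^sup>2)) \<longlonglongrightarrow> 0"
proof -
  define c where "c n = fourier_coeff L (v n)" for n
  have fin: "wfin (sobw s) (c n)" for n using v[of n] by (simp add: c_def H_per_iff)
  have "0 \<le> R" using R[of 0] H_norm_nonneg[OF L, of s "v 0"] by linarith
  have Rc: "wip (sobw s) (c n) (c n) \<le> R\<^sup>2 / L" for n
  proof -
    have "(H_norm L s (v n))\<^sup>2 \<le> R\<^sup>2" using R[of n] H_norm_nonneg[OF L] by (intro power_mono) auto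
    then show ?thesis using L by (simp add: H_norm_sq c_def field_simps)
  qed
  have bd: "cmod (c n k) \<le> sqrt (R\<^sup>2 / L)" for n k
  proof (rule real_le_rsqrt)
    have "(cmod (c n k))\<^sup>2 \<le> sobw s k * (cmod (c n k))\<^sup>2"
      using sobw_ge_1[of s k] s by (simp add: mult_le_cancel_right1)
    also have "\<dots> \<le> wip (sobw s) (c n) (c n)" using wsum_le_wip[of "sobw s" "c n" "{k}"] fin by simp
    finally show "(cmod (c n k))\<^sup>2 \<le> R\<^sup>2 / L" using Rc[of n] by simp
  qed
  obtain r d where r: "strict_mono r" and d: "\<And>k. (\<lambda>n. c (r n) k) \<longlonglongrightarrow> d k"
    by (rule coeff_subsequence[of c, OF bd]) blast
  have fd: "wfin (sobw s) d" "wip (sobw s) d d \<le> R\<^sup>2 / L"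
    using wip_lsc[where a="sobw s" and c="\<lambda>n. c (r n)" and d=d and R="\<lambda>n. R\<^sup>2 / L", OF _ d] fin Rc by auto
  have fd1: "wfin (\<lambda>k. 1) d"
    by (rule wfin_mono(1)[OF fd(1), where C=1]) (use sobw_ge_1[of s] s in auto)
  \<comment> \<open>Hermitian symmetry passes to the limit; \<open>riesz_fischer\<close> needs it to
    provide a real function.\<close>
  have herm: "d (- k) = cnj (d k)" for k
  proof (rule LIMSEQ_unique[OF d])
    show "(\<lambda>n. c (r n) (- k)) \<longlonglongrightarrow> cnj (d k)"
      using tendsto_cnj[OF d[of k]] by (simp add: c_def fourier_coeff_minus)
  qed
  have "(\<lambda>k. (cmod (d k))\<^sup>2) summable_on UNIV" using fd1 by (simp add: wfin_def)
  from riesz_fischer[OF L this herm] obtain w where w: "w \<in> L2_per L" "\<And>k. fourier_coeff L w k = d k"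
    by blast
  then have wd: "fourier_coeff L w = d" by auto
  have wH: "w \<in> H_per L s" using w fd by (simp add: H_per_iff wd)
  have wn: "H_norm L s w \<le> R"
    using fd(2) L \<open>0 \<le> R\<close> by (simp add: H_norm_eq wd real_le_lsqrt field_simps)
  have "(\<lambda>n. iper L (\<lambda>x. (v (r n) x - w x)\<^sup>2)) \<longlonglongrightarrow> 0"
  proof (rule LIMSEQ_I)
    fix e :: real assume e: "e > 0"
    have dd: "(\<lambda>x. v n x - w x) \<in> H_per L s" for n by (rule H_per_diff[OF v wH])
    have fdd: "fourier_coeff L (\<lambda>x. v n x - w x) k = c n k - d k" for n k
      using fourier_coeff_diff[OF L2_per_integrable[OF H_per_L2[OF v]] L2_per_integrable[OF H_per_L2[OF wH]]]
      by (simp add: c_def wd)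
    have dn: "L * wip (sobw s) (\<lambda>k. c n k - d k) (\<lambda>k. c n k - d k) \<le> (2 * R)\<^sup>2" for n
    proof -
      have "H_norm L s (\<lambda>x. v n x + (-1) * w x) \<le> H_norm L s (v n) + H_norm L s (\<lambda>x. (-1) * w x)"
        by (rule H_norm_triangle[OF L v H_per_cmult[OF wH]])
      then have "H_norm L s (\<lambda>x. v n x - w x) \<le> 2 * R" using R[of n] wn H_norm_cmult[OF L, of s "-1" w] by simp
      then have "(H_norm L s (\<lambda>x. v n x - w x))\<^sup>2 \<le> (2 * R)\<^sup>2" using H_norm_nonneg[OF L] by (intro power_mono) auto
      then show ?thesis using L by (simp add: H_norm_sq fdd[abs_def])
    qed
    have P: "0 < 8 * R\<^sup>2 + 1" by (simp add: add_nonneg_pos)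
    \<comment> \<open>The tail has weighted energy at most \<open>4 * R^2 / L\<close>. Where the
      weight is at least \<open>(8 * R^2 + 1) / e\<close>, the plain energy of the tail is thus at
      most \<open>e / (2 * L)\<close>; the 1 keeps the threshold positive when
      \<open>R = 0\<close>.\<close>
    define K where "K = ((8 * R\<^sup>2 + 1) / e) powr (1 / s)"
    define N where "N = nat \<lceil>K\<rceil>"
    define T where "T = {- int N..int N}"
    have big: "sobw s k \<ge> (8 * R\<^sup>2 + 1) / e" if "k \<notin> T" for k
    proof -
      have "K \<ge> 0" by (simp add: K_def)
      have "\<bar>k\<bar> > int N" using that by (auto simp: T_def)
      then have "of_int \<bar>k\<bar> \<ge> K" "of_int \<bar>k\<bar> \<ge> (1::real)" unfolding N_def by linarith+
      then have "K \<le> 1 + (of_int k)\<^sup>2"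
        using self_le_power[of "of_int \<bar>k\<bar> :: real" 2] by simp
      then have "K powr s \<le> sobw s k" unfolding sobw_def using s \<open>K \<ge> 0\<close> by (intro powr_mono2) auto
      moreover have "K powr s = (8 * R\<^sup>2 + 1) / e" unfolding K_def using s e by (simp add: powr_powr add_nonneg_pos)
      ultimately show ?thesis by simp
    qed
    \<comment> \<open>On the finite window coefficientwise convergence is enough.\<close>
    have Tlim: "(\<lambda>n. \<Sum>k\<in>T. (cmod (c (r n) k - d k))\<^sup>2) \<longlonglongrightarrow> (\<Sum>k\<in>T. (cmod (d k - d k))\<^sup>2)"
      by (intro tendsto_intros d)
    then have "(\<lambda>n. \<Sum>k\<in>T. (cmod (c (r n) k - d k))\<^sup>2) \<longlonglongrightarrow> 0" by simp
    then obtain n0 where n0: "\<And>n. n \<ge> n0 \<Longrightarrow> (\<Sum>k\<in>T. (cmod (c (r n) k - d k))\<^sup>2) < e / (2 * L)"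
      using order_tendstoD(2)[of _ 0 sequentially "e / (2 * L)"] e L by (auto simp: eventually_sequentially)
    have "iper L (\<lambda>x. (v (r n) x - w x)\<^sup>2) < e" if n: "n \<ge> n0" for n
    proof -
      let ?b = "\<lambda>k. c (r n) k - d k"
      have f: "wfin (sobw s) ?b" using dd[of "r n"] by (simp add: H_per_iff fdd[abs_def])
      have tail: "(\<Sum>k\<in>F - T. (cmod (?b k))\<^sup>2) \<le> e / (8 * R\<^sup>2 + 1) * (4 * R\<^sup>2 / L)" if F: "finite F" for F
      proof -
        have "(\<Sum>k\<in>F - T. (cmod (?b k))\<^sup>2) \<le> (\<Sum>k\<in>F - T. e / (8 * R\<^sup>2 + 1) * (sobw s k * (cmod (?b k))\<^sup>2))"
        proof (rule sum_mono)
          fix k assume "k \<in> F - T"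
          then have "8 * R\<^sup>2 + 1 \<le> sobw s k * e" using big[of k] by (simp only: pos_divide_le_eq[OF e] Diff_iff not_False_eq_True)
          then have "1 \<le> sobw s k * e / (8 * R\<^sup>2 + 1)" by (simp only: pos_le_divide_eq[OF P] mult_1)
          then have "1 \<le> e / (8 * R\<^sup>2 + 1) * sobw s k" by (simp add: mult.commute)
          from mult_right_mono[OF this, of "(cmod (?b k))\<^sup>2"]
          show "(cmod (?b k))\<^sup>2 \<le> e / (8 * R\<^sup>2 + 1) * (sobw s k * (cmod (?b k))\<^sup>2)" by (simp add: mult.assoc)
        qed
        also have "\<dots> = e / (8 * R\<^sup>2 + 1) * (\<Sum>k\<in>F - T. sobw s k * (cmod (?b k))\<^sup>2)"
          by (simp add: sum_distrib_left)
        also have "\<dots> \<le> e / (8 * R\<^sup>2 + 1) * (4 * R\<^sup>2 / L)"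
        proof (rule mult_left_mono)
          have "(\<Sum>k\<in>F - T. sobw s k * (cmod (?b k))\<^sup>2) \<le> wip (sobw s) ?b ?b"
            using F f by (intro wsum_le_wip) auto
          also have "\<dots> \<le> 4 * R\<^sup>2 / L" using dn[of "r n"] L by (simp add: field_simps)
          finally show "(\<Sum>k\<in>F - T. sobw s k * (cmod (?b k))\<^sup>2) \<le> 4 * R\<^sup>2 / L" .
        qed (use e in simp)
        finally show ?thesis .
      qed
      have tt: "e / (8 * R\<^sup>2 + 1) * (4 * R\<^sup>2 / L) \<le> e / (2 * L)"
      proof -
        have "4 * R\<^sup>2 / (8 * R\<^sup>2 + 1) \<le> 1 / 2" by (subst pos_divide_le_eq[OF P]) simp
        from mult_left_mono[OF this, of "e / L"] show ?thesis using e L by (simp add: mult.commute)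
      qed
      have "wip (\<lambda>k. 1) ?b ?b \<le> (\<Sum>k\<in>T. (cmod (?b k))\<^sup>2) + e / (2 * L)"
      proof (rule wfin_bounded)
        fix F :: "int set" assume F: "finite F"
        have "(\<Sum>k\<in>F. 1 * (cmod (?b k))\<^sup>2) = (\<Sum>k\<in>F \<inter> T. (cmod (?b k))\<^sup>2) + (\<Sum>k\<in>F - T. (cmod (?b k))\<^sup>2)"
          using sum.Int_Diff[OF F] by simp
        also have "\<dots> \<le> (\<Sum>k\<in>T. (cmod (?b k))\<^sup>2) + e / (2 * L)"
          using tail[OF F] tt by (intro add_mono sum_mono2) (auto simp: T_def)
        finally show "(\<Sum>k\<in>F. 1 * (cmod (?b k))\<^sup>2) \<le> (\<Sum>k\<in>T. (cmod (?b k))\<^sup>2) + e / (2 * L)" .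
      qed simp
      then have "wip (\<lambda>k. 1) ?b ?b < e / L" using n0[OF n] L by (simp add: field_simps)
      then show ?thesis using L parseval_self[OF L H_per_L2[OF dd]] by (simp add: fdd[abs_def] field_simps)
    qed
    then show "\<exists>n0. \<forall>n\<ge>n0. norm (iper L (\<lambda>x. (v (r n) x - w x)\<^sup>2) - 0) < e"
      by (intro exI[of _ n0]) simp
  qed
  then show ?thesis using that[OF r wH wn] d by (simp add: wd c_def)
qed

section \<open>The multiplier\<close>

lemma wfin_finite_support:
  assumes "finite F" "\<And>k. k \<notin> F \<Longrightarrow> c k = 0"
  shows "wfin a c" "wip a b c = (\<Sum>k\<in>F. a k * Re (b k * cnj (c k)))"
proof -
  have "(\<lambda>k. a k * (cmod (c k))\<^sup>2) summable_on F" using assms(1) by simp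
  then show "wfin a c" unfolding wfin_def
    by (rule summable_on_cong_neutral[THEN iffD1, rotated -1]) (auto simp: assms(2))
  have "wip a b c = infsum (\<lambda>k. a k * Re (b k * cnj (c k))) F"
    unfolding wip_def by (rule infsum_cong_neutral) (auto simp: assms(2))
  then show "wip a b c = (\<Sum>k\<in>F. a k * Re (b k * cnj (c k)))" using assms(1) by simp
qed

lemma trig_H_per:
  assumes L: "L > 0" and F: "finite F" "uminus ` F = F" and c: "\<And>k. c (- k) = cnj (c k)"
  shows "trig L F c \<in> H_per L s"
  unfolding H_per_iff
  by (intro conjI trig_L2[OF L] wfin_finite_support(1)[OF F(1)]) (simp add: fourier_coeff_trig[of L F c, OF L F c])

lemma integral_L2_tendsto:
  assumes f: "f \<in> L2_per L" and v: "\<And>n. v n \<in> L2_per L" and w: "w \<in> L2_per L"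
    and lim: "(\<lambda>n. iper L (\<lambda>x. (v n x - w x)\<^sup>2)) \<longlonglongrightarrow> 0"
  shows "(\<lambda>n. iper L (\<lambda>x. f x * v n x)) \<longlonglongrightarrow> iper L (\<lambda>x. f x * w x)"
proof -
  let ?S = "\<lambda>n. iper L (\<lambda>x. (v n x - w x)\<^sup>2)"
  have "(\<lambda>n. iper L (\<lambda>x. f x * (v n x - w x))) \<longlonglongrightarrow> 0"
  proof (rule Lim_null_comparison)
    show "\<forall>\<^sub>F n in sequentially. norm (iper L (\<lambda>x. f x * (v n x - w x)))
        \<le> sqrt (iper L (\<lambda>x. (f x)\<^sup>2)) * sqrt (?S n)"
      using L2_cauchy_schwarz[OF f L2_per_diff[OF v w]] by simp
    show "(\<lambda>n. sqrt (iper L (\<lambda>x. (f x)\<^sup>2)) * sqrt (?S n)) \<longlonglongrightarrow> 0"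
      using tendsto_mult_right_zero[OF tendsto_real_sqrt[OF lim, simplified]] .
  qed
  moreover have "iper L (\<lambda>x. f x * (v n x - w x))
      = iper L (\<lambda>x. f x * v n x) - iper L (\<lambda>x. f x * w x)" for n
    using L2_per_mult_integrable[OF f v] L2_per_mult_integrable[OF f w] by (simp add: right_diff_distrib)
  ultimately show ?thesis by (simp add: LIM_zero_iff)
qed

lemma integral_weighted_sq_bound:
  assumes q: "\<And>x. q (x + L) = q x" "q \<in> borel_measurable borel" "\<And>x. \<bar>q x\<bar> \<le> C" and v: "v \<in> L2_per L"
  shows "\<bar>iper L (\<lambda>x. q x * v x * v x)\<bar> \<le> C * iper L (\<lambda>x. (v x)\<^sup>2)"
proof -
  have i: "integrable (per L) (\<lambda>x. q x * v x * v x)"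
    by (rule L2_per_mult_integrable[OF L2_per_mult_bounded[OF q v] v])
  have "\<bar>iper L (\<lambda>x. q x * v x * v x)\<bar> \<le> iper L (\<lambda>x. \<bar>q x * v x * v x\<bar>)"
    by (rule integral_abs_bound)
  also have "\<dots> \<le> iper L (\<lambda>x. C * (v x)\<^sup>2)"
  proof (rule integral_mono)
    show "integrable (per L) (\<lambda>x. \<bar>q x * v x * v x\<bar>)" using i by (rule integrable_abs)
    show "integrable (per L) (\<lambda>x. C * (v x)\<^sup>2)" using L2_perD(3)[OF v] by simp
    show "\<bar>q x * v x * v x\<bar> \<le> C * (v x)\<^sup>2" for x
      using mult_right_mono[OF q(3)[of x], of "(v x)\<^sup>2"] by (simp add: abs_mult power2_eq_square mult.assoc)
  qed
  finally show ?thesis by simp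
qed

text \<open>Expanding around \<open>w\<close> leaves a term quadratic in \<open>v n - w\<close>,
  bounded by \<open>C\<close> times the squared L2 distance, and a linear term, which converges by
  \<open>integral_L2_tendsto\<close>.\<close>

lemma integral_weighted_sq_tendsto:
  assumes q: "\<And>x. q (x + L) = q x" "q \<in> borel_measurable borel" "\<And>x. \<bar>q x\<bar> \<le> C"
    and v: "\<And>n. v n \<in> L2_per L" and w: "w \<in> L2_per L"
    and lim: "(\<lambda>n. iper L (\<lambda>x. (v n x - w x)\<^sup>2)) \<longlonglongrightarrow> 0"
  shows "(\<lambda>n. iper L (\<lambda>x. q x * v n x * v n x)) \<longlonglongrightarrow> iper L (\<lambda>x. q x * w x * w x)"
proof -
  note qm = L2_per_mult_bounded[OF q]
  have "(\<lambda>n. iper L (\<lambda>x. q x * (v n x - w x) * (v n x - w x))) \<longlonglongrightarrow> 0"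
  proof (rule Lim_null_comparison)
    show "\<forall>\<^sub>F n in sequentially. norm (iper L (\<lambda>x. q x * (v n x - w x) * (v n x - w x)))
        \<le> C * iper L (\<lambda>x. (v n x - w x)\<^sup>2)"
      using integral_weighted_sq_bound[OF q L2_per_diff[OF v w]] by simp
  qed (use tendsto_mult_right_zero[OF lim] in simp)
  moreover have "(\<lambda>n. iper L (\<lambda>x. (q x * w x) * v n x)) \<longlonglongrightarrow> iper L (\<lambda>x. (q x * w x) * w x)"
    by (rule integral_L2_tendsto[OF qm[OF w] v w lim])
  ultimately have "(\<lambda>n. iper L (\<lambda>x. q x * (v n x - w x) * (v n x - w x))
      + 2 * iper L (\<lambda>x. (q x * w x) * v n x) - iper L (\<lambda>x. (q x * w x) * w x))
     \<longlonglongrightarrow> 0 + 2 * iper L (\<lambda>x. (q x * w x) * w x) - iper L (\<lambda>x. (q x * w x) * w x)"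
    by (intro tendsto_intros)
  moreover have "iper L (\<lambda>x. q x * (v n x - w x) * (v n x - w x))
      + 2 * iper L (\<lambda>x. (q x * w x) * v n x) - iper L (\<lambda>x. (q x * w x) * w x)
      = iper L (\<lambda>x. q x * v n x * v n x)" for n
  proof -
    have d: "(\<lambda>x. v n x - w x) \<in> L2_per L" by (rule L2_per_diff[OF v w])
    note i = L2_per_mult_integrable[OF qm[OF d] d] L2_per_mult_integrable[OF qm[OF w] v[of n]] L2_per_mult_integrable[OF qm[OF w] w]
    have "iper L (\<lambda>x. q x * (v n x - w x) * (v n x - w x))
      + 2 * iper L (\<lambda>x. (q x * w x) * v n x) - iper L (\<lambda>x. (q x * w x) * w x)
      = iper L (\<lambda>x. q x * (v n x - w x) * (v n x - w x) + 2 * ((q x * w x) * v n x) - (q x * w x) * w x)"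
      using i by simp
    also have "\<dots> = iper L (\<lambda>x. q x * v n x * v n x)"
      by (rule Bochner_Integration.integral_cong) (simp_all add: algebra_simps)
    finally show ?thesis .
  qed
  ultimately show ?thesis by simp
qed

text \<open>The first-variation argument in one variable, used at each extremum below.\<close>

lemma linear_quadratic_nonneg:
  fixes a b :: real
  assumes "\<And>t. 0 \<le> a * t + b * t\<^sup>2"
  shows "a = 0"
proof (rule ccontr)
  assume a: "a \<noteq> 0"
  define B where "B = \<bar>b\<bar> + 1"
  \<comment> \<open>This \<open>t\<close> gives \<open>a * t + B * t^2 = - (a^2) / (4 * B)\<close>;
    the 1 added to \<open>\<bar>b\<bar>\<close> keeps \<open>B\<close> positive.\<close>
  define t where "t = - a / (2 * B)"
  have B: "B > 0" "b \<le> B" by (simp_all add: B_def)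
  have "0 \<le> a * t + b * t\<^sup>2" by (rule assms)
  also have "\<dots> \<le> a * t + B * t\<^sup>2" using B by (intro add_left_mono mult_right_mono) auto
  also have "\<dots> = - (a\<^sup>2) / (4 * B)" using B by (simp add: t_def power2_eq_square field_simps)
  also have "\<dots> < 0" using a B by (intro divide_neg_pos) auto
  finally show False by simp
qed

section \<open>The multiplier, its symbol on the integers and its form\<close>

locale multiplier_setting =
  fixes L m :: real and \<theta> :: "real \<Rightarrow> real"
  assumes L: "L > 0" and mult: "multiplier_of_order L m \<theta>"
begin

abbreviation X :: "(real \<Rightarrow> real) set" where "X \<equiv> H_per L (m / 2)"

abbreviation Xn :: "(real \<Rightarrow> real) \<Rightarrow> real" where "Xn \<equiv> H_norm L (m / 2)"

abbreviation fc :: "(real \<Rightarrow> real) \<Rightarrow> int \<Rightarrow> complex" where "fc \<equiv> fourier_coeff L"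

abbreviation int_per :: "(real \<Rightarrow> real) \<Rightarrow> real" where "int_per \<equiv> iper L"

definition th :: "int \<Rightarrow> real" where "th k = \<theta> (of_int k)"

text \<open>The form of the multiplier makes sense on all of \<open>X\<close>, whereas applying the
  operator itself takes a function in \<open>H_per L m\<close>.\<close>

definition T :: "(real \<Rightarrow> real) \<Rightarrow> (real \<Rightarrow> real) \<Rightarrow> real" where
  "T v w = L * wip th (fc v) (fc w)"

lemma m_pos: "m > 0"
  using mult by (simp add: multiplier_of_order_def)

lemma th_bounds:
  obtains A1 A2 where "A1 > 0" "A2 > 0"
    "\<And>k. A1 * \<bar>of_int k\<bar> powr m \<le> th k" "\<And>k. th k \<le> A2 * \<bar>of_int k\<bar> powr m"
  using mult unfolding multiplier_of_order_def th_def by blast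

lemma th_nonneg [simp]: "th k \<ge> 0"
proof -
  obtain A1 A2 :: real where "A1 > 0" "A1 * \<bar>of_int k\<bar> powr m \<le> th k" by (rule th_bounds) blast
  then show ?thesis by (meson less_imp_le mult_nonneg_nonneg order_trans powr_ge_zero)
qed

lemma multiplier_image: "g \<in> H_per L m \<Longrightarrow> is_multiplier_image L \<theta> g (multiplier_op L \<theta> g)"
  unfolding multiplier_op_def
  by (rule someI_ex[of "is_multiplier_image L \<theta> g"]) (use mult in \<open>simp add: multiplier_of_order_def\<close>)

text \<open>Evenness of the symbol comes from the requirement that the multiplier maps real
  functions to real functions, tested on a function supported on the modes \<open>k\<close> and
  \<open>- k\<close>.\<close>

lemma th_minus: "th (- k) = th k"
proof -
  define g where "g = trig L {k, - k} (\<lambda>_. 1)"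
  have F: "uminus ` {k, - k} = {k, - k}" by auto
  have g: "g \<in> H_per L m" unfolding g_def by (rule trig_H_per[OF L _ F]) auto
  have "fc g k = 1" "fc g (- k) = 1" unfolding g_def by (simp_all add: fourier_coeff_trig[OF L _ F])
  moreover have "fc (multiplier_op L \<theta> g) j = of_real (th j) * fc g j" for j
    using multiplier_image[OF g] by (simp add: is_multiplier_image_def th_def)
  ultimately have "fc (multiplier_op L \<theta> g) k = of_real (th k)" "fc (multiplier_op L \<theta> g) (- k) = of_real (th (- k))"
    by simp_all
  then have "(of_real (th (- k)) :: complex) = of_real (th k)"
    using fourier_coeff_minus[of L "multiplier_op L \<theta> g" k] by simp
  then show ?thesis by simp
qed

lemma abs_powr_eq: "\<bar>of_int k\<bar> powr (2 * s) = ((of_int k)\<^sup>2 :: real) powr s"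
  by (cases "k = 0") (simp_all add: powr_powr[symmetric] powr_numeral)

lemma weight_upper: "s > 0 \<Longrightarrow> \<bar>of_int k\<bar> powr (2 * s) \<le> sobw s k"
  unfolding abs_powr_eq sobw_def by (rule powr_mono2) auto

text \<open>For a nonzero integer, \<open>1 + k^2\<close> is at most \<open>2 * k^2\<close>; the
  summand 1 takes care of \<open>k = 0\<close>.\<close>

lemma weight_lower:
  assumes s: "s > 0"
  shows "sobw s k \<le> 1 + 2 powr s * \<bar>of_int k\<bar> powr (2 * s)"
proof (cases "k = 0")
  case True
  then show ?thesis by (simp add: sobw_def)
next
  case False
  have "1 \<le> \<bar>of_int k :: real\<bar>" using False by linarith
  then have "(1::real) \<le> (of_int k)\<^sup>2" using one_le_power[of "\<bar>of_int k :: real\<bar>" 2] by simp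
  then have "sobw s k \<le> (2 * (of_int k)\<^sup>2) powr s" unfolding sobw_def using s by (intro powr_mono2) auto
  also have "\<dots> = 2 powr s * \<bar>of_int k\<bar> powr (2 * s)" unfolding abs_powr_eq by (simp add: powr_mult)
  finally show ?thesis by simp
qed

text \<open>The symbol vanishes at mode 0, so it dominates the Sobolev weight only after 1 is added.
  The bound of \<open>sobw m\<close> by \<open>1 + th^2\<close> turns square summability of
  \<open>th k * fc v k\<close> into membership in \<open>H_per L m\<close>.\<close>

lemma th_sobw:
  obtains C where "C > 0" "\<And>k. th k \<le> C * sobw (m / 2) k" "\<And>k. sobw (m / 2) k \<le> C * (1 + th k)"
    "\<And>k. (th k)\<^sup>2 \<le> C * sobw m k" "\<And>k. sobw m k \<le> C * (1 + (th k)\<^sup>2)"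
proof -
  obtain A1 A2 where A: "A1 > 0" "A2 > 0"
    "\<And>k. A1 * \<bar>of_int k\<bar> powr m \<le> th k" "\<And>k. th k \<le> A2 * \<bar>of_int k\<bar> powr m"
    by (rule th_bounds) blast
  have p: "(\<bar>of_int k\<bar> powr m)\<^sup>2 = \<bar>of_int k :: real\<bar> powr (2 * m)" for k
    by (simp add: power2_eq_square powr_add[symmetric])
  have u1: "th k \<le> A2 * sobw (m / 2) k" for k
  proof -
    have "\<bar>of_int k\<bar> powr m \<le> sobw (m / 2) k" using weight_upper[of "m / 2" k] m_pos by simp
    from mult_left_mono[OF this less_imp_le[OF A(2)]] A(4)[of k] show ?thesis by linarith
  qed
  have u2: "(th k)\<^sup>2 \<le> A2\<^sup>2 * sobw m k" for k
  proof -
    have "(th k)\<^sup>2 \<le> (A2 * \<bar>of_int k\<bar> powr m)\<^sup>2" by (rule power_mono[OF A(4)]) simp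
    also have "\<dots> \<le> A2\<^sup>2 * sobw m k" using weight_upper[OF m_pos, of k]
      by (simp add: power_mult_distrib p mult_left_mono)
    finally show ?thesis .
  qed
  have l1: "sobw (m / 2) k \<le> 1 + 2 powr (m / 2) / A1 * th k" for k
  proof -
    have "\<bar>of_int k\<bar> powr m \<le> th k / A1" using A(1) A(3)[of k] by (simp add: field_simps)
    from mult_left_mono[OF this, of "2 powr (m / 2)"]
    show ?thesis using weight_lower[of "m / 2" k] m_pos by simp
  qed
  have l2: "sobw m k \<le> 1 + 2 powr m / A1\<^sup>2 * (th k)\<^sup>2" for k
  proof -
    have "\<bar>of_int k\<bar> powr m \<le> th k / A1" using A(1) A(3)[of k] by (simp add: field_simps)
    then have "(\<bar>of_int k\<bar> powr m)\<^sup>2 \<le> (th k / A1)\<^sup>2" by (rule power_mono) simp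
    from mult_left_mono[OF this, of "2 powr m"]
    show ?thesis using weight_lower[OF m_pos, of k] by (simp add: p power_divide)
  qed
  \<comment> \<open>The sum of all constants, so that each of the four bounds can be weakened to
    it.\<close>
  define C where "C = 1 + A2 + A2\<^sup>2 + 2 powr (m / 2) / A1 + 2 powr m / A1\<^sup>2"
  have nn: "0 \<le> A2" "0 \<le> A2\<^sup>2" "0 \<le> 2 powr (m / 2) / A1" "0 \<le> 2 powr m / A1\<^sup>2" using A by simp_all
  have C: "1 \<le> C" "A2 \<le> C" "A2\<^sup>2 \<le> C" "2 powr (m / 2) / A1 \<le> C" "2 powr m / A1\<^sup>2 \<le> C"
    using nn unfolding C_def by linarith+
  show ?thesis
  proof (rule that[of C])
    show "C > 0" using C(1) by simp
    show "th k \<le> C * sobw (m / 2) k" for k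
      using u1[of k] mult_right_mono[OF C(2) sobw_nonneg[of "m / 2" k]] by linarith
    show "(th k)\<^sup>2 \<le> C * sobw m k" for k
      using u2[of k] mult_right_mono[OF C(3) sobw_nonneg[of m k]] by linarith
    show "sobw (m / 2) k \<le> C * (1 + th k)" for k
      using l1[of k] mult_right_mono[OF C(4) th_nonneg[of k]] C(1) by (simp add: distrib_left)
    show "sobw m k \<le> C * (1 + (th k)\<^sup>2)" for k
      using l2[of k] mult_right_mono[OF C(5) zero_le_power2[of "th k"]] C(1) by (simp add: distrib_left)
  qed
qed

lemma X_L2: "v \<in> X \<Longrightarrow> v \<in> L2_per L"
  by (rule H_per_L2)

lemma wfin_th: "v \<in> X \<Longrightarrow> wfin th (fc v)"
proof -
  assume v: "v \<in> X"
  obtain C where C: "\<And>k. th k \<le> C * sobw (m / 2) k" by (rule th_sobw) blast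
  show ?thesis by (rule wfin_mono(1)[of "sobw (m / 2)"]) (use v C in \<open>auto simp: H_per_iff\<close>)
qed

lemma H_per_m_X:
  assumes "v \<in> H_per L m"
  shows "v \<in> X"
proof -
  have le: "sobw (m / 2) k \<le> 1 * sobw m k" for k
    unfolding sobw_def using m_pos by (simp add: powr_mono)
  have "wfin (sobw (m / 2)) (fc v)"
    by (rule wfin_mono(1)[OF _ _ le]) (use assms in \<open>auto simp: H_per_iff\<close>)
  then show ?thesis using assms by (simp add: H_per_iff)
qed

lemma fc_lin: "g \<in> X \<Longrightarrow> h \<in> X \<Longrightarrow> fc (\<lambda>x. a * g x + b * h x) = (\<lambda>k. of_real a * fc g k + of_real b * fc h k)"
  by (rule fourier_coeff_L2_lin) (rule X_L2; assumption)+

lemma T_lin_left: "u \<in> X \<Longrightarrow> v \<in> X \<Longrightarrow> w \<in> X \<Longrightarrow> T (\<lambda>x. a * u x + b * v x) w = a * T u w + b * T v w"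
  unfolding T_def by (simp add: fc_lin wip_lin_left[OF _ wfin_th wfin_th wfin_th] algebra_simps)

lemma T_commute: "T u v = T v u"
  unfolding T_def by (simp add: wip_commute)

lemma T_nonneg: "T v v \<ge> 0"
  unfolding T_def using L by (simp add: wip_nonneg)

lemma Xn_bound:
  obtains C where "C > 0" "\<And>v. v \<in> X \<Longrightarrow> (Xn v)\<^sup>2 \<le> C * (int_per (\<lambda>x. (v x)\<^sup>2) + T v v)"
    "\<And>v. v \<in> X \<Longrightarrow> T v v \<le> C * (Xn v)\<^sup>2"
proof -
  obtain C where C: "C > 0" "\<And>k. th k \<le> C * sobw (m / 2) k" "\<And>k. sobw (m / 2) k \<le> C * (1 + th k)"
    by (rule th_sobw) blast
  show ?thesis
  proof (rule that[OF C(1)])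
    fix v assume v: "v \<in> X"
    note f1 = wfin_fourier[OF L X_L2[OF v]] and f2 = wfin_th[OF v]
    have "wip (sobw (m / 2)) (fc v) (fc v) \<le> C * wip (\<lambda>k. 1 + th k) (fc v) (fc v)"
      by (rule wfin_mono(2)[OF wfin_add_weight(1)[OF f1 f2]]) (use C in auto)
    from mult_left_mono[OF this less_imp_le[OF L]]
    show "(Xn v)\<^sup>2 \<le> C * (int_per (\<lambda>x. (v x)\<^sup>2) + T v v)"
      unfolding wfin_add_weight(2)[OF f1 f2] H_norm_sq[OF L] parseval_self[OF L X_L2[OF v]] T_def
      by (simp add: algebra_simps)
    have "wip th (fc v) (fc v) \<le> C * wip (sobw (m / 2)) (fc v) (fc v)"
      by (rule wfin_mono(2)) (use C v in \<open>auto simp: H_per_iff\<close>)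
    from mult_left_mono[OF this less_imp_le[OF L]]
    show "T v v \<le> C * (Xn v)\<^sup>2" unfolding H_norm_sq[OF L] T_def by (simp add: algebra_simps)
  qed
qed

lemma integral_multiplier_op:
  assumes g: "g \<in> H_per L m" and w: "w \<in> L2_per L"
  shows "int_per (\<lambda>x. multiplier_op L \<theta> g x * w x) = T g w"
proof -
  have h: "multiplier_op L \<theta> g \<in> L2_per L" "\<And>k. fc (multiplier_op L \<theta> g) k = of_real (th k) * fc g k"
    using multiplier_image[OF g] by (auto simp: is_multiplier_image_def th_def)
  have "wip (\<lambda>k. 1) (fc (multiplier_op L \<theta> g)) (fc w) = wip th (fc g) (fc w)"
    unfolding wip_def by (rule infsum_cong) (simp add: h(2) mult.assoc right_diff_distrib distrib_left)
  then show ?thesis unfolding parseval_ip[OF L h(1) w] T_def by simp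
qed

text \<open>\<open>multiplier_op\<close> is a choice, so an image has to exist first: membership in
  \<open>X\<close> makes \<open>sqrt th\<close> times the coefficients square summable, and evenness
  of \<open>th\<close> keeps them Hermitian.\<close>

lemma multiplier_sqrt_image:
  assumes u: "u \<in> X"
  shows "multiplier_sqrt L \<theta> u \<in> L2_per L" "int_per (\<lambda>x. (multiplier_sqrt L \<theta> u x)\<^sup>2) = T u u"
proof -
  define c where "c k = of_real (sqrt (th k)) * fc u k" for k
  have n: "(cmod (c k))\<^sup>2 = th k * (cmod (fc u k))\<^sup>2" for k
    by (simp add: c_def norm_mult power_mult_distrib)
  have s: "(\<lambda>k. (cmod (c k))\<^sup>2) summable_on UNIV" using wfin_th[OF u] by (simp add: n wfin_def)
  have h: "c (- k) = cnj (c k)" for k by (simp add: c_def th_minus fourier_coeff_minus)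
  obtain g where g: "g \<in> L2_per L" "\<And>k. fc g k = c k"
    using riesz_fischer[OF L s h] by blast
  then have "is_multiplier_image L (\<lambda>\<kappa>. sqrt (\<theta> \<kappa>)) u g"
    by (simp add: is_multiplier_image_def c_def th_def)
  then have im: "is_multiplier_image L (\<lambda>\<kappa>. sqrt (\<theta> \<kappa>)) u (multiplier_sqrt L \<theta> u)"
    unfolding multiplier_sqrt_def multiplier_op_def by (rule someI[of "is_multiplier_image L (\<lambda>\<kappa>. sqrt (\<theta> \<kappa>)) u"])
  then show 1: "multiplier_sqrt L \<theta> u \<in> L2_per L" by (simp add: is_multiplier_image_def)
  have "fc (multiplier_sqrt L \<theta> u) k = c k" for k
    using im by (simp add: is_multiplier_image_def c_def th_def)
  then show "int_per (\<lambda>x. (multiplier_sqrt L \<theta> u x)\<^sup>2) = T u u"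
    unfolding parseval[OF L 1] T_def wip_self by (simp add: n)
qed

text \<open>The test functions are the residual itself, truncated to the modes \<open>k\<close> and \<open>- k\<close>.\<close>
lemma weak_multiplier:
  assumes v: "v \<in> X" and f: "f \<in> L2_per L" and eq: "\<And>w. w \<in> X \<Longrightarrow> T v w = int_per (\<lambda>x. f x * w x)"
  shows "v \<in> H_per L m" "AE x in lborel. multiplier_op L \<theta> v x = f x"
proof -
  define c where "c k = of_real (th k) * fc v k - fc f k" for k
  have c: "c (- k) = cnj (c k)" for k by (simp add: c_def th_minus fourier_coeff_minus)
  have z: "of_real (th k) * fc v k = fc f k" for k
  proof -
    define F where "F = {k, - k}"
    have F: "finite F" "uminus ` F = F" by (auto simp: F_def)
    define w where "w = trig L F c"
    have w: "w \<in> X" unfolding w_def by (rule trig_H_per[of L F c, OF L F c])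
    have fw: "fc w j = (if j \<in> F then c j else 0)" for j
      unfolding w_def by (rule fourier_coeff_trig[of L F c, OF L F c])
    have w0: "fc w j = 0" if "j \<notin> F" for j using that by (simp add: fw)
    have "L * wip th (fc v) (fc w) = L * wip (\<lambda>k. 1) (fc f) (fc w)"
      using eq[OF w] unfolding T_def parseval_ip[OF L f X_L2[OF w]] .
    then have "wip th (fc v) (fc w) = wip (\<lambda>k. 1) (fc f) (fc w)" using L by simp
    moreover have "wip a b (fc w) = (\<Sum>j\<in>F. a j * Re (b j * cnj (fc w j)))" for a b
      by (rule wfin_finite_support(2)[OF F(1)]) (rule w0)
    ultimately have "(\<Sum>j\<in>F. th j * Re (fc v j * cnj (fc w j))) = (\<Sum>j\<in>F. 1 * Re (fc f j * cnj (fc w j)))"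
      by (simp only:)
    then have "(\<Sum>j\<in>F. th j * Re (fc v j * cnj (fc w j)) - Re (fc f j * cnj (fc w j))) = 0"
      by (simp add: sum_subtractf)
    also have "(\<Sum>j\<in>F. th j * Re (fc v j * cnj (fc w j)) - Re (fc f j * cnj (fc w j))) = (\<Sum>j\<in>F. (cmod (c j))\<^sup>2)"
    proof (rule sum.cong[OF refl])
      fix j assume "j \<in> F"
      then show "th j * Re (fc v j * cnj (fc w j)) - Re (fc f j * cnj (fc w j)) = (cmod (c j))\<^sup>2"
        by (simp add: fw c_def cmod_power2) (simp add: power2_eq_square algebra_simps)
    qed
    finally have "(cmod (c k))\<^sup>2 = 0"
      using F(1) by (subst (asm) sum_nonneg_eq_0_iff) (auto simp: F_def)
    then show ?thesis by (simp add: c_def)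
  qed
  \<comment> \<open>Square summability of the coefficients and of \<open>th\<close> times the
    coefficients together is the gain from \<open>X\<close> to \<open>H_per L m\<close>.\<close>
  obtain C where C: "C > 0" "\<And>k. sobw m k \<le> C * (1 + (th k)\<^sup>2)" by (rule th_sobw) blast
  have "wfin (\<lambda>k. 1) (fc f)" by (rule wfin_fourier[OF L f])
  then have "wfin (\<lambda>k. (th k)\<^sup>2) (fc v)"
    unfolding wfin_def z[symmetric] by (simp add: norm_mult power_mult_distrib)
  then have "wfin (\<lambda>k. 1 + (th k)\<^sup>2) (fc v)"
    by (rule wfin_add_weight(1)[OF wfin_fourier[OF L X_L2[OF v]]])
  then have "wfin (sobw m) (fc v)" by (rule wfin_mono(1)) (use C in auto)
  then show vm: "v \<in> H_per L m" using X_L2[OF v] by (simp add: H_per_iff)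
  show "AE x in lborel. multiplier_op L \<theta> v x = f x"
    by (rule L2_per_eq_AE[OF L _ f])
      (use multiplier_image[OF vm] z in \<open>auto simp: is_multiplier_image_def th_def\<close>)
qed

end

section \<open>Coercivity of the linearized form\<close>

definition l2 :: "real \<Rightarrow> (real \<Rightarrow> real) \<Rightarrow> (real \<Rightarrow> real) \<Rightarrow> real" where
  "l2 L g h = iper L (\<lambda>x. g x * h x)"

lemma l2_lin_left:
  assumes "g \<in> L2_per L" "h \<in> L2_per L" "f \<in> L2_per L"
  shows "l2 L (\<lambda>x. a * g x + b * h x) f = a * l2 L g f + b * l2 L h f"
proof -
  have "l2 L (\<lambda>x. a * g x + b * h x) f = iper L (\<lambda>x. a * (g x * f x) + b * (h x * f x))"
    unfolding l2_def by (simp add: algebra_simps)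
  also have "\<dots> = a * l2 L g f + b * l2 L h f"
    unfolding l2_def using L2_per_mult_integrable assms by simp
  finally show ?thesis .
qed

lemma l2_commute: "l2 L g h = l2 L h g"
  unfolding l2_def by (simp add: mult.commute)

lemma l2_self: "l2 L g g = iper L (\<lambda>x. (g x)\<^sup>2)"
  unfolding l2_def by (simp add: power2_eq_square)

lemma l2_nonneg: "l2 L g g \<ge> 0"
  unfolding l2_self by simp

lemma l2_lin_self:
  assumes "g \<in> L2_per L" "h \<in> L2_per L"
  shows "l2 L (\<lambda>x. a * g x + b * h x) (\<lambda>x. a * g x + b * h x) = a\<^sup>2 * l2 L g g + 2 * a * b * l2 L g h + b\<^sup>2 * l2 L h h"
  using l2_lin_left[OF assms L2_per_lin[OF assms, of a b], of a b]
    l2_lin_left[OF assms assms(1), of a b] l2_lin_left[OF assms assms(2), of a b]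
    l2_commute[of L g "\<lambda>x. a * g x + b * h x"] l2_commute[of L h "\<lambda>x. a * g x + b * h x"] l2_commute[of L h g]
  by (simp add: power2_eq_square algebra_simps)

lemma l2_cong_AE:
  assumes "AE x in lborel. g x = g' x" "g \<in> L2_per L" "g' \<in> L2_per L" "h \<in> L2_per L"
  shows "l2 L g h = l2 L g' h"
  unfolding l2_def
proof (rule integral_cong_AE)
  note [measurable] = L2_perD(2)[OF assms(2)] L2_perD(2)[OF assms(3)] L2_perD(2)[OF assms(4)]
  show "(\<lambda>x. g x * h x) \<in> borel_measurable (per L)" "(\<lambda>x. g' x * h x) \<in> borel_measurable (per L)"
    by (intro borel_measurable_per; measurable)+
  show "AE x in per L. g x * h x = g' x * h x"
    using AE_perI[OF assms(1)] by (rule AE_mp) (auto intro!: AE_I2)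
qed

lemma l2_self_eq_0:
  assumes L: "L > 0" and g: "g \<in> L2_per L" and 0: "l2 L g g = 0"
  shows "AE x in lborel. g x = 0" "fourier_coeff L g k = 0" "h \<in> L2_per L \<Longrightarrow> l2 L g h = 0"
proof -
  have "AE x in per L. (g x)\<^sup>2 = 0"
    using 0 L2_perD(3)[OF g] unfolding l2_self by (subst (asm) integral_nonneg_eq_0_iff_AE) auto
  then show ae: "AE x in lborel. g x = 0"
    by (intro periodic_AE[OF L]) (use L2_perD[OF g] in auto)
  show "fourier_coeff L g k = 0"
    using fourier_coeff_cong_AE[OF AE_perI[OF ae] L2_perD(2)[OF g] borel_measurable_const, of L k] by (simp add: fourier_coeff_eq)
  show "l2 L g h = 0" if "h \<in> L2_per L"
    using l2_cong_AE[OF ae g L2_per_const that] by (simp add: l2_def)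
qed

section \<open>The form of the multiplier plus a bounded potential\<close>

locale form_setting = multiplier_setting +
  fixes q :: "real \<Rightarrow> real" and C :: real
  assumes q_per: "\<And>x. q (x + L) = q x" and q_meas: "q \<in> borel_measurable borel" and q_bd: "\<And>x. \<bar>q x\<bar> \<le> C"
begin

abbreviation ip :: "(real \<Rightarrow> real) \<Rightarrow> (real \<Rightarrow> real) \<Rightarrow> real" where "ip \<equiv> l2 L"

text \<open>For \<open>q = \<omega> - \<psi>\<close> this is the form of the linearized
  operator.\<close>

definition bil :: "(real \<Rightarrow> real) \<Rightarrow> (real \<Rightarrow> real) \<Rightarrow> real" where
  "bil v w = T v w + ip (\<lambda>x. q x * v x) w"

lemma q_mult_L2: "v \<in> L2_per L \<Longrightarrow> (\<lambda>x. q x * v x) \<in> L2_per L"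
  by (rule L2_per_mult_bounded[OF q_per q_meas q_bd])

lemma bil_lin_left:
  assumes "u \<in> X" "v \<in> X" "w \<in> X"
  shows "bil (\<lambda>x. a * u x + b * v x) w = a * bil u w + b * bil v w"
proof -
  have "(\<lambda>x. q x * (a * u x + b * v x)) = (\<lambda>x. a * (q x * u x) + b * (q x * v x))"
    by (simp add: algebra_simps)
  then show ?thesis unfolding bil_def
    by (simp add: T_lin_left[OF assms] l2_lin_left[OF q_mult_L2 q_mult_L2] X_L2 assms algebra_simps)
qed

lemma bil_commute: "bil v w = bil w v"
  unfolding bil_def l2_def by (simp add: T_commute[of v w] mult_ac)

lemma bil_lin_self:
  assumes "u \<in> X" "v \<in> X"
  shows "bil (\<lambda>x. a * u x + b * v x) (\<lambda>x. a * u x + b * v x) = a\<^sup>2 * bil u u + 2 * a * b * bil u v + b\<^sup>2 * bil v v"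
  using bil_lin_left[OF assms H_per_lin[OF assms, of a b], of a b]
    bil_lin_left[OF assms assms(1), of a b] bil_lin_left[OF assms assms(2), of a b]
    bil_commute[of u "\<lambda>x. a * u x + b * v x"] bil_commute[of v "\<lambda>x. a * u x + b * v x"] bil_commute[of v u]
  by (simp add: power2_eq_square algebra_simps)

lemma C_nonneg: "C \<ge> 0"
  using q_bd[of 0] by linarith

lemma bil_bounds:
  assumes "v \<in> X"
  shows "\<bar>bil v v - T v v\<bar> \<le> C * ip v v"
  using integral_weighted_sq_bound[OF q_per q_meas q_bd X_L2[OF assms]]
  unfolding bil_def l2_self by (simp add: l2_def)

text \<open>Functions are representatives, so zero norm does not mean the zero function; what
  vanishes are the Fourier coefficients and all L2 products.\<close>

lemma bil_null:
  assumes v: "v \<in> X" and 0: "ip v v = 0" and w: "w \<in> X"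
  shows "bil v w = 0"
proof -
  have "fc v k = 0" for k by (rule l2_self_eq_0(2)[OF L X_L2[OF v] 0])
  then have "T v w = 0" by (simp add: T_def wip_def)
  moreover have "ip (\<lambda>x. q x * v x) w = ip v (\<lambda>x. q x * w x)" by (simp add: l2_def mult_ac)
  ultimately show ?thesis
    using l2_self_eq_0(3)[OF L X_L2[OF v] 0 q_mult_L2[OF X_L2[OF w]]] by (simp add: bil_def)
qed

lemma strong_imp_weak:
  assumes e: "e \<in> H_per L m" and eq: "AE x in lborel. multiplier_op L \<theta> e x + q x * e x = \<mu> * e x" and w: "w \<in> X"
  shows "bil e w = \<mu> * ip e w"
proof -
  have h: "multiplier_op L \<theta> e \<in> L2_per L" using multiplier_image[OF e] by (simp add: is_multiplier_image_def)
  note qe = q_mult_L2[OF H_per_L2[OF e]]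
  have "bil e w = ip (multiplier_op L \<theta> e) w + ip (\<lambda>x. q x * e x) w"
    unfolding bil_def integral_multiplier_op[OF e X_L2[OF w], symmetric] by (simp add: l2_def)
  also have "\<dots> = ip (\<lambda>x. 1 * multiplier_op L \<theta> e x + 1 * (q x * e x)) w"
    by (subst l2_lin_left[OF h qe X_L2[OF w]]) simp
  also have "\<dots> = ip (\<lambda>x. \<mu> * e x) w"
    by (rule l2_cong_AE) (use eq L2_per_lin[OF h qe, of 1 1] L2_per_cmult[OF H_per_L2[OF e]] X_L2[OF w] in auto)
  also have "\<dots> = \<mu> * ip e w" by (simp add: l2_def mult.assoc)
  finally show ?thesis .
qed

text \<open>Simplicity and uniqueness are assumed for strong eigenfunctions in
  \<open>H_per L m\<close>; a critical point of the form in \<open>X\<close> qualifies only after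
  this regularity step.\<close>

lemma weak_imp_strong:
  assumes v: "v \<in> X" and eq: "\<And>w. w \<in> X \<Longrightarrow> bil v w = lam * ip v w"
  shows "v \<in> H_per L m" "AE x in lborel. multiplier_op L \<theta> v x + q x * v x = lam * v x"
proof -
  define f where "f = (\<lambda>x. lam * v x + (-1) * (q x * v x))"
  note vL = X_L2[OF v] and qv = q_mult_L2[OF X_L2[OF v]]
  have f: "f \<in> L2_per L" unfolding f_def by (rule L2_per_lin[OF vL qv])
  have weak: "T v w = int_per (\<lambda>x. f x * w x)" if "w \<in> X" for w
    using eq[OF that] l2_lin_left[OF vL qv X_L2[OF that], of lam "-1"] by (simp add: bil_def f_def l2_def)
  show "v \<in> H_per L m" by (rule weak_multiplier(1)[OF v f weak])
  have "AE x in lborel. multiplier_op L \<theta> v x = f x" by (rule weak_multiplier(2)[OF v f weak])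
  then show "AE x in lborel. multiplier_op L \<theta> v x + q x * v x = lam * v x"
    by (rule AE_mp) (auto intro!: AE_I2 simp: f_def)
qed

text \<open>Bounds on the form and on the L2 norm bound the \<open>X\<close> norm because the
  potential is bounded, so \<open>rellich\<close> applies. In the limit the potential term converges
  and the multiplier term is lower semicontinuous.\<close>

lemma form_compact:
  assumes v: "\<And>n. v n \<in> X" and B: "\<And>n. ip (v n) (v n) \<le> B"
    and R: "\<And>n. bil (v n) (v n) \<le> R n" "R \<longlonglongrightarrow> R0"
  obtains r w where "strict_mono (r :: nat \<Rightarrow> nat)" "w \<in> X" "bil w w \<le> R0"
    "(\<lambda>n. int_per (\<lambda>x. (v (r n) x - w x)\<^sup>2)) \<longlonglongrightarrow> 0"
proof -
  obtain K where K: "K > 0" "\<And>v. v \<in> X \<Longrightarrow> (Xn v)\<^sup>2 \<le> K * (int_per (\<lambda>x. (v x)\<^sup>2) + T v v)"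
    by (rule Xn_bound) blast
  obtain M where M: "\<And>n. \<bar>R n\<bar> \<le> M"
    using convergent_imp_Bseq[OF convergentI[OF R(2)]] by (auto simp: Bseq_def)
  have bound: "Xn (v n) \<le> sqrt (K * (B + (M + C * B)))" for n
  proof (rule real_le_rsqrt)
    have "T (v n) (v n) \<le> M + C * B"
      using bil_bounds[OF v[of n]] R(1)[of n] M[of n] mult_left_mono[OF B[of n] C_nonneg] by linarith
    then have "ip (v n) (v n) + T (v n) (v n) \<le> B + (M + C * B)" using B[of n] by linarith
    from mult_left_mono[OF this less_imp_le[OF K(1)]] K(2)[OF v[of n]]
    show "(Xn (v n))\<^sup>2 \<le> K * (B + (M + C * B))" by (simp add: l2_self)
  qed
  have m2: "m / 2 > 0" using m_pos by simp
  obtain r w where r: "strict_mono r" and w: "w \<in> X"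
    and co: "\<And>k. (\<lambda>n. fc (v (r n)) k) \<longlonglongrightarrow> fc w k"
    and lim: "(\<lambda>n. int_per (\<lambda>x. (v (r n) x - w x)\<^sup>2)) \<longlonglongrightarrow> 0"
    by (rule rellich[of L "m / 2" v, OF L m2 v bound]) blast
  have q_lim: "(\<lambda>n. int_per (\<lambda>x. q x * v (r n) x * v (r n) x)) \<longlonglongrightarrow> int_per (\<lambda>x. q x * w x * w x)"
    by (rule integral_weighted_sq_tendsto[OF q_per q_meas q_bd X_L2[OF v] X_L2[OF w] lim])
  have "wip th (fc w) (fc w) \<le> (R0 - int_per (\<lambda>x. q x * w x * w x)) / L"
  proof (rule wip_lsc(2)[where c="\<lambda>n. fc (v (r n))" and R="\<lambda>n. (R (r n) - int_per (\<lambda>x. q x * v (r n) x * v (r n) x)) / L"])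
    show "wip th (fc (v (r n))) (fc (v (r n))) \<le> (R (r n) - int_per (\<lambda>x. q x * v (r n) x * v (r n) x)) / L" for n
      using R(1)[of "r n"] L unfolding bil_def T_def l2_def by (simp add: pos_le_divide_eq mult.commute)
    show "(\<lambda>n. (R (r n) - int_per (\<lambda>x. q x * v (r n) x * v (r n) x)) / L) \<longlonglongrightarrow> (R0 - int_per (\<lambda>x. q x * w x * w x)) / L"
      using LIMSEQ_subseq_LIMSEQ[OF R(2) r] by (intro tendsto_intros q_lim) (use L in \<open>simp_all add: o_def\<close>)
  qed (use co wfin_th[OF v] in auto)
  then have "bil w w \<le> R0" unfolding bil_def T_def l2_def using L by (simp add: pos_le_divide_eq mult.commute)
  with r w show ?thesis using lim by (rule that)
qed

lemma ip_tendsto: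
  assumes v: "\<And>n. v n \<in> L2_per L" and w: "w \<in> L2_per L" and f: "f \<in> L2_per L"
    and lim: "(\<lambda>n. int_per (\<lambda>x. (v n x - w x)\<^sup>2)) \<longlonglongrightarrow> 0"
  shows "(\<lambda>n. ip (v n) f) \<longlonglongrightarrow> ip w f" "(\<lambda>n. ip (v n) (v n)) \<longlonglongrightarrow> ip w w"
proof -
  show "(\<lambda>n. ip (v n) f) \<longlonglongrightarrow> ip w f"
    using integral_L2_tendsto[OF f v w lim] by (simp add: l2_def mult.commute)
  show "(\<lambda>n. ip (v n) (v n)) \<longlonglongrightarrow> ip w w"
    using integral_weighted_sq_tendsto[of "\<lambda>x. 1" L 1, OF _ _ _ v w lim] by (simp add: l2_def)
qed

lemma orth_decomp:
  assumes e: "e \<in> X" and ee: "ip e e > 0" and w: "w \<in> X"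
  obtains w' s where "w' \<in> X" "ip w' e = 0" "w = (\<lambda>x. 1 * w' x + s * e x)"
proof -
  define s where "s = ip w e / ip e e"
  define w' where "w' = (\<lambda>x. 1 * w x + (- s) * e x)"
  have "ip w' e = 0"
    unfolding w'_def l2_lin_left[OF X_L2[OF w] X_L2[OF e] X_L2[OF e]] using ee by (simp add: s_def)
  moreover have "w' \<in> X" unfolding w'_def by (rule H_per_lin[OF w e])
  moreover have "w = (\<lambda>x. 1 * w' x + s * e x)" by (simp add: w'_def)
  ultimately show ?thesis using that by blast
qed

text \<open>The direct method on the L2 unit sphere of the complement of \<open>e\<close>. The
  minimum lies at or below the Rayleigh quotient of \<open>v0\<close>, and its level is a weak
  eigenvalue.\<close>

lemma rayleigh_minimizer:
  assumes e: "e \<in> X" and ee: "ip e e > 0" and eig: "\<And>w. w \<in> X \<Longrightarrow> bil e w = \<mu> * ip e w"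
    and v0: "v0 \<in> X" "ip v0 e = 0" "ip v0 v0 > 0"
  obtains l v where "v \<in> X" "ip v v = 1" "ip v e = 0" "l * ip v0 v0 \<le> bil v0 v0"
    "\<And>w. w \<in> X \<Longrightarrow> bil v w = l * ip v w"
proof -
  define Q where "Q = {bil v v |v. v \<in> X \<and> ip v v = 1 \<and> ip v e = 0}"
  define l where "l = Inf Q"
  have norm: "bil w w / ip w w \<in> Q" if w: "w \<in> X" "ip w e = 0" "ip w w > 0" for w
  proof -
    define c where "c = 1 / sqrt (ip w w)"
    have c2: "c\<^sup>2 = 1 / ip w w" using w(3) by (simp add: c_def power_divide)
    let ?w = "\<lambda>x. c * w x + 0 * w x"
    have "?w \<in> X" by (rule H_per_lin[OF w(1) w(1)])
    moreover have "ip ?w ?w = 1"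
      unfolding l2_lin_self[OF X_L2[OF w(1)] X_L2[OF w(1)]] using c2 w(3) by simp
    moreover have "ip ?w e = 0"
      unfolding l2_lin_left[OF X_L2[OF w(1)] X_L2[OF w(1)] X_L2[OF e]] using w(2) by simp
    moreover have "bil ?w ?w = bil w w / ip w w"
      unfolding bil_lin_self[OF w(1) w(1)] using c2 by simp
    ultimately show ?thesis unfolding Q_def by (intro CollectI exI[of _ ?w]) simp
  qed
  have ne: "Q \<noteq> {}" using norm[OF v0] by auto
  have "- C \<le> y" if y: "y \<in> Q" for y
  proof -
    obtain v where "y = bil v v" "v \<in> X" "ip v v = 1" using y by (auto simp: Q_def)
    then show ?thesis using bil_bounds[of v] T_nonneg[of v] by (simp add: abs_le_iff)
  qed
  then have bdd: "bdd_below Q" by (rule bdd_belowI)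
  have low: "l * ip w w \<le> bil w w" if w: "w \<in> X" "ip w e = 0" for w
  proof (cases "ip w w = 0")
    case True
    then show ?thesis using bil_null[OF w(1) True w(1)] by simp
  next
    case False
    then have p: "ip w w > 0" using l2_nonneg[of L w] by simp
    have "l \<le> bil w w / ip w w" unfolding l_def by (rule cInf_lower[OF norm[OF w p] bdd])
    then show ?thesis using p by (simp add: pos_le_divide_eq)
  qed
  have "\<exists>v. v \<in> X \<and> ip v v = 1 \<and> ip v e = 0 \<and> bil v v \<le> l + 1 / real (Suc n)" for n
  proof -
    have "Inf Q < l + 1 / real (Suc n)" by (simp add: l_def)
    then obtain y where "y \<in> Q" "y < l + 1 / real (Suc n)" using cInf_less_iff[OF ne bdd] by blast
    then show ?thesis unfolding Q_def by (auto intro: less_imp_le)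
  qed
  then obtain V where V: "\<And>n. V n \<in> X" "\<And>n. ip (V n) (V n) = 1" "\<And>n. ip (V n) e = 0"
    "\<And>n. bil (V n) (V n) \<le> l + 1 / real (Suc n)" by metis
  have Rl: "(\<lambda>n. l + 1 / real (Suc n)) \<longlonglongrightarrow> l"
    using tendsto_add[OF tendsto_const LIMSEQ_inverse_real_of_nat, of l] by (simp add: inverse_eq_divide)
  have V1: "ip (V n) (V n) \<le> 1" for n using V(2) by simp
  obtain r v where r: "strict_mono r" and v: "v \<in> X" "bil v v \<le> l"
    and lim: "(\<lambda>n. int_per (\<lambda>x. (V (r n) x - v x)\<^sup>2)) \<longlonglongrightarrow> 0"
    by (rule form_compact[of V, OF V(1) V1 V(4) Rl]) blast
  note tl = ip_tendsto[OF X_L2[OF V(1)] X_L2[OF v(1)] X_L2[OF e] lim]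
  have ve: "ip v e = 0" using tl(1) V(3) by (simp add: LIMSEQ_const_iff)
  have vv: "ip v v = 1" using tl(2) V(2) by (simp add: LIMSEQ_const_iff)
  have bv: "bil v v = l" using low[OF v(1) ve] v(2) vv by simp
  \<comment> \<open>For \<open>w\<close> in the complement, the form minus \<open>l\<close> times
    the L2 product is nonnegative along \<open>v + t * w\<close> and zero at \<open>t = 0\<close>,
    so its linear part vanishes.\<close>
  have orth: "bil v w = l * ip v w" if w: "w \<in> X" "ip w e = 0" for w
  proof -
    have "0 \<le> 2 * (bil v w - l * ip v w) * t + (bil w w - l * ip w w) * t\<^sup>2" for t
    proof -
      have "ip (\<lambda>x. 1 * v x + t * w x) e = 0"
        using l2_lin_left[OF X_L2[OF v(1)] X_L2[OF w(1)] X_L2[OF e], of 1 t] ve w(2) by simp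
      then show ?thesis
        using low[OF H_per_lin[OF v(1) w(1), of 1 t]] bv vv
        unfolding l2_lin_self[OF X_L2[OF v(1)] X_L2[OF w(1)]] bil_lin_self[OF v(1) w(1)]
        by (simp add: algebra_simps)
    qed
    from linear_quadratic_nonneg[OF this] show ?thesis by simp
  qed
  \<comment> \<open>The equation extends from the complement to all of \<open>X\<close>: since
    \<open>e\<close> is an eigenvector orthogonal to \<open>v\<close>, both sides vanish on
    it.\<close>
  have "bil v w = l * ip v w" if w: "w \<in> X" for w
  proof -
    obtain w' s where w': "w' \<in> X" "ip w' e = 0" "w = (\<lambda>x. 1 * w' x + s * e x)"
      by (rule orth_decomp[OF e ee w])
    have "bil w v = bil w' v + s * bil e v" unfolding w'(3) by (subst bil_lin_left[OF w'(1) e v(1)]) simp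
    moreover have "ip w v = ip w' v + s * ip e v"
      unfolding w'(3) by (subst l2_lin_left[OF X_L2[OF w'(1)] X_L2[OF e] X_L2[OF v(1)]]) simp
    moreover have "bil e v = 0" "ip e v = 0" using eig[OF v(1)] ve by (simp_all add: l2_commute)
    ultimately show ?thesis using orth[OF w'(1,2)] by (simp add: bil_commute[of v] l2_commute[of L v])
  qed
  then show ?thesis using that[OF v(1) vv ve _ ] low[OF v0(1,2)] by blast
qed

end

text \<open>Abstract data for an index count: eigenvectors at negative levels are multiples of
  \<open>e\<close>, the kernel lies in the span of \<open>z\<close>, \<open>\<eta>\<close> is a
  negative vector, and \<open>\<zeta>\<close> represents \<open>\<lambda>v. bil v \<eta>\<close> in
  L2. For the wave they become its negative eigenfunction, \<open>\<psi>'\<close>, the constant 1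
  and \<open>q\<close>.\<close>

locale spectral_setting = form_setting +
  fixes e z \<eta> \<zeta> :: "real \<Rightarrow> real" and \<mu> :: real
  assumes e: "e \<in> X" and ee: "ip e e > 0" and eig: "\<And>w. w \<in> X \<Longrightarrow> bil e w = \<mu> * ip e w"
    and neg: "\<And>v l. v \<in> X \<Longrightarrow> l < 0 \<Longrightarrow> (\<And>w. w \<in> X \<Longrightarrow> bil v w = l * ip v w) \<Longrightarrow> \<exists>c. AE x in lborel. v x = c * e x"
    and ker: "\<And>v. v \<in> X \<Longrightarrow> (\<And>w. w \<in> X \<Longrightarrow> bil v w = 0) \<Longrightarrow> \<exists>c. AE x in lborel. v x = c * z x"
    and z: "z \<in> L2_per L"
    and \<eta>: "\<eta> \<in> X" "bil \<eta> \<eta> < 0"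
    and \<zeta>: "\<zeta> \<in> L2_per L" "\<And>v. v \<in> X \<Longrightarrow> bil v \<eta> = ip v \<zeta>"
begin

text \<open>A negative value would produce, through \<open>rayleigh_minimizer\<close>, an
  eigenvector at a negative level orthogonal to \<open>e\<close>, although \<open>neg\<close> makes
  it a multiple of \<open>e\<close>.\<close>

lemma bil_orth_nonneg:
  assumes v: "v \<in> X" "ip v e = 0"
  shows "bil v v \<ge> 0"
proof (cases "ip v v = 0")
  case True
  then show ?thesis using bil_null[OF v(1) True v(1)] by simp
next
  case False
  then have p: "ip v v > 0" using l2_nonneg[of L v] by simp
  obtain l w where w: "w \<in> X" "ip w w = 1" "ip w e = 0" "l * ip v v \<le> bil v v"
    "\<And>u. u \<in> X \<Longrightarrow> bil w u = l * ip w u"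
    by (rule rayleigh_minimizer[OF e ee eig v p]) blast+
  have "\<not> l < 0"
  proof
    assume "l < 0"
    then obtain c where c: "AE x in lborel. w x = c * e x" using neg[OF w(1) _ w(5)] by blast
    have "ip w w = ip (\<lambda>x. c * e x) w"
      by (rule l2_cong_AE[OF c]) (use X_L2[OF w(1)] L2_per_cmult[OF X_L2[OF e]] in auto)
    also have "\<dots> = c * ip w e" by (simp add: l2_def mult_ac)
    finally show False using w(2,3) by simp
  qed
  then show ?thesis using w(4) p by (meson linorder_not_less mult_nonneg_nonneg less_imp_le order_trans)
qed

text \<open>On the complement of \<open>e\<close> the form is nonnegative, so a zero is a minimizer
  and the first variation vanishes; the direction \<open>e\<close> adds nothing, being an
  eigenvector orthogonal to \<open>v\<close>.\<close>

lemma bil_orth_zero: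
  assumes v: "v \<in> X" "ip v e = 0" "bil v v = 0"
  shows "\<exists>c. AE x in lborel. v x = c * z x"
proof (rule ker[OF v(1)])
  have orth: "bil v w = 0" if w: "w \<in> X" "ip w e = 0" for w
  proof -
    have "0 \<le> 2 * bil v w * t + bil w w * t\<^sup>2" for t
    proof -
      have "ip (\<lambda>x. 1 * v x + t * w x) e = 0"
        using l2_lin_left[OF X_L2[OF v(1)] X_L2[OF w(1)] X_L2[OF e], of 1 t] v(2) w(2) by simp
      then show ?thesis
        using bil_orth_nonneg[OF H_per_lin[OF v(1) w(1), of 1 t]] v(3)
        unfolding bil_lin_self[OF v(1) w(1)] by (simp add: algebra_simps)
    qed
    from linear_quadratic_nonneg[OF this] show ?thesis by simp
  qed
  fix w assume w: "w \<in> X"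
  obtain w' s where w': "w' \<in> X" "ip w' e = 0" "w = (\<lambda>x. 1 * w' x + s * e x)"
    by (rule orth_decomp[OF e ee w])
  have "bil w v = bil w' v + s * bil e v" unfolding w'(3) by (subst bil_lin_left[OF w'(1) e v(1)]) simp
  moreover have "bil e v = 0" using eig[OF v(1)] v(2) by (simp add: l2_commute)
  ultimately show "bil v w = 0" using orth[OF w'(1,2)] by (simp add: bil_commute[of v])
qed

text \<open>A nonzero such \<open>v\<close> would span with \<open>\<eta>\<close> a plane on which the form is nonpositive; the plane meets the
  complement of \<open>e\<close>, where the form is nonnegative.\<close>
lemma bil_definite:
  assumes v: "v \<in> X" "ip v \<zeta> = 0" "ip v z = 0" "bil v v \<le> 0"
  shows "ip v v = 0"
proof -
  \<comment> \<open>The coefficients place the combination in the complement of \<open>e\<close>,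
    and the cross term \<open>bil v \<eta> = ip v \<zeta>\<close> vanishes. A nonzero
    \<open>b\<close> would make the form negative there, so \<open>v\<close> itself is orthogonal to
    \<open>e\<close>.\<close>
  define a where "a = ip \<eta> e"
  define b where "b = - ip v e"
  let ?w = "\<lambda>x. a * v x + b * \<eta> x"
  have "ip ?w e = 0"
    unfolding l2_lin_left[OF X_L2[OF v(1)] X_L2[OF \<eta>(1)] X_L2[OF e]] by (simp add: a_def b_def)
  then have "0 \<le> bil ?w ?w" by (rule bil_orth_nonneg[OF H_per_lin[OF v(1) \<eta>(1)]])
  also have "bil ?w ?w = a\<^sup>2 * bil v v + b\<^sup>2 * bil \<eta> \<eta>"
    unfolding bil_lin_self[OF v(1) \<eta>(1)] using \<zeta>(2)[OF v(1)] v(2) by simp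
  finally have 1: "0 \<le> a\<^sup>2 * bil v v + b\<^sup>2 * bil \<eta> \<eta>" .
  have "a\<^sup>2 * bil v v \<le> 0" using v(4) by (simp add: mult_nonneg_nonpos)
  then have "0 \<le> b\<^sup>2 * bil \<eta> \<eta>" using 1 by linarith
  then have "b = 0" using \<eta>(2) by (auto simp: zero_le_mult_iff)
  then have ve: "ip v e = 0" by (simp add: b_def)
  have "bil v v = 0" using bil_orth_nonneg[OF v(1) ve] v(4) by simp
  then obtain c where c: "AE x in lborel. v x = c * z x" using bil_orth_zero[OF v(1) ve] by blast
  have "ip v v = ip (\<lambda>x. c * z x) v"
    by (rule l2_cong_AE[OF c]) (use X_L2[OF v(1)] L2_per_cmult[OF z] in auto)
  also have "\<dots> = c * ip v z" by (simp add: l2_def mult_ac)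
  finally show ?thesis using v(3) by simp
qed

text \<open>Contradiction and compactness, with failing constants \<open>1 / real (Suc n)\<close>
  and \<open>real n\<close>. A penalty instead of the constraint \<open>ip v \<zeta> = 0\<close>
  admits perturbations that meet the constraint only approximately.\<close>

theorem coercivity:
  obtains c N where "c > 0" "N \<ge> 0"
    "\<And>v. v \<in> X \<Longrightarrow> ip v z = 0 \<Longrightarrow> c * (Xn v)\<^sup>2 \<le> bil v v + N * (ip v \<zeta>)\<^sup>2"
proof -
  have "\<exists>c>0. \<exists>N\<ge>0. \<forall>v\<in>X. ip v z = 0 \<longrightarrow> c * (Xn v)\<^sup>2 \<le> bil v v + N * (ip v \<zeta>)\<^sup>2"
  proof (rule ccontr)
    assume contra: "\<not> ?thesis"
    have "\<exists>u. u \<in> X \<and> ip u z = 0 \<and> Xn u = 1 \<and> bil u u + real n * (ip u \<zeta>)\<^sup>2 \<le> 1 / real (Suc n)" for n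
    proof -
      have "\<not> (\<forall>v\<in>X. ip v z = 0 \<longrightarrow> (1 / real (Suc n)) * (Xn v)\<^sup>2 \<le> bil v v + real n * (ip v \<zeta>)\<^sup>2)"
      proof
        assume *: "\<forall>v\<in>X. ip v z = 0 \<longrightarrow> (1 / real (Suc n)) * (Xn v)\<^sup>2 \<le> bil v v + real n * (ip v \<zeta>)\<^sup>2"
        have "1 / real (Suc n) > 0" "real n \<ge> 0" by auto
        with * contra show False by blast
      qed
      then obtain v where v: "v \<in> X" "ip v z = 0"
        and lt: "bil v v + real n * (ip v \<zeta>)\<^sup>2 < (1 / real (Suc n)) * (Xn v)\<^sup>2" by (meson linorder_not_le)
      have "Xn v \<noteq> 0"
      proof
        assume "Xn v = 0"
        then have "ip v v \<le> 0" using L2_norm_le_H_norm[OF L _ v(1)] m_pos by (simp add: l2_self)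
        then have "ip v v = 0" using l2_nonneg[of L v] by linarith
        then have "bil v v = 0" by (rule bil_null[OF v(1) _ v(1)])
        moreover have "0 \<le> real n * (ip v \<zeta>)\<^sup>2" by simp
        moreover have "bil v v + real n * (ip v \<zeta>)\<^sup>2 < 0" using lt \<open>Xn v = 0\<close> by simp
        ultimately show False by linarith
      qed
      then have p: "Xn v > 0" using H_norm_nonneg[OF L, of "m / 2" v] by simp
      define c where "c = 1 / Xn v"
      let ?u = "\<lambda>x. c * v x + 0 * v x"
      have X: "?u \<in> X" by (rule H_per_lin[OF v(1) v(1)])
      have i: "ip ?u f = c * ip v f" if "f \<in> L2_per L" for f
        unfolding l2_lin_left[OF X_L2[OF v(1)] X_L2[OF v(1)] that] by simp
      have b: "bil ?u ?u = c\<^sup>2 * bil v v" unfolding bil_lin_self[OF v(1) v(1)] by simp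
      have "Xn ?u = 1" using p H_norm_cmult[OF L, of "m / 2" c v] by (simp add: c_def)
      moreover have "bil ?u ?u + real n * (ip ?u \<zeta>)\<^sup>2 \<le> 1 / real (Suc n)"
      proof -
        have "bil ?u ?u + real n * (ip ?u \<zeta>)\<^sup>2 = c\<^sup>2 * (bil v v + real n * (ip v \<zeta>)\<^sup>2)"
          unfolding b i[OF \<zeta>(1)] by (simp add: power_mult_distrib algebra_simps)
        also have "\<dots> \<le> c\<^sup>2 * ((1 / real (Suc n)) * (Xn v)\<^sup>2)" using lt by (intro mult_left_mono) auto
        also have "\<dots> = 1 / real (Suc n)" using p by (simp add: c_def power_divide)
        finally show ?thesis .
      qed
      ultimately show ?thesis using X i[OF z] v(2) by (intro exI[of _ ?u]) simp
    qed
    then obtain u where u: "\<And>n. u n \<in> X" "\<And>n. ip (u n) z = 0" "\<And>n. Xn (u n) = 1"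
      "\<And>n. bil (u n) (u n) + real n * (ip (u n) \<zeta>)\<^sup>2 \<le> 1 / real (Suc n)" by metis
    have u1: "ip (u n) (u n) \<le> 1" for n
      using L2_norm_le_H_norm[OF L _ u(1)[of n]] m_pos u(3)[of n] by (simp add: l2_self)
    have ub: "bil (u n) (u n) \<le> 1 / real (Suc n)" for n
    proof -
      have "0 \<le> real n * (ip (u n) \<zeta>)\<^sup>2" by simp
      then show ?thesis using u(4)[of n] by linarith
    qed
    have R0: "(\<lambda>n. 1 / real (Suc n)) \<longlonglongrightarrow> 0"
      using LIMSEQ_inverse_real_of_nat by (simp add: inverse_eq_divide)
    obtain r w where r: "strict_mono r" and w: "w \<in> X" "bil w w \<le> 0"
      and lim: "(\<lambda>n. int_per (\<lambda>x. (u (r n) x - w x)\<^sup>2)) \<longlonglongrightarrow> 0"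
      by (rule form_compact[of u, OF u(1) u1 ub R0]) blast
    note tl = ip_tendsto[OF X_L2[OF u(1)] X_L2[OF w(1)] _ lim]
    have wz: "ip w z = 0" using tl(1)[OF z] u(2) by (simp add: LIMSEQ_const_iff)
    \<comment> \<open>The form is at least \<open>- C\<close> on the sequence, so the penalty term
      stays bounded while its factor \<open>n\<close> grows.\<close>
    have "(\<lambda>n. (ip (u n) \<zeta>)\<^sup>2) \<longlonglongrightarrow> 0"
    proof (rule Lim_null_comparison)
      show "\<forall>\<^sub>F n in sequentially. norm ((ip (u n) \<zeta>)\<^sup>2) \<le> (1 + C) * (1 / real n)"
      proof (rule eventually_sequentiallyI[of 1])
        fix n :: nat assume n: "1 \<le> n"
        have "- C \<le> bil (u n) (u n)"
          using bil_bounds[OF u(1)[of n]] T_nonneg[of "u n"] mult_left_mono[OF u1[of n] C_nonneg] by linarith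
        moreover have "1 / real (Suc n) \<le> 1" by simp
        ultimately have "real n * (ip (u n) \<zeta>)\<^sup>2 \<le> 1 + C" using u(4)[of n] by linarith
        then show "norm ((ip (u n) \<zeta>)\<^sup>2) \<le> (1 + C) * (1 / real n)" using n by (simp add: pos_le_divide_eq mult.commute)
      qed
      show "(\<lambda>n. (1 + C) * (1 / real n)) \<longlonglongrightarrow> 0"
        using tendsto_mult_right_zero[OF lim_1_over_n] by simp
    qed
    then have "(\<lambda>n. (ip (u (r n)) \<zeta>)\<^sup>2) \<longlonglongrightarrow> 0" using LIMSEQ_subseq_LIMSEQ[OF _ r] by (fastforce simp: o_def)
    moreover have "(\<lambda>n. (ip (u (r n)) \<zeta>)\<^sup>2) \<longlonglongrightarrow> (ip w \<zeta>)\<^sup>2" by (intro tendsto_intros tl(1) \<zeta>(1))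
    ultimately have "(ip w \<zeta>)\<^sup>2 = 0" using LIMSEQ_unique by blast
    then have "ip w w = 0" using bil_definite[OF w(1) _ wz w(2)] by simp
    then have l0: "(\<lambda>n. ip (u (r n)) (u (r n))) \<longlonglongrightarrow> 0" using tl(2)[OF z] by simp
    obtain K where K: "K > 0" "\<And>v. v \<in> X \<Longrightarrow> (Xn v)\<^sup>2 \<le> K * (int_per (\<lambda>x. (v x)\<^sup>2) + T v v)"
      by (rule Xn_bound) blast
    \<comment> \<open>The norm, which is 1, is dominated by the L2 part and the multiplier form. The
      former tends to zero, and the latter is bounded by quantities that do.\<close>
    have "1 \<le> K * (ip (u (r n)) (u (r n)) + (1 / real (Suc (r n)) + C * ip (u (r n)) (u (r n))))" for n
    proof -
      have "T (u (r n)) (u (r n)) \<le> 1 / real (Suc (r n)) + C * ip (u (r n)) (u (r n))"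
        using bil_bounds[OF u(1)[of "r n"]] ub[of "r n"] by linarith
      then have "ip (u (r n)) (u (r n)) + T (u (r n)) (u (r n)) \<le> ip (u (r n)) (u (r n)) + (1 / real (Suc (r n)) + C * ip (u (r n)) (u (r n)))"
        by linarith
      from mult_left_mono[OF this less_imp_le[OF K(1)]] K(2)[OF u(1)[of "r n"]] u(3)[of "r n"]
      show ?thesis by (simp add: l2_self)
    qed
    moreover have "(\<lambda>n. K * (ip (u (r n)) (u (r n)) + (1 / real (Suc (r n)) + C * ip (u (r n)) (u (r n)))))
      \<longlonglongrightarrow> K * (0 + (0 + C * 0))"
      using LIMSEQ_subseq_LIMSEQ[OF R0 r] by (intro tendsto_intros l0) (simp add: o_def)
    ultimately have "1 \<le> K * (0 + (0 + C * 0))" using LIMSEQ_le_const by blast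
    then show False by simp
  qed
  then show ?thesis using that by blast
qed

end

section \<open>The cubic bound\<close>

lemma cube_diff_le:
  fixes s t N :: real
  assumes "0 \<le> s" "s \<le> N" "0 \<le> t" "t \<le> N"
  shows "\<bar>s ^ 3 - t ^ 3\<bar> \<le> 3 * N\<^sup>2 * \<bar>s - t\<bar>"
proof -
  have "s ^ 3 - t ^ 3 = (s\<^sup>2 + s * t + t\<^sup>2) * (s - t)" by (simp add: power2_eq_square power3_eq_cube algebra_simps)
  moreover have "0 \<le> s\<^sup>2 + s * t + t\<^sup>2" using assms by simp
  moreover have "s\<^sup>2 + s * t + t\<^sup>2 \<le> N\<^sup>2 + N * N + N\<^sup>2"
    using assms by (intro add_mono power_mono mult_mono) auto
  ultimately show ?thesis
    by (simp add: abs_mult mult_right_mono power2_eq_square)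
qed

lemma cube_add_le:
  fixes a b :: real
  assumes "0 \<le> a" "0 \<le> b"
  shows "(a + b) ^ 3 \<le> 4 * (a ^ 3 + b ^ 3)"
proof -
  have "4 * (a ^ 3 + b ^ 3) - (a + b) ^ 3 = 3 * (a + b) * (a - b)\<^sup>2"
    by (simp add: power2_eq_square power3_eq_cube algebra_simps)
  moreover have "0 \<le> 3 * (a + b) * (a - b)\<^sup>2" using assms by simp
  ultimately show ?thesis by linarith
qed

context multiplier_setting
begin

definition N3 :: "(real \<Rightarrow> real) \<Rightarrow> real" where
  "N3 v = int_per (\<lambda>x. \<bar>v x\<bar> ^ 3)"

lemma N3_nonneg: "N3 v \<ge> 0"
  unfolding N3_def by simp

lemma N3_cmult: "N3 (\<lambda>x. a * v x) = \<bar>a\<bar> ^ 3 * N3 v"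
  unfolding N3_def by (simp add: abs_mult power_mult_distrib)

lemma L1_le_Xn: "v \<in> X \<Longrightarrow> int_per (\<lambda>x. \<bar>v x\<bar>) \<le> sqrt L * Xn v"
proof -
  assume v: "v \<in> X"
  have "sqrt (int_per (\<lambda>x. (v x)\<^sup>2)) \<le> Xn v"
    using L2_norm_le_H_norm[OF L _ v] m_pos H_norm_nonneg[OF L, of "m / 2" v] by (intro real_le_lsqrt) auto
  then show ?thesis using L2_norm_L1[OF L X_L2[OF v]] L
    by (meson mult_left_mono order_trans real_sqrt_ge_zero less_imp_le)
qed

context
  assumes cubic: "\<And>v. v \<in> X \<Longrightarrow> integrable (per L) (\<lambda>x. \<bar>v x\<bar> ^ 3)"
begin

text \<open>The truncations at height \<open>N\<close> are Lipschitz in L1, hence continuous on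
  \<open>X\<close>, and their integrals converge to \<open>N3\<close> from below. This makes
  \<open>N3\<close> lower semicontinuous before any continuity of it is known.\<close>

lemma N3_open:
  assumes x: "x \<in> X" and n: "N3 x > B"
  obtains r where "r > 0" "\<And>y. y \<in> X \<Longrightarrow> Xn (\<lambda>t. y t - x t) \<le> r \<Longrightarrow> N3 y > B"
proof -
  define \<phi> where "\<phi> N t = (min \<bar>t\<bar> (real N)) ^ 3" for N t
  have [measurable]: "\<phi> N \<in> borel_measurable borel" for N unfolding \<phi>_def by measurable
  have \<phi>: "0 \<le> \<phi> N t" "\<phi> N t \<le> \<bar>t\<bar> ^ 3" for N t
    unfolding \<phi>_def by (auto intro!: power_mono)
  have meas: "(\<lambda>t. \<phi> N (v t)) \<in> borel_measurable (per L)" if "v \<in> X" for N v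
  proof -
    note [measurable] = L2_perD(2)[OF X_L2[OF that]]
    show ?thesis by (intro borel_measurable_per) measurable
  qed
  have int: "integrable (per L) (\<lambda>t. \<phi> N (v t))" if "v \<in> X" for N v
    by (rule Bochner_Integration.integrable_bound[OF cubic[OF that] meas[OF that]]) (use \<phi> in \<open>auto intro!: AE_I2\<close>)
  have "(\<lambda>N. int_per (\<lambda>t. \<phi> N (x t))) \<longlonglongrightarrow> N3 x"
    unfolding N3_def
  proof (rule integral_dominated_convergence[where w="\<lambda>t. \<bar>x t\<bar> ^ 3"])
    show "(\<lambda>t. \<bar>x t\<bar> ^ 3) \<in> borel_measurable (per L)" using cubic[OF x] by (rule borel_measurable_integrable)
    show "integrable (per L) (\<lambda>t. \<bar>x t\<bar> ^ 3)" by (rule cubic[OF x])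
    show "AE t in per L. norm (\<phi> N (x t)) \<le> \<bar>x t\<bar> ^ 3" for N using \<phi> by (intro AE_I2) auto
    have "(\<lambda>N. \<phi> N s) \<longlonglongrightarrow> \<bar>s\<bar> ^ 3" for s
    proof (rule tendsto_eventually, rule eventually_sequentiallyI[of "nat \<lceil>\<bar>s\<bar>\<rceil>"])
      fix N assume "nat \<lceil>\<bar>s\<bar>\<rceil> \<le> N"
      then have "\<bar>s\<bar> \<le> real N" by linarith
      then show "\<phi> N s = \<bar>s\<bar> ^ 3" by (simp add: \<phi>_def)
    qed
    then show "AE t in per L. (\<lambda>N. \<phi> N (x t)) \<longlonglongrightarrow> \<bar>x t\<bar> ^ 3" by (intro AE_I2)
  qed (rule meas[OF x])
  then have "\<forall>\<^sub>F N in sequentially. B < int_per (\<lambda>t. \<phi> N (x t))" by (rule order_tendstoD(1)) (rule n)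
  then obtain N where N: "B < int_per (\<lambda>t. \<phi> N (x t))" by (auto simp: eventually_sequentially)
  define K where "K = 3 * (real N)\<^sup>2 * sqrt L + 1"
  have K: "K > 0" unfolding K_def using L by (simp add: add_nonneg_pos)
  \<comment> \<open>The radius lets the truncated integral drop by at most half of its excess over
    \<open>B\<close>; the 1 in \<open>K\<close> avoids division by zero for
    \<open>N = 0\<close>.\<close>
  define r where "r = (int_per (\<lambda>t. \<phi> N (x t)) - B) / (2 * K)"
  show ?thesis
  proof (rule that[of r])
    show r: "r > 0" using N K by (simp add: r_def)
    fix y assume y: "y \<in> X" and d: "Xn (\<lambda>t. y t - x t) \<le> r"
    have dX: "(\<lambda>t. y t - x t) \<in> X" by (rule H_per_diff[OF y x])
    have "int_per (\<lambda>t. \<phi> N (x t)) - int_per (\<lambda>t. \<phi> N (y t)) = int_per (\<lambda>t. \<phi> N (x t) - \<phi> N (y t))"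
      using int[OF x] int[OF y] by simp
    also have "\<dots> \<le> int_per (\<lambda>t. 3 * (real N)\<^sup>2 * \<bar>y t - x t\<bar>)"
    proof (rule integral_mono)
      show "integrable (per L) (\<lambda>t. \<phi> N (x t) - \<phi> N (y t))" using int[OF x] int[OF y] by simp
      show "integrable (per L) (\<lambda>t. 3 * (real N)\<^sup>2 * \<bar>y t - x t\<bar>)"
        using L2_per_integrable[OF X_L2[OF dX]] by simp
      fix t
      have "\<phi> N (x t) - \<phi> N (y t) \<le> 3 * (real N)\<^sup>2 * \<bar>min \<bar>x t\<bar> (real N) - min \<bar>y t\<bar> (real N)\<bar>"
        unfolding \<phi>_def by (rule order_trans[OF abs_ge_self cube_diff_le]) auto
      also have "\<dots> \<le> 3 * (real N)\<^sup>2 * \<bar>y t - x t\<bar>" by (intro mult_left_mono) (auto simp: min_def)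
      finally show "\<phi> N (x t) - \<phi> N (y t) \<le> 3 * (real N)\<^sup>2 * \<bar>y t - x t\<bar>" .
    qed
    also have "\<dots> = 3 * (real N)\<^sup>2 * int_per (\<lambda>t. \<bar>y t - x t\<bar>)" by simp
    also have "\<dots> \<le> 3 * (real N)\<^sup>2 * (sqrt L * r)"
      using L1_le_Xn[OF dX] d L by (intro mult_left_mono order_trans[OF L1_le_Xn[OF dX]]) auto
    also have "\<dots> \<le> K * r" using r by (simp add: K_def algebra_simps)
    also have "\<dots> = (int_per (\<lambda>t. \<phi> N (x t)) - B) / 2" using K by (simp add: r_def)
    finally have "B < int_per (\<lambda>t. \<phi> N (y t))" using N by (simp add: field_simps)
    also have "\<dots> \<le> N3 y" unfolding N3_def using int[OF y] cubic[OF y] \<phi> by (intro integral_mono) auto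
    finally show "N3 y > B" .
  qed
qed

text \<open>As \<open>2 * h\<close> is the difference of \<open>x + h\<close> and
  \<open>x - h\<close>, one of the two has cubic integral at least \<open>N3 h\<close>. An
  \<open>h\<close> of small norm and large \<open>N3\<close> therefore makes the superlevel sets
  dense.\<close>

lemma N3_convex:
  assumes x: "x \<in> X" and h: "h \<in> X"
  shows "2 * N3 h \<le> N3 (\<lambda>t. x t + h t) + N3 (\<lambda>t. x t - h t)"
proof -
  note i = cubic[OF H_per_add[OF x h]] cubic[OF H_per_diff[OF x h]]
  have "2 * N3 h = int_per (\<lambda>t. 2 * \<bar>h t\<bar> ^ 3)" by (simp add: N3_def)
  also have "\<dots> \<le> int_per (\<lambda>t. \<bar>x t + h t\<bar> ^ 3 + \<bar>x t - h t\<bar> ^ 3)"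
  proof (rule integral_mono)
    fix t
    have "(2 * \<bar>h t\<bar>) ^ 3 \<le> (\<bar>x t + h t\<bar> + \<bar>x t - h t\<bar>) ^ 3" by (rule power_mono) auto
    also have "\<dots> \<le> 4 * (\<bar>x t + h t\<bar> ^ 3 + \<bar>x t - h t\<bar> ^ 3)" by (rule cube_add_le) auto
    finally show "2 * \<bar>h t\<bar> ^ 3 \<le> \<bar>x t + h t\<bar> ^ 3 + \<bar>x t - h t\<bar> ^ 3" by (simp add: power_mult_distrib)
  qed (use i cubic[OF h] in auto)
  also have "\<dots> = N3 (\<lambda>t. x t + h t) + N3 (\<lambda>t. x t - h t)" unfolding N3_def using i by simp
  finally show ?thesis .
qed

text \<open>Coefficients converge along a subsequence by \<open>rellich\<close>, and lower
  semicontinuity carries the rates \<open>r n\<close> over to the limit.\<close>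

lemma Xn_complete:
  fixes x :: "nat \<Rightarrow> real \<Rightarrow> real"
  assumes x: "\<And>n. x n \<in> X" and c: "\<And>n m. n \<le> m \<Longrightarrow> Xn (\<lambda>t. x m t - x n t) \<le> r n"
  obtains w where "w \<in> X" "\<And>n. Xn (\<lambda>t. w t - x n t) \<le> r n"
proof -
  have b: "Xn (x n) \<le> Xn (x 0) + r 0" for n
    using H_norm_triangle[OF L H_per_diff[OF x[of n] x[of 0]] x[of 0]] c[of 0 n] by simp
  have m2: "m / 2 > 0" using m_pos by simp
  obtain s w where s: "strict_mono s" and w: "w \<in> X" and co: "\<And>k. (\<lambda>n. fc (x (s n)) k) \<longlonglongrightarrow> fc w k"
    by (rule rellich[of L "m / 2" x, OF L m2 x b]) blast
  have "Xn (\<lambda>t. w t - x n t) \<le> r n" for n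
  proof -
    have fd: "fc (\<lambda>t. y t - x n t) k = fc y k - fc (x n) k" if "y \<in> X" for y k
      by (rule fourier_coeff_diff[OF L2_per_integrable[OF X_L2[OF that]] L2_per_integrable[OF X_L2[OF x]]])
    have rn: "r n \<ge> 0" using c[of n n] H_norm_nonneg[OF L] order_trans by blast
    have "wip (sobw (m / 2)) (fc (\<lambda>t. w t - x n t)) (fc (\<lambda>t. w t - x n t)) \<le> (r n)\<^sup>2 / L"
    \<comment> \<open>Starting the subsequence at \<open>n\<close> keeps its indices at or above
      \<open>n\<close>, where the rate \<open>r n\<close> is available.\<close>
    proof (rule wip_lsc(2)[where c="\<lambda>j. fc (\<lambda>t. x (s (j + n)) t - x n t)" and R="\<lambda>j. (r n)\<^sup>2 / L"])
      show "(\<lambda>j. fc (\<lambda>t. x (s (j + n)) t - x n t) k) \<longlonglongrightarrow> fc (\<lambda>t. w t - x n t) k" for k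
        unfolding fd[OF x] fd[OF w] by (intro tendsto_intros LIMSEQ_ignore_initial_segment co)
      show "wfin (sobw (m / 2)) (fc (\<lambda>t. x (s (j + n)) t - x n t))" for j
        using H_per_diff[OF x x] by (simp add: H_per_iff)
      fix j
      have "n \<le> s (j + n)" using seq_suble[OF s, of "j + n"] by simp
      from power_mono[OF c[OF this] H_norm_nonneg[OF L], of 2]
      show "wip (sobw (m / 2)) (fc (\<lambda>t. x (s (j + n)) t - x n t)) (fc (\<lambda>t. x (s (j + n)) t - x n t)) \<le> (r n)\<^sup>2 / L"
        using L by (simp add: H_norm_sq pos_le_divide_eq mult.commute)
    qed auto
    then have "(Xn (\<lambda>t. w t - x n t))\<^sup>2 \<le> (r n)\<^sup>2"
      unfolding H_norm_sq[OF L] using L by (simp add: pos_le_divide_eq mult.commute)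
    then show ?thesis using rn by (rule power2_le_imp_le)
  qed
  with w show ?thesis by (rule that)
qed

text \<open>Uniform boundedness by nested balls: were the cubic integral unbounded on the unit ball, its superlevel
  sets would be open and dense, and some element of the space would not be cubically integrable.\<close>
theorem cubic_bound:
  obtains K where "K \<ge> 0" "\<And>v. v \<in> X \<Longrightarrow> N3 v \<le> K * (Xn v) ^ 3"
proof -
  have "\<exists>B. \<forall>v\<in>X. Xn v \<le> 1 \<longrightarrow> N3 v \<le> B"
  proof (rule ccontr)
    assume "\<nexists>B. \<forall>v\<in>X. Xn v \<le> 1 \<longrightarrow> N3 v \<le> B"
    then have unb: "\<exists>v\<in>X. Xn v \<le> 1 \<and> N3 v > B" for B by (meson linorder_not_le)
    \<comment> \<open>A pair is the center and radius of a closed ball. The bound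
      \<open>real n - 1\<close> makes the property hold at \<open>n = 0\<close> without any choice,
      as \<open>N3\<close> is nonnegative.\<close>
    define P where "P n p \<longleftrightarrow> fst p \<in> X \<and> snd p > 0 \<and> (\<forall>y\<in>X. Xn (\<lambda>t. y t - fst p t) \<le> snd p \<longrightarrow> N3 y > real n - 1)"
      for n and p :: "(real \<Rightarrow> real) \<times> real"
    define S where "S p p' \<longleftrightarrow> Xn (\<lambda>t. fst p' t - fst p t) \<le> snd p / 2 \<and> snd p' \<le> snd p / 2"
      for p p' :: "(real \<Rightarrow> real) \<times> real"
    have "\<exists>f. \<forall>n. P n (f n) \<and> S (f n) (f (Suc n))"
    proof (rule dependent_nat_choice)
      have "P 0 (\<lambda>x. 0, 1)" unfolding P_def using H_per_const[OF L] N3_nonneg by (auto intro: less_le_trans[of _ 0])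
      then show "\<exists>p. P 0 p" by blast
    next
      fix p n assume "P n p"
      then obtain x r where p: "p = (x, r)" and x: "x \<in> X" and r: "r > 0" by (cases p) (auto simp: P_def)
      \<comment> \<open>Scaling \<open>h\<close> by \<open>r / 2\<close> multiplies
        \<open>N3\<close> by \<open>(r / 2) ^ 3\<close>, which this threshold compensates.\<close>
      obtain h where h: "h \<in> X" "Xn h \<le> 1" "N3 h > real n / (r / 2) ^ 3" using unb by blast
      define h' where "h' = (\<lambda>t. (r / 2) * h t)"
      have h'X: "h' \<in> X" unfolding h'_def by (rule H_per_cmult[OF h(1)])
      have h'n: "Xn h' \<le> r / 2" unfolding h'_def H_norm_cmult[OF L] using h(2) r by simp
      have N3h': "N3 h' > real n" unfolding h'_def N3_cmult using h(3) r by (simp add: pos_divide_less_eq mult.commute)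
      have "\<exists>x'\<in>X. Xn (\<lambda>t. x' t - x t) \<le> r / 2 \<and> N3 x' > real n"
      proof (cases "N3 (\<lambda>t. x t + h' t) > real n")
        case True
        then show ?thesis using H_per_add[OF x h'X] h'n by (intro bexI[of _ "\<lambda>t. x t + h' t"]) auto
      next
        case False
        then have "N3 (\<lambda>t. x t - h' t) > real n" using N3_convex[OF x h'X] N3h' by linarith
        moreover have "Xn (\<lambda>t. x t - h' t - x t) \<le> r / 2" using H_norm_cmult[OF L, of "m / 2" "-1" h'] h'n by simp
        ultimately show ?thesis using H_per_diff[OF x h'X] by (intro bexI[of _ "\<lambda>t. x t - h' t"]) auto
      qed
      then obtain x' where x': "x' \<in> X" "Xn (\<lambda>t. x' t - x t) \<le> r / 2" "N3 x' > real n" by blast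
      obtain r' where r': "r' > 0" "\<And>y. y \<in> X \<Longrightarrow> Xn (\<lambda>t. y t - x' t) \<le> r' \<Longrightarrow> N3 y > real n"
        by (rule N3_open[OF x'(1,3)]) blast
      have "P (Suc n) (x', min r' (r / 2))" unfolding P_def using x'(1) r' r by auto
      moreover have "S p (x', min r' (r / 2))" unfolding S_def p using x'(2) by simp
      ultimately show "\<exists>p'. P (Suc n) p' \<and> S p p'" by blast
    qed
    then obtain f where f: "\<And>n. P n (f n)" "\<And>n. S (f n) (f (Suc n))" by blast
    define x where "x n = fst (f n)" for n
    define r where "r n = snd (f n)" for n
    have x: "x n \<in> X" and big: "y \<in> X \<Longrightarrow> Xn (\<lambda>t. y t - x n t) \<le> r n \<Longrightarrow> N3 y > real n - 1" and rp: "r n > 0" for n y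
      using f(1)[of n] by (auto simp: P_def x_def r_def)
    have st: "Xn (\<lambda>t. x (Suc n) t - x n t) \<le> r n / 2" "r (Suc n) \<le> r n / 2" for n
      using f(2)[of n] by (auto simp: S_def x_def r_def)
    \<comment> \<open>Each step moves the center by at most half the radius, and the radius loses at
      least as much, so the displacements telescope.\<close>
    have cauchy: "Xn (\<lambda>t. x m t - x n t) \<le> r n - r m" if "n \<le> m" for n m
      using that
    proof (induction m rule: dec_induct)
      case base
      have "Xn (\<lambda>t. 0 * x n t) = 0" unfolding H_norm_cmult[OF L] by simp
      then show ?case by simp
    next
      case (step m)
      have "Xn (\<lambda>t. (x (Suc m) t - x m t) + (x m t - x n t)) \<le> Xn (\<lambda>t. x (Suc m) t - x m t) + Xn (\<lambda>t. x m t - x n t)"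
        by (rule H_norm_triangle[OF L H_per_diff[OF x x] H_per_diff[OF x x]])
      then show ?case using step.IH st[of m] by simp
    qed
    have cr: "Xn (\<lambda>t. x m t - x n t) \<le> r n" if "n \<le> m" for n m
      using cauchy[OF that] rp[of m] by linarith
    obtain w where w: "w \<in> X" "\<And>n. Xn (\<lambda>t. w t - x n t) \<le> r n"
      by (rule Xn_complete[of x r, OF x cr]) blast+
    obtain n where "N3 w + 1 < real n" using reals_Archimedean2 by blast
    then show False using big[OF w(1) w(2)[of n]] by simp
  qed
  then obtain B where B: "\<And>v. v \<in> X \<Longrightarrow> Xn v \<le> 1 \<Longrightarrow> N3 v \<le> B" by blast
  show ?thesis
  proof (rule that[of "max B 0"])
    fix v assume v: "v \<in> X"
    show "N3 v \<le> max B 0 * (Xn v) ^ 3"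
    proof (cases "Xn v = 0")
      case True
      then have "int_per (\<lambda>x. (v x)\<^sup>2) \<le> 0" using L2_norm_le_H_norm[OF L _ v] m_pos by simp
      then have "l2 L v v \<le> 0" by (simp add: l2_self)
      then have "l2 L v v = 0" using l2_nonneg[of L v] by linarith
      from l2_self_eq_0(1)[OF L X_L2[OF v] this]
      have "AE x in per L. \<bar>v x\<bar> ^ 3 = 0" by (intro AE_perI) simp
      then have "N3 v = int_per (\<lambda>x. 0)"
        unfolding N3_def using borel_measurable_integrable[OF cubic[OF v]] by (intro integral_cong_AE) auto
      then show ?thesis using True by simp
    next
      case False
      then have p: "Xn v > 0" using H_norm_nonneg[OF L, of "m / 2" v] by simp
      have "Xn (\<lambda>x. (1 / Xn v) * v x) = 1" unfolding H_norm_cmult[OF L] using p by simp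
      then have "N3 (\<lambda>x. (1 / Xn v) * v x) \<le> B" by (intro B[OF H_per_cmult[OF v]]) simp
      then have "N3 v / (Xn v) ^ 3 \<le> B" unfolding N3_cmult using p by (simp add: power_divide)
      then have "N3 v \<le> B * (Xn v) ^ 3" using p by (simp add: pos_divide_le_eq)
      also have "\<dots> \<le> max B 0 * (Xn v) ^ 3" using p by (intro mult_right_mono) auto
      finally show ?thesis .
    qed
  qed simp
qed

end

end

section \<open>Modulation\<close>

lemma periodic_bounded:
  fixes f :: "real \<Rightarrow> real"
  assumes L: "L > 0" and p: "\<And>x. f (x + L) = f x" and c: "continuous_on UNIV f"
  obtains B where "\<And>x. \<bar>f x\<bar> \<le> B"
proof -
  have "compact (f ` {0..L})" by (intro compact_continuous_image continuous_on_subset[OF c]) auto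
  then obtain B where B: "\<And>x. x \<in> {0..L} \<Longrightarrow> \<bar>f x\<bar> \<le> B"
    by (force dest!: compact_imp_bounded simp: bounded_iff)
  have "\<bar>f x\<bar> \<le> B" for x
  proof -
    obtain n where "x + of_int n * L \<in> {0..L}" by (rule period_reduce[OF L])
    then show ?thesis using B[of "x + of_int n * L"] periodic_int[of f L x n] p by simp
  qed
  then show ?thesis by (rule that)
qed

lemma periodic_deriv:
  fixes f :: "real \<Rightarrow> real"
  assumes p: "\<And>x. f (x + L) = f x" and d: "\<And>x. (f has_real_derivative f' x) (at x)"
  shows "f' (x + L) = f' x"
proof -
  have "((\<lambda>x. f (x + L)) has_real_derivative f' (x + L)) (at x)"
    using d[of "x + L"] by (simp add: DERIV_shift)
  then have "(f has_real_derivative f' (x + L)) (at x)" by (simp add: p)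
  then show ?thesis using d DERIV_unique by blast
qed

lemma lipschitz_of_derivative:
  fixes f :: "real \<Rightarrow> real"
  assumes d: "\<And>x. (f has_real_derivative f' x) (at x)" and B: "\<And>x. \<bar>f' x\<bar> \<le> B"
  shows "\<bar>f x - f y\<bar> \<le> B * \<bar>x - y\<bar>"
proof -
  have "norm (f x - f y) \<le> B * norm (x - y)"
    by (rule field_differentiable_bound[of UNIV]) (use d B in auto)
  then show ?thesis by simp
qed

text \<open>The mean value inequality for \<open>f\<close> minus its tangent line. It loses a factor
  2 against the sharp Taylor remainder, which is harmless here.\<close>

lemma taylor1_of_second_derivative:
  fixes f :: "real \<Rightarrow> real"
  assumes d: "\<And>x. (f has_real_derivative f' x) (at x)" and d': "\<And>x. (f' has_real_derivative f'' x) (at x)"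
    and B: "\<And>x. \<bar>f'' x\<bar> \<le> B"
  shows "\<bar>f (x - h) - f x + h * f' x\<bar> \<le> B * h\<^sup>2"
proof -
  have B0: "0 \<le> B" using B[of 0] by linarith
  have bound: "\<bar>f' y - f' x\<bar> \<le> B * \<bar>h\<bar>" if "\<bar>y - x\<bar> \<le> \<bar>h\<bar>" for y
    using lipschitz_of_derivative[OF d' B, of y x] mult_left_mono[OF that B0] by linarith
  define g where "g y = f y - (y - x) * f' x" for y
  have g: "(g has_real_derivative f' y - f' x) (at y)" for y
    unfolding g_def by (auto intro!: derivative_eq_intros d)
  have "norm (g (x - h) - g x) \<le> (B * \<bar>h\<bar>) * norm ((x - h) - x)"
  proof (rule field_differentiable_bound[of "cball x \<bar>h\<bar>"])
    fix y assume "y \<in> cball x \<bar>h\<bar>"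
    then show "(g has_real_derivative f' y - f' x) (at y within cball x \<bar>h\<bar>)" "norm (f' y - f' x) \<le> B * \<bar>h\<bar>"
      using g bound[of y] by (auto simp: dist_real_def abs_minus_commute[of x y] intro: has_field_derivative_at_within)
  qed (auto simp: dist_real_def)
  then show ?thesis by (simp add: g_def power2_eq_square mult.assoc)
qed

text \<open>Integration by parts; the boundary terms cancel by periodicity.\<close>

lemma fourier_coeff_derivative:
  fixes f f' :: "real \<Rightarrow> real"
  assumes L: "L > 0" and p: "\<And>x. f (x + L) = f x" and d: "\<And>x. (f has_real_derivative f' x) (at x)"
    and c: "continuous_on UNIV f'"
  shows "fourier_coeff L f' k = \<i> * of_real (2 * pi * of_int k / L) * fourier_coeff L f k"
proof -
  define a :: complex where "a = \<i> * of_real (2 * pi * of_int (- k) / L)"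
  have cf: "continuous_on UNIV f" using d by (meson DERIV_isCont continuous_at_imp_continuous_on)
  have int: "integrable (per L) g" if g: "\<And>x. g (x + L) = g x" "continuous_on UNIV g" for g :: "real \<Rightarrow> real"
  proof -
    obtain B where "\<And>x. \<bar>g x\<bar> \<le> B" by (rule periodic_bounded[OF L g]) blast
    then show ?thesis using g
      by (intro L2_per_integrable L2_per_bounded[of g L B] borel_measurable_continuous_onI) auto
  qed
  have i: "integrable (per L) f" "integrable (per L) f'"
    using int[of f] int[of f'] p cf c periodic_deriv[of f L f', OF p d] by auto
  have dd: "((\<lambda>x. of_real (f x) * emode L (- k) x) has_vector_derivative
      (of_real (f x) * (a * emode L (- k) x) + of_real (f' x) * emode L (- k) x)) (at x)" for x
  proof (rule has_vector_derivative_mult)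
    show "((\<lambda>x. complex_of_real (f x)) has_vector_derivative of_real (f' x)) (at x)"
      by (rule has_vector_derivative_of_real) (use d in \<open>simp add: has_real_derivative_iff_has_vector_derivative\<close>)
    show "(emode L (- k) has_vector_derivative a * emode L (- k) x) (at x)"
      unfolding a_def by (rule emode_has_vector_derivative)
  qed
  have "iper L (\<lambda>x. of_real (f x) * (a * emode L (- k) x) + of_real (f' x) * emode L (- k) x)
    = of_real (f L) * emode L (- k) L - of_real (f 0) * emode L (- k) 0"
    by (rule integral_per_FTC[OF less_imp_le[OF L] dd])
      (intro continuous_intros continuous_on_emode cf c)
  also have "\<dots> = 0" using p[of 0] emode_period[of L "- k" 0] L by simp
  finally have "iper L (\<lambda>x. a * (of_real (f x) * emode L (- k) x) + of_real (f' x) * emode L (- k) x) = 0"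
    by (simp add: mult.left_commute)
  then have "a * iper L (\<lambda>x. of_real (f x) * emode L (- k) x) + iper L (\<lambda>x. of_real (f' x) * emode L (- k) x) = 0"
    using integrable_emode_mult[OF i(1), of "- k"] integrable_emode_mult[OF i(2), of "- k"] by simp
  then have "iper L (\<lambda>x. of_real (f' x) * emode L (- k) x) = - a * iper L (\<lambda>x. of_real (f x) * emode L (- k) x)"
    by (simp add: eq_neg_iff_add_eq_0 add.commute)
  then show ?thesis unfolding fourier_coeff_eq a_def by simp
qed

text \<open>A shift minimizing the \<open>L\<^sup>2\<close> distance to the orbit gives orthogonality to the derivative,
  without an implicit function argument.\<close>
lemma best_shift:
  fixes \<psi> :: "real \<Rightarrow> real"
  assumes L: "L > 0" and u: "u \<in> L2_per L" and p: "\<And>x. \<psi> (x + L) = \<psi> x"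
    and d: "\<And>x. (\<psi> has_real_derivative \<psi>' x) (at x)" and d': "\<And>x. (\<psi>' has_real_derivative \<psi>'' x) (at x)"
    and B: "\<And>x. \<bar>\<psi>' x\<bar> \<le> B" and B': "\<And>x. \<bar>\<psi>'' x\<bar> \<le> B'"
  obtains y where "iper L (\<lambda>x. u (x + y) * \<psi>' x) = 0"
    "\<And>y'. iper L (\<lambda>x. (u (x + y) - \<psi> x)\<^sup>2) \<le> iper L (\<lambda>x. (u (x + y') - \<psi> x)\<^sup>2)"
proof -
  have c\<psi>: "continuous_on UNIV \<psi>" using d by (meson DERIV_isCont continuous_at_imp_continuous_on)
  have c\<psi>': "continuous_on UNIV \<psi>'" using d' by (meson DERIV_isCont continuous_at_imp_continuous_on)
  obtain B0 where B0: "\<And>x. \<bar>\<psi> x\<bar> \<le> B0" by (rule periodic_bounded[OF L p c\<psi>]) blast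
  have \<psi>L: "\<psi> \<in> L2_per L" by (rule L2_per_bounded[of \<psi> L B0, OF p _ B0]) (rule borel_measurable_continuous_onI[OF c\<psi>])
  have \<psi>'L: "\<psi>' \<in> L2_per L"
    by (rule L2_per_bounded[of \<psi>' L B, OF periodic_deriv[of \<psi> L \<psi>', OF p d] _ B]) (rule borel_measurable_continuous_onI[OF c\<psi>'])
  note [measurable] = L2_perD(2)[OF u] L2_perD(2)[OF \<psi>L]
  have uy: "(\<lambda>x. u (x + y)) \<in> L2_per L" for y by (rule L2_per_shift[OF L u])
  have \<psi>y: "(\<lambda>x. \<psi> (x - y)) \<in> L2_per L" for y using L2_per_shift[OF L \<psi>L, of "- y"] by simp
  \<comment> \<open>The norm of \<open>u\<close> is invariant under shifts, so minimizing the L2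
    distance is maximizing this correlation.\<close>
  define J where "J y = iper L (\<lambda>x. u (x + y) * \<psi> x)" for y
  \<comment> \<open>The increment is moved onto \<psi>, because \<open>u\<close> is merely in L2 and
    cannot be differentiated.\<close>
  have Jh: "J (y + h) = iper L (\<lambda>x. u (x + y) * \<psi> (x - h))" for y h
  proof -
    have "J (y + h) = iper L (\<lambda>x. (\<lambda>t. u (t + y) * \<psi> (t - h)) (x + h))"
      unfolding J_def by (simp add: algebra_simps)
    also have "\<dots> = iper L (\<lambda>t. u (t + y) * \<psi> (t - h))"
    proof (rule integral_per_shift[OF L])
      fix x
      show "u (x + L + y) * \<psi> (x + L - h) = u (x + y) * \<psi> (x - h)"
        using L2_perD(1)[OF u, of "x + y"] p[of "x - h"] by (simp add: algebra_simps)
    qed measurable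
    finally show ?thesis .
  qed
  have diff: "J (y + h) - J y = iper L (\<lambda>x. u (x + y) * (\<psi> (x - h) - \<psi> x))" for y h
    unfolding Jh using L2_per_mult_integrable[OF uy \<psi>y] L2_per_mult_integrable[OF uy \<psi>L]
    by (simp add: J_def right_diff_distrib)
  define U where "U = iper L (\<lambda>x. \<bar>u x\<bar>)"
  have Uy: "iper L (\<lambda>x. \<bar>u (x + y)\<bar>) = U" for y
    unfolding U_def using integral_per_shift[OF L, of "\<lambda>x. \<bar>u x\<bar>" y] L2_perD[OF u] by simp
  have iu: "integrable (per L) (\<lambda>x. \<bar>u (x + y)\<bar>)" for y using L2_per_integrable[OF uy] by simp
  have small: "\<bar>iper L (\<lambda>x. u (x + y) * g x)\<bar> \<le> b * U" if g: "g \<in> L2_per L" "\<And>x. \<bar>g x\<bar> \<le> b" for y g b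
  proof -
    have i: "integrable (per L) (\<lambda>x. u (x + y) * g x)" by (rule L2_per_mult_integrable[OF uy g(1)])
    have "\<bar>iper L (\<lambda>x. u (x + y) * g x)\<bar> \<le> iper L (\<lambda>x. \<bar>u (x + y) * g x\<bar>)"
      by (rule integral_abs_bound)
    also have "\<dots> \<le> iper L (\<lambda>x. b * \<bar>u (x + y)\<bar>)"
    proof (rule integral_mono)
      show "integrable (per L) (\<lambda>x. \<bar>u (x + y) * g x\<bar>)" using i by (rule integrable_abs)
      show "integrable (per L) (\<lambda>x. b * \<bar>u (x + y)\<bar>)" using iu by simp
      show "\<bar>u (x + y) * g x\<bar> \<le> b * \<bar>u (x + y)\<bar>" for x
        using mult_right_mono[OF g(2)[of x], of "\<bar>u (x + y)\<bar>"] by (simp add: abs_mult mult.commute)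
    qed
    finally show ?thesis by (simp add: Uy)
  qed
  have U0: "U \<ge> 0" by (simp add: U_def)
  have lip: "\<bar>J (y + h) - J y\<bar> \<le> (B * U) * \<bar>h\<bar>" for y h
  proof -
    have "\<bar>\<psi> (x - h) - \<psi> x\<bar> \<le> B * \<bar>h\<bar>" for x
      using lipschitz_of_derivative[OF d B, of "x - h" x] by simp
    from small[OF L2_per_diff[OF \<psi>y[of h] \<psi>L] this, of y] show ?thesis
      unfolding diff by (simp add: mult_ac)
  qed
  have "continuous_on {0..L} J"
  proof (rule continuous_at_imp_continuous_on, intro ballI)
    fix y
    have "((\<lambda>h. J (y + h) - J y) \<longlongrightarrow> 0) (at 0)"
    proof (rule Lim_null_comparison)
      show "\<forall>\<^sub>F h in at 0. norm (J (y + h) - J y) \<le> (B * U) * \<bar>h\<bar>" using lip by simp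
      show "((\<lambda>h. (B * U) * \<bar>h\<bar>) \<longlongrightarrow> 0) (at 0)" by (auto intro!: tendsto_eq_intros)
    qed
    then show "isCont J y" by (simp add: isCont_iff LIM_zero_iff)
  qed
  then obtain y where y: "y \<in> {0..L}" "\<And>y'. y' \<in> {0..L} \<Longrightarrow> J y' \<le> J y"
    using continuous_attains_sup[of "{0..L}" J] L by auto
  have Jp: "J (y' + L) = J y'" for y'
    unfolding J_def using L2_perD(1)[OF u] by (simp add: add.assoc[symmetric])
  have max: "J y' \<le> J y" for y'
  proof -
    obtain n where "y' + of_int n * L \<in> {0..L}" by (rule period_reduce[OF L])
    then show ?thesis using y(2) periodic_int[of J L y' n] Jp by metis
  qed
  define I where "I = iper L (\<lambda>x. u (x + y) * \<psi>' x)"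
  \<comment> \<open>Maximality of \<open>J\<close> at \<open>y\<close> and the second order
    expansion of \<psi> give an inequality for all \<open>h\<close>, which forces the linear
    coefficient to vanish.\<close>
  have "0 \<le> I * h + (B' * U) * h\<^sup>2" for h
  proof -
    have L2: "(\<lambda>x. \<psi> (x - h) - \<psi> x + h * \<psi>' x) \<in> L2_per L"
      by (intro L2_per_add L2_per_diff L2_per_cmult \<psi>y \<psi>L \<psi>'L)
    have "iper L (\<lambda>x. u (x + y) * (\<psi> (x - h) - \<psi> x + h * \<psi>' x))
      = iper L (\<lambda>x. u (x + y) * (\<psi> (x - h) - \<psi> x) + h * (u (x + y) * \<psi>' x))"
      by (simp add: algebra_simps)
    also have "\<dots> = (J (y + h) - J y) + h * I"
      unfolding diff I_def using L2_per_mult_integrable[OF uy L2_per_diff[OF \<psi>y \<psi>L]] L2_per_mult_integrable[OF uy \<psi>'L]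
      by simp
    finally have "- ((J (y + h) - J y) + h * I) \<le> (B' * h\<^sup>2) * U"
      using small[OF L2, of "B' * h\<^sup>2" y] taylor1_of_second_derivative[OF d d' B'] by simp
    then show ?thesis using max[of "y + h"] by (simp add: mult_ac)
  qed
  then have I0: "I = 0" by (rule linear_quadratic_nonneg)
  have expand: "iper L (\<lambda>x. (u (x + y) - \<psi> x)\<^sup>2)
    = iper L (\<lambda>x. (u x)\<^sup>2) - 2 * J y + iper L (\<lambda>x. (\<psi> x)\<^sup>2)" for y
  proof -
    have "iper L (\<lambda>x. (u (x + y) - \<psi> x)\<^sup>2)
      = iper L (\<lambda>x. (u (x + y))\<^sup>2 - 2 * (u (x + y) * \<psi> x) + (\<psi> x)\<^sup>2)"
      by (simp add: power2_diff algebra_simps)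
    also have "\<dots> = iper L (\<lambda>x. (u (x + y))\<^sup>2) - 2 * J y + iper L (\<lambda>x. (\<psi> x)\<^sup>2)"
      unfolding J_def using L2_perD(3)[OF uy] L2_perD(3)[OF \<psi>L] L2_per_mult_integrable[OF uy \<psi>L] by simp
    also have "iper L (\<lambda>x. (u (x + y))\<^sup>2) = iper L (\<lambda>x. (u x)\<^sup>2)"
      by (rule integral_per_shift[OF L, of "\<lambda>x. (u x)\<^sup>2"]) (use L2_perD[OF u] in auto)
    finally show ?thesis .
  qed
  show ?thesis
  proof (rule that[of y])
    show "iper L (\<lambda>x. u (x + y) * \<psi>' x) = 0" using I0 by (simp add: I_def)
    show "iper L (\<lambda>x. (u (x + y) - \<psi> x)\<^sup>2) \<le> iper L (\<lambda>x. (u (x + y') - \<psi> x)\<^sup>2)" for y'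
      unfolding expand using max[of y'] by simp
  qed
qed

section \<open>The conserved functionals near the wave\<close>

locale wave_setting = multiplier_setting L m \<theta> for L m :: real and \<theta> :: "real \<Rightarrow> real" +
  fixes \<omega> A :: real and \<psi> :: "real \<Rightarrow> real"
  assumes H: "assumption_H L m \<theta> \<omega> A \<psi>"
    and avg: "(1 / L) * (LINT x:{0..L}|lborel. \<psi> x) > \<omega>"
    and wp: "globally_well_posed L \<theta> (m / 2)"
    and cons: "conserves_EFM L m \<theta>"
begin

abbreviation "\<psi>' \<equiv> deriv \<psi>"

definition q :: "real \<Rightarrow> real" where "q x = \<omega> - \<psi> x"

text \<open>A bound named by choice, since the interpretation of \<open>form_setting\<close> needs a
  fixed term for its constant.\<close>

definition qC :: real where "qC = (SOME B. \<forall>x. \<bar>q x\<bar> \<le> B)"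

lemma psi_per: "\<psi> (x + L) = \<psi> x"
  using H by (simp add: assumption_H_def smooth_per_def)

lemma psi_smooth: "(deriv ^^ n) \<psi> field_differentiable (at x)"
  using H by (simp add: assumption_H_def smooth_per_def)

lemma psi_deriv: "(\<psi> has_real_derivative \<psi>' x) (at x)"
  using psi_smooth[of 0 x] by (simp add: DERIV_deriv_iff_field_differentiable)

lemma psi'_deriv: "(\<psi>' has_real_derivative deriv \<psi>' x) (at x)"
  using psi_smooth[of 1 x] by (simp add: DERIV_deriv_iff_field_differentiable)

lemma psi''_deriv: "(deriv \<psi>' has_real_derivative deriv (deriv \<psi>') x) (at x)"
  using psi_smooth[of 2 x] by (simp add: DERIV_deriv_iff_field_differentiable numeral_2_eq_2)

lemma psi_cont: "continuous_on UNIV \<psi>"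
  using psi_deriv by (meson DERIV_isCont continuous_at_imp_continuous_on)

lemma psi'_cont: "continuous_on UNIV \<psi>'"
  using psi'_deriv by (meson DERIV_isCont continuous_at_imp_continuous_on)

lemma psi''_cont: "continuous_on UNIV (deriv \<psi>')"
  using psi''_deriv by (meson DERIV_isCont continuous_at_imp_continuous_on)

lemma psi'_per: "\<psi>' (x + L) = \<psi>' x"
  by (rule periodic_deriv[of \<psi> L \<psi>', OF psi_per psi_deriv])

lemma psi''_per: "deriv \<psi>' (x + L) = deriv \<psi>' x"
  by (rule periodic_deriv[of \<psi>' L "deriv \<psi>'", OF psi'_per psi'_deriv])

lemma psi_bounded: obtains B where "\<And>x. \<bar>\<psi> x\<bar> \<le> B"
  using periodic_bounded[of L \<psi>, OF L psi_per psi_cont] by blast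

lemma psi_L2: "\<psi> \<in> L2_per L"
proof -
  obtain B where "\<And>x. \<bar>\<psi> x\<bar> \<le> B" by (rule psi_bounded) blast
  then show ?thesis by (rule L2_per_bounded[of \<psi> L, OF psi_per borel_measurable_continuous_onI[OF psi_cont]])
qed

lemma psi'_L2: "\<psi>' \<in> L2_per L"
proof -
  obtain B where "\<And>x. \<bar>\<psi>' x\<bar> \<le> B" by (rule periodic_bounded[of L \<psi>', OF L psi'_per psi'_cont]) blast
  then show ?thesis by (rule L2_per_bounded[of \<psi>' L, OF psi'_per borel_measurable_continuous_onI[OF psi'_cont]])
qed

lemma q_bounded: "\<bar>q x\<bar> \<le> qC"
proof -
  obtain B where B: "\<And>x. \<bar>\<psi> x\<bar> \<le> B" by (rule psi_bounded) blast
  have "\<bar>q x\<bar> \<le> \<bar>\<omega>\<bar> + B" for x using B[of x] by (simp add: q_def)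
  then have "\<forall>x. \<bar>q x\<bar> \<le> qC" unfolding qC_def by (intro someI[where P="\<lambda>B. \<forall>x. \<bar>q x\<bar> \<le> B"]) blast
  then show ?thesis by blast
qed

end

sublocale wave_setting \<subseteq> form_setting L m \<theta> q qC
proof
  show "q (x + L) = q x" for x by (simp add: q_def psi_per)
  show "q \<in> borel_measurable borel"
    unfolding q_def by (intro borel_measurable_continuous_onI continuous_intros psi_cont)
  show "\<bar>q x\<bar> \<le> qC" for x by (rule q_bounded)
qed

context wave_setting
begin

section \<open>Regularity and spectral data of the wave\<close>

lemma q_L2: "q \<in> L2_per L"
  by (rule L2_per_bounded[of q L qC, OF q_per q_meas q_bd])

lemma eigenfunction_iff:
  "eigenfunction L m (linearized_op L \<theta> \<omega> \<psi>) l g \<longleftrightarrow>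
    g \<in> H_per L m \<and> \<not> (AE x in lborel. g x = 0) \<and> (AE x in lborel. multiplier_op L \<theta> g x + q x * g x = l * g x)"
  by (simp add: eigenfunction_def linearized_op_def q_def left_diff_distrib add_diff_eq)

lemma psi'_eigen: "eigenfunction L m (linearized_op L \<theta> \<omega> \<psi>) 0 \<psi>'"
  using H by (simp add: assumption_H_def Let_def)

text \<open>\<open>\<psi>'\<close> lies in \<open>H_per L m\<close> because it is assumed to be an
  eigenfunction, and each nonzero mode of \<psi> is at most a constant times the same mode of
  \<open>\<psi>'\<close>. This avoids comparing classical smoothness with Sobolev spaces of real
  order.\<close>

lemma psi_Hm: "\<psi> \<in> H_per L m"
proof -
  have f': "wfin (sobw m) (fc \<psi>')" using psi'_eigen by (simp add: eigenfunction_iff H_per_iff)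
  define a where "a = (L / (2 * pi))\<^sup>2"
  \<comment> \<open>The derivative has no zero mode, so that mode of \<psi> is added by
    hand.\<close>
  let ?\<delta> = "\<lambda>k::int. if k = 0 then sobw m 0 * (cmod (fc \<psi> 0))\<^sup>2 else 0"
  have "?\<delta> summable_on {0}" by simp
  then have "?\<delta> summable_on UNIV" by (rule summable_on_cong_neutral[THEN iffD1, rotated -1]) auto
  then have s: "(\<lambda>k. a * (sobw m k * (cmod (fc \<psi>' k))\<^sup>2) + ?\<delta> k) summable_on UNIV"
    using f' unfolding wfin_def by (intro summable_on_add summable_on_cmult_right)
  have "(\<lambda>k. sobw m k * (cmod (fc \<psi> k))\<^sup>2) summable_on UNIV"
  proof (rule summable_on_comparison_test[OF s])
    fix k
    show "sobw m k * (cmod (fc \<psi> k))\<^sup>2 \<le> a * (sobw m k * (cmod (fc \<psi>' k))\<^sup>2) + ?\<delta> k"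
    proof (cases "k = 0")
      case True
      then show ?thesis by (simp add: a_def)
    next
      case False
      have "cmod (fc \<psi>' k) = (2 * pi / L) * \<bar>of_int k\<bar> * cmod (fc \<psi> k)"
        unfolding fourier_coeff_derivative[of L \<psi> \<psi>' k, OF L psi_per psi_deriv psi'_cont]
        using L by (simp add: norm_mult norm_divide abs_mult)
      then have "a * (cmod (fc \<psi>' k))\<^sup>2 = (of_int k)\<^sup>2 * (cmod (fc \<psi> k))\<^sup>2"
        using L by (simp add: a_def power_mult_distrib power_divide)
      moreover have "1 \<le> (of_int k :: real)\<^sup>2"
      proof -
        have "1 \<le> \<bar>of_int k :: real\<bar>" using False by linarith
        then show ?thesis using one_le_power[of "\<bar>of_int k :: real\<bar>" 2] by simp
      qed
      ultimately have "(cmod (fc \<psi> k))\<^sup>2 \<le> a * (cmod (fc \<psi>' k))\<^sup>2"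
        using mult_right_mono[of 1 "(of_int k :: real)\<^sup>2" "(cmod (fc \<psi> k))\<^sup>2"] by simp
      from mult_left_mono[OF this sobw_nonneg[of m k]] show ?thesis using False by (simp add: mult_ac)
    qed
  qed simp
  then show ?thesis using psi_L2 by (simp add: H_per_iff wfin_def)
qed

lemma psi_X: "\<psi> \<in> X"
  by (rule H_per_m_X[OF psi_Hm])

text \<open>Lets the orthogonality of a translate of \<open>u\<close> to \<open>\<psi>'\<close> pass
  to its difference from \<psi>.\<close>

lemma psi_psi': "ip \<psi> \<psi>' = 0"
proof -
  have "int_per (\<lambda>x. \<psi> x * \<psi>' x) = (\<psi> L)\<^sup>2 / 2 - (\<psi> 0)\<^sup>2 / 2"
  proof (rule integral_per_FTC[OF less_imp_le[OF L]])
    fix x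
    have "((\<lambda>x. (\<psi> x)\<^sup>2 / 2) has_real_derivative \<psi> x * \<psi>' x) (at x)"
      by (auto intro!: derivative_eq_intros psi_deriv)
    then show "((\<lambda>x. (\<psi> x)\<^sup>2 / 2) has_vector_derivative \<psi> x * \<psi>' x) (at x)"
      by (simp add: has_real_derivative_iff_has_vector_derivative)
  qed (intro continuous_intros psi_cont psi'_cont)
  then show ?thesis using psi_per[of 0] by (simp add: l2_def)
qed

lemma one_X: "(\<lambda>x. 1) \<in> X"
  by (rule H_per_const[OF L])

text \<open>The symbol vanishes at mode 0 and constants live on that mode alone, so only the
  potential acts on the constant 1.\<close>

lemma bil_one: "v \<in> X \<Longrightarrow> bil v (\<lambda>x. 1) = ip v q"
proof -
  have th0: "th 0 = 0"
  proof -
    obtain A2 where "th 0 \<le> A2 * \<bar>of_int 0\<bar> powr m" by (rule th_bounds) blast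
    then show ?thesis using th_nonneg[of 0] by simp
  qed
  have "fc (\<lambda>x. 1) k = 0" if "k \<noteq> 0" for k
    using that integral_emode[OF L, of "- k"] by (simp add: fourier_coeff_eq)
  then have z: "th k * Re (fc v k * cnj (fc (\<lambda>x. 1) k)) = 0" for k
    using th0 by (cases "k = 0") auto
  then have "T v (\<lambda>x. 1) = 0" unfolding T_def wip_def z by simp
  then show ?thesis by (simp add: bil_def l2_def mult.commute)
qed

text \<open>The value is \<open>L\<close> times the difference of \<omega> and the mean of \<psi>;
  this is where the mean condition enters.\<close>

lemma bil_one_one: "bil (\<lambda>x. 1) (\<lambda>x. 1) < 0"
proof -
  have "ip (\<lambda>x. 1) q = int_per (\<lambda>x. \<omega> - \<psi> x)" by (simp add: l2_def q_def)
  also have "\<dots> = \<omega> * L - int_per \<psi>"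
    using L2_per_integrable[OF psi_L2] L2_per_integrable[OF L2_per_const[of \<omega>]] integral_per_const[of L \<omega>] L by simp
  also have "\<dots> < 0" using avg L unfolding set_integral_eq_per by (simp add: pos_less_divide_eq)
  finally show ?thesis by (simp add: bil_one[OF one_X])
qed

lemma weak_eigen_cases:
  assumes v: "v \<in> X" and eq: "\<And>w. w \<in> X \<Longrightarrow> bil v w = l * ip v w"
  shows "(AE x in lborel. v x = 0) \<or> eigenfunction L m (linearized_op L \<theta> \<omega> \<psi>) l v"
  unfolding eigenfunction_iff using weak_imp_strong[OF v eq] by blast

text \<open>A weak eigenvector is null or a strong eigenfunction. Uniqueness of the negative
  eigenvalue then fixes a negative level, and simplicity makes the vector a multiple of
  \<open>e\<close> or of \<open>\<psi>'\<close>.\<close>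

lemma wave_spectral:
  obtains e \<mu> where "spectral_setting L m \<theta> q qC e \<psi>' (\<lambda>x. 1) q \<mu>"
proof -
  let ?T = "linearized_op L \<theta> \<omega> \<psi>"
  obtain \<mu> where \<mu>: "\<mu> < 0" "simple_eigenvalue L m ?T \<mu>" "\<And>\<nu>. \<nu> < 0 \<Longrightarrow> eigenvalue L m ?T \<nu> \<Longrightarrow> \<nu> = \<mu>"
    using H unfolding assumption_H_def Let_def by blast
  have s0: "simple_eigenvalue L m ?T 0" using H unfolding assumption_H_def Let_def by blast
  obtain e where e: "eigenfunction L m ?T \<mu> e" using \<mu>(2) unfolding simple_eigenvalue_def eigenvalue_def by blast
  then have eH: "e \<in> H_per L m" and e0: "\<not> (AE x in lborel. e x = 0)"
    and eeq: "AE x in lborel. multiplier_op L \<theta> e x + q x * e x = \<mu> * e x"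
    by (auto simp: eigenfunction_iff)
  have eX: "e \<in> X" by (rule H_per_m_X[OF eH])
  have "spectral_setting L m \<theta> q qC e \<psi>' (\<lambda>x. 1) q \<mu>"
  proof
    show "e \<in> X" by (rule eX)
    have "ip e e \<noteq> 0" using l2_self_eq_0(1)[OF L X_L2[OF eX]] e0 by blast
    then show "ip e e > 0" using l2_nonneg[of L e] by simp
    show "bil e w = \<mu> * ip e w" if "w \<in> X" for w by (rule strong_imp_weak[OF eH eeq that])
    show "\<exists>c. AE x in lborel. v x = c * e x" if v: "v \<in> X" and l: "l < 0" and eq: "\<And>w. w \<in> X \<Longrightarrow> bil v w = l * ip v w" for v l
      using weak_eigen_cases[OF v eq]
    proof
      assume "AE x in lborel. v x = 0"
      then show ?thesis by (intro exI[of _ 0]) simp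
    next
      assume ev: "eigenfunction L m ?T l v"
      then have "l = \<mu>" using \<mu>(3)[OF l] by (auto simp: eigenvalue_def)
      then show ?thesis using ev e \<mu>(2) unfolding simple_eigenvalue_def by blast
    qed
    show "\<exists>c. AE x in lborel. v x = c * \<psi>' x" if v: "v \<in> X" and eq: "\<And>w. w \<in> X \<Longrightarrow> bil v w = 0" for v
    proof -
      have eq0: "\<And>w. w \<in> X \<Longrightarrow> bil v w = 0 * ip v w" using eq by simp
      from weak_eigen_cases[OF v eq0] show ?thesis
      proof
        assume "AE x in lborel. v x = 0"
        then show ?thesis by (intro exI[of _ 0]) simp
      next
        assume "eigenfunction L m ?T 0 v"
        then show ?thesis using psi'_eigen s0 unfolding simple_eigenvalue_def by blast
      qed
    qed
    show "\<psi>' \<in> L2_per L" by (rule psi'_L2)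
    show "(\<lambda>x. 1) \<in> X" by (rule one_X)
    show "bil (\<lambda>x. 1) (\<lambda>x. 1) < 0" by (rule bil_one_one)
    show "q \<in> L2_per L" by (rule q_L2)
    show "bil v (\<lambda>x. 1) = ip v q" if "v \<in> X" for v by (rule bil_one[OF that])
  qed
  then show ?thesis by (rule that)
qed

lemma wave_coercivity:
  obtains c N where "c > 0" "N \<ge> 0"
    "\<And>v. v \<in> X \<Longrightarrow> ip v \<psi>' = 0 \<Longrightarrow> c * (Xn v)\<^sup>2 \<le> bil v v + N * (ip v q)\<^sup>2"
proof -
  obtain e \<mu> where S: "spectral_setting L m \<theta> q qC e \<psi>' (\<lambda>x. 1) q \<mu>" by (rule wave_spectral)
  show ?thesis by (rule spectral_setting.coercivity[OF S]) (rule that)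
qed

text \<open>Conservation includes integrability of the energy density along the solution that starts
  at \<open>v\<close>. The squared multiplier root is integrable by itself, so the cube is what
  remains; at time 0 the solution equals \<open>v\<close> only almost everywhere.\<close>

lemma X_cubic:
  assumes v: "v \<in> X"
  shows "integrable (per L) (\<lambda>x. \<bar>v x\<bar> ^ 3)"
proof -
  obtain u where u: "solution L \<theta> (m / 2) u" "AE x in lborel. u 0 x = v x"
    using wp v unfolding globally_well_posed_def solution_from_def by blast
  have u0: "u 0 \<in> X" using u(1) by (simp add: solution_def)
  have "integrable (per L) (E_density L \<theta> (u 0))"
    using cons u(1) unfolding conserves_EFM_def set_integrable_iff_per by blast
  then have "integrable (per L) (\<lambda>x. 3 * (multiplier_sqrt L \<theta> (u 0) x)\<^sup>2 - 3 * E_density L \<theta> (u 0) x)"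
    using L2_perD(3)[OF multiplier_sqrt_image(1)[OF u0]] by simp
  then have "integrable (per L) (\<lambda>x. (u 0 x) ^ 3)" by (simp add: E_density_def algebra_simps)
  then have "integrable (per L) (\<lambda>x. \<bar>u 0 x ^ 3\<bar>)" by (rule integrable_abs)
  then have i: "integrable (per L) (\<lambda>x. \<bar>u 0 x\<bar> ^ 3)" by (simp add: power_abs)
  note [measurable] = L2_perD(2)[OF X_L2[OF v]] L2_perD(2)[OF X_L2[OF u0]]
  show ?thesis
  proof (rule integrable_cong_AE_imp[OF i])
    show "(\<lambda>x. \<bar>v x\<bar> ^ 3) \<in> borel_measurable (per L)" by (intro borel_measurable_per) measurable
    show "AE x in per L. \<bar>u 0 x\<bar> ^ 3 = \<bar>v x\<bar> ^ 3"
      using AE_perI[OF u(2)] by (rule AE_mp) (auto intro!: AE_I2)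
  qed
qed

lemma X_cube_integrable: "v \<in> X \<Longrightarrow> integrable (per L) (\<lambda>x. (v x) ^ 3)"
proof -
  assume v: "v \<in> X"
  note [measurable] = L2_perD(2)[OF X_L2[OF v]]
  show ?thesis
    by (rule Bochner_Integration.integrable_bound[OF X_cubic[OF v]])
      (auto intro!: AE_I2 borel_measurable_per simp: power_abs)
qed

section \<open>Expansion of the conserved functionals at the wave\<close>

definition G :: "(real \<Rightarrow> real) \<Rightarrow> real" where
  "G u = E_fun L \<theta> u + \<omega> * F_fun L u + A * M_fun L u"

definition Q :: "(real \<Rightarrow> real) \<Rightarrow> real" where
  "Q u = \<omega> * M_fun L u - F_fun L u"

lemma E_fun_eq: "u \<in> X \<Longrightarrow> E_fun L \<theta> u = T u u / 2 - int_per (\<lambda>x. (u x) ^ 3) / 6"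
proof -
  assume u: "u \<in> X"
  have "int_per (E_density L \<theta> u) = int_per (\<lambda>x. (multiplier_sqrt L \<theta> u x)\<^sup>2) - int_per (\<lambda>x. (1 / 3) * (u x) ^ 3)"
    unfolding E_density_def using L2_perD(3)[OF multiplier_sqrt_image(1)[OF u]] X_cube_integrable[OF u]
    by (intro Bochner_Integration.integral_diff) auto
  then show ?thesis unfolding E_fun_def set_integral_eq_per multiplier_sqrt_image(2)[OF u] by simp
qed

lemma F_fun_eq: "F_fun L u = ip u u / 2"
  by (simp add: F_fun_def set_integral_eq_per l2_self)

lemma M_fun_eq: "M_fun L u = int_per u"
  by (simp add: M_fun_def set_integral_eq_per)

text \<open>The profile equation tested with \<open>v\<close>; it says that the first variation of
  \<open>G\<close> at \<psi> vanishes.\<close>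

lemma profile_weak:
  assumes v: "v \<in> X"
  shows "T \<psi> v + \<omega> * ip \<psi> v - ip (\<lambda>x. \<psi> x * \<psi> x) v / 2 + A * int_per v = 0"
proof -
  have Mp: "multiplier_op L \<theta> \<psi> \<in> L2_per L" using multiplier_image[OF psi_Hm] by (simp add: is_multiplier_image_def)
  obtain B where B: "\<And>x. \<bar>\<psi> x\<bar> \<le> B" by (rule psi_bounded) blast
  have pp: "(\<lambda>x. \<psi> x * \<psi> x) \<in> L2_per L"
    by (rule L2_per_mult_bounded[OF psi_per L2_perD(2)[OF psi_L2] B psi_L2])
  note i = L2_per_mult_integrable[OF Mp X_L2[OF v]] L2_per_mult_integrable[OF psi_L2 X_L2[OF v]]
    L2_per_mult_integrable[OF pp X_L2[OF v]] L2_per_integrable[OF X_L2[OF v]]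
  have "T \<psi> v + \<omega> * ip \<psi> v - ip (\<lambda>x. \<psi> x * \<psi> x) v / 2 + A * int_per v
    = int_per (\<lambda>x. multiplier_op L \<theta> \<psi> x * v x + \<omega> * (\<psi> x * v x) - (1 / 2) * (\<psi> x * \<psi> x * v x) + A * v x)"
    unfolding integral_multiplier_op[OF psi_Hm X_L2[OF v], symmetric] l2_def using i by simp
  also have "\<dots> = int_per (\<lambda>x. 0)"
  proof (rule integral_cong_AE)
    note [measurable] = L2_perD(2)[OF Mp] L2_perD(2)[OF psi_L2] L2_perD(2)[OF X_L2[OF v]]
    show "(\<lambda>x. multiplier_op L \<theta> \<psi> x * v x + \<omega> * (\<psi> x * v x) - (1 / 2) * (\<psi> x * \<psi> x * v x) + A * v x) \<in> borel_measurable (per L)"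
      by (intro borel_measurable_per) measurable
    have "AE x in lborel. multiplier_op L \<theta> \<psi> x + \<omega> * \<psi> x - (1/2) * (\<psi> x)\<^sup>2 + A = 0"
      using H by (simp add: assumption_H_def profile_equation_def)
    then have "AE x in per L. multiplier_op L \<theta> \<psi> x + \<omega> * \<psi> x - (1/2) * (\<psi> x)\<^sup>2 + A = 0" by (rule AE_perI)
    then show "AE x in per L. multiplier_op L \<theta> \<psi> x * v x + \<omega> * (\<psi> x * v x) - (1 / 2) * (\<psi> x * \<psi> x * v x) + A * v x = 0"
    proof (rule AE_mp, intro AE_I2 impI)
      fix x assume "multiplier_op L \<theta> \<psi> x + \<omega> * \<psi> x - (1/2) * (\<psi> x)\<^sup>2 + A = 0"
      then have "(multiplier_op L \<theta> \<psi> x + \<omega> * \<psi> x - (1/2) * (\<psi> x)\<^sup>2 + A) * v x = 0" by simp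
      then show "multiplier_op L \<theta> \<psi> x * v x + \<omega> * (\<psi> x * v x) - (1 / 2) * (\<psi> x * \<psi> x * v x) + A * v x = 0"
        by (simp add: power2_eq_square algebra_simps)
    qed
  qed simp
  finally show ?thesis by simp
qed

lemma Q_expand:
  assumes v: "v \<in> X"
  shows "Q (\<lambda>x. \<psi> x + v x) - Q \<psi> = ip v q - ip v v / 2"
proof -
  have "ip (\<lambda>x. \<psi> x + v x) (\<lambda>x. \<psi> x + v x) = ip \<psi> \<psi> + 2 * ip \<psi> v + ip v v"
    using l2_lin_self[OF psi_L2 X_L2[OF v], of 1 1] by simp
  moreover have "int_per (\<lambda>x. \<psi> x + v x) = int_per \<psi> + int_per v"
    using L2_per_integrable[OF psi_L2] L2_per_integrable[OF X_L2[OF v]] by simp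
  moreover have "ip v q = \<omega> * int_per v - ip \<psi> v"
    unfolding l2_def q_def using L2_per_integrable[OF X_L2[OF v]] L2_per_mult_integrable[OF psi_L2 X_L2[OF v]]
    by (simp add: right_diff_distrib mult.commute)
  ultimately show ?thesis by (simp add: Q_def F_fun_eq M_fun_eq field_simps)
qed

text \<open>The functionals are polynomial, so the expansion is exact. The linear part is cancelled
  by \<open>profile_weak\<close>, and the one term beyond second order is the cubic integral, hence
  the need for \<open>cubic_bound\<close>.\<close>

lemma G_expand:
  assumes v: "v \<in> X"
  shows "G (\<lambda>x. \<psi> x + v x) - G \<psi> = bil v v / 2 - int_per (\<lambda>x. (v x) ^ 3) / 6"
proof -
  have uX: "(\<lambda>x. \<psi> x + v x) \<in> X" by (rule H_per_add[OF psi_X v])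
  obtain B where B: "\<And>x. \<bar>\<psi> x\<bar> \<le> B" by (rule psi_bounded) blast
  note pm = L2_per_mult_bounded[OF psi_per L2_perD(2)[OF psi_L2] B]
  have 1: "ip (\<lambda>x. \<psi> x + v x) (\<lambda>x. \<psi> x + v x) = ip \<psi> \<psi> + 2 * ip \<psi> v + ip v v"
    using l2_lin_self[OF psi_L2 X_L2[OF v], of 1 1] by simp
  have 2: "int_per (\<lambda>x. \<psi> x + v x) = int_per \<psi> + int_per v"
    using L2_per_integrable[OF psi_L2] L2_per_integrable[OF X_L2[OF v]] by simp
  have 3: "T (\<lambda>x. \<psi> x + v x) (\<lambda>x. \<psi> x + v x) = T \<psi> \<psi> + 2 * T \<psi> v + T v v"
    using T_lin_left[OF psi_X v uX, of 1 1] T_lin_left[OF psi_X v psi_X, of 1 1] T_lin_left[OF psi_X v v, of 1 1]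
      T_commute[of \<psi> "\<lambda>x. \<psi> x + v x"] T_commute[of v "\<lambda>x. \<psi> x + v x"] T_commute[of v \<psi>] by simp
  have 4: "int_per (\<lambda>x. (\<psi> x + v x) ^ 3) = int_per (\<lambda>x. (\<psi> x) ^ 3) + 3 * ip (\<lambda>x. \<psi> x * \<psi> x) v + 3 * ip (\<lambda>x. \<psi> x * v x) v + int_per (\<lambda>x. (v x) ^ 3)"
  proof -
    have "int_per (\<lambda>x. (\<psi> x + v x) ^ 3) = int_per (\<lambda>x. (\<psi> x) ^ 3 + 3 * (\<psi> x * \<psi> x * v x) + 3 * (\<psi> x * v x * v x) + (v x) ^ 3)"
      by (rule Bochner_Integration.integral_cong) (simp_all add: power3_eq_cube algebra_simps)
    then show ?thesis unfolding l2_def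
      using X_cube_integrable[OF psi_X] X_cube_integrable[OF v] L2_per_mult_integrable[OF pm[OF psi_L2] X_L2[OF v]]
        L2_per_mult_integrable[OF pm[OF X_L2[OF v]] X_L2[OF v]] by simp
  qed
  have 5: "bil v v = T v v + \<omega> * ip v v - ip (\<lambda>x. \<psi> x * v x) v"
  proof -
    have "(\<lambda>x. q x * v x) = (\<lambda>x. \<omega> * v x + (-1) * (\<psi> x * v x))" by (simp add: q_def fun_eq_iff algebra_simps)
    then show ?thesis unfolding bil_def
      using l2_lin_left[OF X_L2[OF v] pm[OF X_L2[OF v]] X_L2[OF v], of \<omega> "-1"] by simp
  qed
  show ?thesis
    unfolding G_def E_fun_eq[OF uX] E_fun_eq[OF psi_X] F_fun_eq M_fun_eq 1 2 3 4 5
    using profile_weak[OF v] by (simp add: field_simps)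
qed

text \<open>A shift only rotates the phases of the coefficients, so \<open>T\<close> is unchanged.
  The conserved values can thus be evaluated at the best translate.\<close>

lemma GQ_shift:
  assumes u: "u \<in> X"
  shows "G (\<lambda>x. u (x + y)) = G u" "Q (\<lambda>x. u (x + y)) = Q u"
proof -
  note [measurable] = L2_perD(2)[OF X_L2[OF u]]
  have s: "int_per (\<lambda>x. f (u (x + y))) = int_per (\<lambda>x. f (u x))" if [measurable]: "f \<in> borel_measurable borel" for f :: "real \<Rightarrow> real"
    by (rule integral_per_shift[OF L, of "\<lambda>x. f (u x)"]) (use L2_perD(1)[OF X_L2[OF u]] in auto)
  have "cmod (fc (\<lambda>x. u (x + y)) k) = cmod (fc u k)" for k
    using fourier_coeff_shift[OF L, of u y k] L2_perD[OF X_L2[OF u]] by (simp add: norm_mult)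
  then have "T (\<lambda>x. u (x + y)) (\<lambda>x. u (x + y)) = T u u" by (simp add: T_def wip_self)
  then have "E_fun L \<theta> (\<lambda>x. u (x + y)) = E_fun L \<theta> u"
    using s[of "\<lambda>t. t ^ 3"] by (simp add: E_fun_eq[OF u] E_fun_eq[OF H_per_shift(1)[OF L u]])
  moreover have "F_fun L (\<lambda>x. u (x + y)) = F_fun L u" using s[of "\<lambda>t. t\<^sup>2"] by (simp add: F_fun_eq l2_self)
  moreover have "M_fun L (\<lambda>x. u (x + y)) = M_fun L u" using s[of "\<lambda>t. t"] by (simp add: M_fun_eq)
  ultimately show "G (\<lambda>x. u (x + y)) = G u" "Q (\<lambda>x. u (x + y)) = Q u" by (simp_all add: G_def Q_def)
qed

end

section \<open>Stability\<close>

context wave_setting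
begin

text \<open>The weight \<open>sobw (m / 2)\<close> is the square root of \<open>sobw m\<close>, so
  this is the inequality of arithmetic and geometric means mode by mode, with \<open>s\<close>
  balancing the two terms.\<close>

lemma interpolation:
  assumes w: "w \<in> H_per L m" and s: "s > 0"
  shows "(Xn w)\<^sup>2 \<le> (s * (H_norm L m w)\<^sup>2 + ip w w / s) / 2"
proof -
  have pw: "sobw (m / 2) k \<le> 1 * (s / 2 * sobw m k + 1 / (2 * s) * 1)" for k
  proof -
    have sq: "sobw m k = (sobw (m / 2) k)\<^sup>2"
      unfolding sobw_def by (simp add: power2_eq_square powr_add[symmetric])
    have "0 \<le> (s * sobw (m / 2) k - 1)\<^sup>2" by simp
    then have "2 * s * sobw (m / 2) k \<le> s\<^sup>2 * sobw m k + 1" by (simp add: sq power2_eq_square algebra_simps)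
    then have "2 * s * sobw (m / 2) k \<le> 2 * s * (s / 2 * sobw m k + 1 / (2 * s))"
      using s by (simp add: power2_eq_square algebra_simps)
    then show ?thesis using s by simp
  qed
  have f: "wfin (sobw m) (fc w)" "wfin (\<lambda>k. 1) (fc w)" using w wfin_fourier[OF L] by (auto simp: H_per_iff)
  have scale: "wfin (\<lambda>k. a * b k) c" "wip (\<lambda>k. a * b k) c c = a * wip b c c" if "wfin b c" for a b c
    using that unfolding wfin_def wip_self
    by (auto simp: mult.assoc infsum_cmult_right' intro: summable_on_cmult_right)
  have "wip (sobw (m / 2)) (fc w) (fc w) \<le> 1 * wip (\<lambda>k. s / 2 * sobw m k + 1 / (2 * s) * 1) (fc w) (fc w)"
    by (rule wfin_mono(2)[OF wfin_add_weight(1)[OF scale(1)[OF f(1)] scale(1)[OF f(2)]] _ pw]) simp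
  also have "\<dots> = s / 2 * wip (sobw m) (fc w) (fc w) + 1 / (2 * s) * wip (\<lambda>k. 1) (fc w) (fc w)"
    unfolding wfin_add_weight(2)[OF scale(1)[OF f(1)] scale(1)[OF f(2)]] scale(2)[OF f(1)] scale(2)[OF f(2)] by simp
  finally have "L * wip (sobw (m / 2)) (fc w) (fc w) \<le> L * (s / 2 * wip (sobw m) (fc w) (fc w) + 1 / (2 * s) * wip (\<lambda>k. 1) (fc w) (fc w))"
    using L by (intro mult_left_mono) auto
  then show ?thesis
    unfolding H_norm_sq[OF L] l2_self parseval_self[OF L H_per_L2[OF w]] using s by (simp add: field_simps)
qed

lemma best_shift_X:
  assumes u: "u \<in> X"
  obtains y where "ip (\<lambda>x. u (x + y) - \<psi> x) \<psi>' = 0"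
    "\<And>y'. ip (\<lambda>x. u (x + y) - \<psi> x) (\<lambda>x. u (x + y) - \<psi> x) \<le> ip (\<lambda>x. u (x + y') - \<psi> x) (\<lambda>x. u (x + y') - \<psi> x)"
proof -
  obtain B where B: "\<And>x. \<bar>\<psi>' x\<bar> \<le> B" by (rule periodic_bounded[of L \<psi>', OF L psi'_per psi'_cont]) blast
  obtain B' where B': "\<And>x. \<bar>deriv \<psi>' x\<bar> \<le> B'" by (rule periodic_bounded[of L "deriv \<psi>'", OF L psi''_per psi''_cont]) blast
  obtain y where y: "int_per (\<lambda>x. u (x + y) * \<psi>' x) = 0"
    "\<And>y'. int_per (\<lambda>x. (u (x + y) - \<psi> x)\<^sup>2) \<le> int_per (\<lambda>x. (u (x + y') - \<psi> x)\<^sup>2)"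
    by (rule best_shift[of L u \<psi> \<psi>' "deriv \<psi>'" B B', OF L X_L2[OF u] psi_per psi_deriv psi'_deriv B B']) blast
  have "ip (\<lambda>x. 1 * u (x + y) + (-1) * \<psi> x) \<psi>' = 0"
    unfolding l2_lin_left[OF L2_per_shift[OF L X_L2[OF u]] psi_L2 psi'_L2] using y(1) psi_psi' by (simp add: l2_def)
  then have "ip (\<lambda>x. u (x + y) - \<psi> x) \<psi>' = 0" by simp
  then show ?thesis using that[of y] y(2) by (simp add: l2_self)
qed

lemma psi_shift_Hm: "(\<lambda>x. \<psi> (x + y)) \<in> H_per L m"
  by (rule H_per_shift(1)[OF L psi_Hm])

text \<open>Two shifts that are both close to the profile in \<open>L\<^sup>2\<close> differ by an almost-period of the profile; interpolation
  with the smooth profile turns this into closeness in the Sobolev norm.\<close>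
lemma shift_comparison:
  assumes \<rho>: "\<rho> > 0"
  obtains \<eta> where "\<eta> > 0"
    "\<And>u y y1. u \<in> X \<Longrightarrow> Xn (\<lambda>x. u (x + y1) - \<psi> x) < \<eta> \<Longrightarrow>
      ip (\<lambda>x. u (x + y) - \<psi> x) (\<lambda>x. u (x + y) - \<psi> x) \<le> ip (\<lambda>x. u (x + y1) - \<psi> x) (\<lambda>x. u (x + y1) - \<psi> x) \<Longrightarrow>
      Xn (\<lambda>x. u (x + y) - \<psi> x) \<le> \<rho>"
proof -
  define h where "h = H_norm L m \<psi>"
  define k where "k = h\<^sup>2 + 1"
  \<comment> \<open>\<open>s\<close> is small enough that \<open>s * (4 * h^2)\<close> stays below
    \<open>\<rho>^2 / 4\<close>, and \<open>\<eta>\<close> is then chosen so that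
    \<open>4 * \<eta>^2 / s\<close> does too. The 1 in \<open>k\<close> avoids division by
    zero.\<close>
  define s where "s = \<rho>\<^sup>2 / (16 * k)"
  have h1: "k > 0" by (simp add: k_def add_nonneg_pos)
  have s: "s > 0" using \<rho> h1 by (simp add: s_def)
  define \<eta> where "\<eta> = min (\<rho> / 2) (\<rho> / 4 * sqrt s)"
  have \<eta>: "\<eta> > 0" "\<eta> \<le> \<rho> / 2" "\<eta> \<le> \<rho> / 4 * sqrt s" using \<rho> s by (simp_all add: \<eta>_def)
  have \<eta>2: "\<eta>\<^sup>2 \<le> \<rho>\<^sup>2 / 16 * s"
  proof -
    have "\<eta>\<^sup>2 \<le> (\<rho> / 4 * sqrt s)\<^sup>2" using \<eta> by (intro power_mono) auto
    then show ?thesis using s by (simp add: power_mult_distrib power_divide)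
  qed
  show ?thesis
  proof (rule that[OF \<eta>(1)])
    fix u y y1
    assume u: "u \<in> X" and d1: "Xn (\<lambda>x. u (x + y1) - \<psi> x) < \<eta>"
      and le: "ip (\<lambda>x. u (x + y) - \<psi> x) (\<lambda>x. u (x + y) - \<psi> x) \<le> ip (\<lambda>x. u (x + y1) - \<psi> x) (\<lambda>x. u (x + y1) - \<psi> x)"
    define z where "z = y - y1"
    define a where "a = (\<lambda>x. u (x + y) - \<psi> x)"
    define b where "b = (\<lambda>x. u (x + y1) - \<psi> x)"
    define d where "d = (\<lambda>x. \<psi> (x + z) - \<psi> x)"
    have aX: "a \<in> X" unfolding a_def by (rule H_per_diff[OF H_per_shift(1)[OF L u] psi_X])
    have bX: "b \<in> X" unfolding b_def by (rule H_per_diff[OF H_per_shift(1)[OF L u] psi_X])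
    have bzX: "(\<lambda>x. b (x + z)) \<in> X" by (rule H_per_shift(1)[OF L bX])
    have dH: "d \<in> H_per L m" unfolding d_def by (rule H_per_diff[OF psi_shift_Hm psi_Hm])
    \<comment> \<open>The rough function \<open>u\<close> enters only through a translate of
      \<open>b\<close>, already small in \<open>X\<close>; the correction \<open>d\<close> is built
      from the wave and lies in \<open>H_per L m\<close>.\<close>
    have a_eq: "a = (\<lambda>x. b (x + z) + d x)" by (simp add: a_def b_def d_def z_def algebra_simps)
    have d_eq: "d = (\<lambda>x. 1 * a x + (-1) * b (x + z))" by (simp add: a_eq)
    have bn: "Xn b < \<eta>" using d1 by (simp add: b_def)
    have bz: "ip (\<lambda>x. b (x + z)) (\<lambda>x. b (x + z)) = ip b b"
      unfolding l2_self using integral_per_shift[OF L, of "\<lambda>x. (b x)\<^sup>2" z] L2_perD[OF X_L2[OF bX]] by simp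
    have ibb: "ip b b \<le> \<eta>\<^sup>2"
    proof -
      have "ip b b \<le> (Xn b)\<^sup>2" unfolding l2_self using L2_norm_le_H_norm[OF L _ bX] m_pos by simp
      also have "\<dots> \<le> \<eta>\<^sup>2" using bn H_norm_nonneg[OF L] by (intro power_mono) auto
      finally show ?thesis .
    qed
    have iaa: "ip a a \<le> \<eta>\<^sup>2" using le ibb by (simp add: a_def b_def)
    have dd: "ip d d \<le> 4 * \<eta>\<^sup>2"
    proof -
      have "\<bar>ip a (\<lambda>x. b (x + z))\<bar> \<le> sqrt (ip a a) * sqrt (ip b b)"
        using L2_cauchy_schwarz[OF X_L2[OF aX] X_L2[OF bzX]] bz by (simp add: l2_self) (simp add: l2_def)
      also have "\<dots> \<le> \<eta> * \<eta>"
        using iaa ibb \<eta>(1) by (intro mult_mono real_le_lsqrt) (auto simp: l2_nonneg)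
      finally have "- ip a (\<lambda>x. b (x + z)) \<le> \<eta>\<^sup>2" by (simp add: power2_eq_square)
      moreover have "ip d d = ip a a - 2 * ip a (\<lambda>x. b (x + z)) + ip b b"
        unfolding d_eq l2_lin_self[OF X_L2[OF aX] X_L2[OF bzX]] bz by simp
      ultimately show ?thesis using iaa ibb by linarith
    qed
    have hh: "(H_norm L m d)\<^sup>2 \<le> 4 * h\<^sup>2"
    proof -
      have "H_norm L m (\<lambda>x. \<psi> (x + z) + (-1) * \<psi> x) \<le> H_norm L m (\<lambda>x. \<psi> (x + z)) + H_norm L m (\<lambda>x. (-1) * \<psi> x)"
        by (rule H_norm_triangle[OF L psi_shift_Hm H_per_cmult[OF psi_Hm]])
      also have "\<dots> = 2 * h" unfolding H_per_shift(2)[OF L psi_Hm] H_norm_cmult[OF L] h_def by simp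
      finally have "H_norm L m d \<le> 2 * h" by (simp add: d_def)
      then have "(H_norm L m d)\<^sup>2 \<le> (2 * h)\<^sup>2" using H_norm_nonneg[OF L] by (intro power_mono) auto
      then show ?thesis by (simp add: power_mult_distrib)
    qed
    have "(Xn d)\<^sup>2 \<le> (s * (4 * h\<^sup>2) + 4 * \<eta>\<^sup>2 / s) / 2"
      by (rule order_trans[OF interpolation[OF dH s] divide_right_mono])
        (use s in \<open>auto intro!: add_mono mult_left_mono divide_right_mono hh dd\<close>)
    also have "\<dots> \<le> (\<rho>\<^sup>2 / 4 + \<rho>\<^sup>2 / 4) / 2"
    proof -
      have "s * (4 * h\<^sup>2) \<le> s * (4 * k)" using s by (intro mult_left_mono) (auto simp: k_def)
      also have "\<dots> = \<rho>\<^sup>2 / 4" using h1 by (simp add: s_def)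
      finally have "s * (4 * h\<^sup>2) \<le> \<rho>\<^sup>2 / 4" .
      moreover have "4 * \<eta>\<^sup>2 / s \<le> \<rho>\<^sup>2 / 4" using \<eta>2 s by (simp add: pos_divide_le_eq)
      ultimately show ?thesis by simp
    qed
    also have "\<dots> = (\<rho> / 2)\<^sup>2" by (simp add: power_divide)
    finally have "Xn d \<le> \<rho> / 2" by (rule power2_le_imp_le) (use \<rho> in simp)
    moreover have "Xn a \<le> Xn (\<lambda>x. b (x + z)) + Xn d"
      unfolding a_eq by (rule H_norm_triangle[OF L bzX H_per_m_X[OF dH]])
    ultimately show "Xn (\<lambda>x. u (x + y) - \<psi> x) \<le> \<rho>"
      using bn \<eta>(2) H_per_shift(2)[OF L bX] by (simp add: a_def)
  qed
qed

section \<open>The orbit distance and its continuity in time\<close>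

lemma orbit_dist_le: "u \<in> X \<Longrightarrow> orbit_dist L (m / 2) u \<psi> \<le> Xn (\<lambda>x. u (x + y) - \<psi> x)"
  unfolding orbit_dist_def by (rule cINF_lower) (auto intro!: bdd_belowI2[where m=0] H_norm_nonneg[OF L])

lemma orbit_dist_less:
  assumes "orbit_dist L (m / 2) u \<psi> < a"
  obtains y where "Xn (\<lambda>x. u (x + y) - \<psi> x) < a"
proof -
  have "bdd_below (range (\<lambda>y. Xn (\<lambda>x. u (x + y) - \<psi> x)))"
    by (auto intro!: bdd_belowI2[where m=0] H_norm_nonneg[OF L])
  then show ?thesis using assms that unfolding orbit_dist_def by (subst (asm) cINF_less_iff) auto
qed

lemma orbit_dist_lipschitz:
  assumes u: "u \<in> X" and v: "v \<in> X"
  shows "orbit_dist L (m / 2) u \<psi> \<le> orbit_dist L (m / 2) v \<psi> + Xn (\<lambda>x. u x - v x)"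
proof (rule ccontr)
  assume "\<not> ?thesis"
  then have "orbit_dist L (m / 2) v \<psi> < orbit_dist L (m / 2) u \<psi> - Xn (\<lambda>x. u x - v x)" by simp
  then obtain y where y: "Xn (\<lambda>x. v (x + y) - \<psi> x) < orbit_dist L (m / 2) u \<psi> - Xn (\<lambda>x. u x - v x)"
    by (rule orbit_dist_less)
  have "orbit_dist L (m / 2) u \<psi> \<le> Xn (\<lambda>x. u (x + y) - \<psi> x)" by (rule orbit_dist_le[OF u])
  also have "(\<lambda>x. u (x + y) - \<psi> x) = (\<lambda>x. (v (x + y) - \<psi> x) + (u (x + y) - v (x + y)))" by simp
  also have "Xn \<dots> \<le> Xn (\<lambda>x. v (x + y) - \<psi> x) + Xn (\<lambda>x. u (x + y) - v (x + y))"
    by (intro H_norm_triangle[OF L] H_per_diff H_per_shift(1)[OF L] u v psi_X)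
  also have "Xn (\<lambda>x. u (x + y) - v (x + y)) = Xn (\<lambda>x. u x - v x)"
    using H_per_shift(2)[OF L H_per_diff[OF u v]] .
  finally show False using y by simp
qed

lemma orbit_dist_continuous:
  assumes u: "solution L \<theta> (m / 2) u"
  shows "continuous_on UNIV (\<lambda>t. orbit_dist L (m / 2) (u t) \<psi>)"
proof (rule continuous_at_imp_continuous_on, intro ballI)
  fix t
  have X: "u t \<in> X" for t using u by (simp add: solution_def)
  have "((\<lambda>\<tau>. orbit_dist L (m / 2) (u \<tau>) \<psi> - orbit_dist L (m / 2) (u t) \<psi>) \<longlongrightarrow> 0) (at t)"
  proof (rule Lim_null_comparison)
    show "((\<lambda>\<tau>. Xn (\<lambda>x. u \<tau> x - u t x)) \<longlongrightarrow> 0) (at t)" using u by (simp add: solution_def)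
    have "\<bar>orbit_dist L (m / 2) (u \<tau>) \<psi> - orbit_dist L (m / 2) (u t) \<psi>\<bar> \<le> Xn (\<lambda>x. u \<tau> x - u t x)" for \<tau>
      using orbit_dist_lipschitz[OF X[of \<tau>] X[of t]] orbit_dist_lipschitz[OF X[of t] X[of \<tau>]]
        H_norm_diff_commute[OF L, of "m / 2" "u t" "u \<tau>"] by linarith
    then show "\<forall>\<^sub>F \<tau> in at t. norm (orbit_dist L (m / 2) (u \<tau>) \<psi> - orbit_dist L (m / 2) (u t) \<psi>) \<le> Xn (\<lambda>x. u \<tau> x - u t x)"
      by simp
  qed
  then show "isCont (\<lambda>t. orbit_dist L (m / 2) (u t) \<psi>) t" by (simp add: isCont_def LIM_zero_iff)
qed

text \<open>Coercivity bounds the norm by the form and the penalty. The exact expansions rewrite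
  both through the changes of \<open>G\<close> and \<open>Q\<close>, and a small radius absorbs the
  errors of order three and higher.\<close>

lemma lyapunov:
  obtains r c K where "r > 0" "c > 0" "K \<ge> 0"
    "\<And>v. v \<in> X \<Longrightarrow> ip v \<psi>' = 0 \<Longrightarrow> Xn v \<le> r \<Longrightarrow>
      c * (Xn v)\<^sup>2 \<le> \<bar>G (\<lambda>x. \<psi> x + v x) - G \<psi>\<bar> + K * (Q (\<lambda>x. \<psi> x + v x) - Q \<psi>)\<^sup>2"
proof -
  obtain c N where c: "c > 0" "N \<ge> 0"
    and co: "\<And>v. v \<in> X \<Longrightarrow> ip v \<psi>' = 0 \<Longrightarrow> c * (Xn v)\<^sup>2 \<le> bil v v + N * (ip v q)\<^sup>2"
    by (rule wave_coercivity) blast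
  obtain K3 where K3: "K3 \<ge> 0" "\<And>v. v \<in> X \<Longrightarrow> N3 v \<le> K3 * (Xn v) ^ 3"
    by (rule cubic_bound[OF X_cubic]) blast+
  \<comment> \<open>\<open>M\<close> collects the cubic errors from \<open>G\<close> and from the
    penalty. The radius gives \<open>M * r \<le> c / 2\<close>, so they use up at most half of the
    coercive term; \<open>P = M + 1\<close> is nonzero and can be divided by.\<close>
  define M where "M = K3 / 3 + N / 2"
  have M: "M \<ge> 0" using K3(1) c(2) by (simp add: M_def)
  define P where "P = M + 1"
  have P: "P > 0" "M \<le> P" using M by (simp_all add: P_def)
  define r where "r = min 1 (c / (2 * P))"
  have r: "r > 0" "r \<le> 1" using c P by (simp_all add: r_def)
  have "M * r \<le> P * (c / (2 * P))" using M P c r by (intro mult_mono) (auto simp: r_def)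
  then have rM: "M * r \<le> c / 2" using P by simp
  show ?thesis
  proof (rule that[of r "c / 4" N])
    fix v assume v: "v \<in> X" and orth: "ip v \<psi>' = 0" and small: "Xn v \<le> r"
    define a where "a = Xn v"
    define dG where "dG = G (\<lambda>x. \<psi> x + v x) - G \<psi>"
    define dQ where "dQ = Q (\<lambda>x. \<psi> x + v x) - Q \<psi>"
    define I where "I = ip v v"
    have a: "0 \<le> a" "a \<le> r" using small H_norm_nonneg[OF L] by (simp_all add: a_def)
    have I: "0 \<le> I" "I \<le> a\<^sup>2"
      using l2_nonneg L2_norm_le_H_norm[OF L _ v] m_pos by (simp_all add: I_def a_def l2_self)
    have "\<bar>int_per (\<lambda>x. (v x) ^ 3)\<bar> \<le> N3 v"
      unfolding N3_def by (rule order_trans[OF integral_abs_bound]) (simp add: power_abs)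
    then have cub: "\<bar>int_per (\<lambda>x. (v x) ^ 3)\<bar> \<le> K3 * a ^ 3" using K3(2)[OF v] by (simp add: a_def)
    have b: "bil v v = 2 * dG + int_per (\<lambda>x. (v x) ^ 3) / 3" using G_expand[OF v] by (simp add: dG_def)
    have q: "ip v q = dQ + I / 2" using Q_expand[OF v] by (simp add: dQ_def I_def)
    \<comment> \<open>The constraint differs from the change of \<open>Q\<close> by half of
      \<open>I\<close>, whose square is of fourth order in \<open>a\<close> and at most
      \<open>a ^ 3\<close> since \<open>a \<le> 1\<close>.\<close>
    have "(dQ + I / 2)\<^sup>2 \<le> 2 * dQ\<^sup>2 + I\<^sup>2 / 2"
      using zero_le_power2[of "dQ - I / 2"] by (simp add: power2_sum power2_diff power_divide)
    also have "I\<^sup>2 \<le> a ^ 3"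
    proof -
      have "I\<^sup>2 \<le> (a\<^sup>2)\<^sup>2" using I by (rule power_mono[rotated])
      also have "\<dots> = a * a ^ 3" by (simp add: power2_eq_square power3_eq_cube)
      also have "\<dots> \<le> 1 * a ^ 3" using a r by (intro mult_right_mono) auto
      finally show ?thesis by simp
    qed
    finally have q2: "(dQ + I / 2)\<^sup>2 \<le> 2 * dQ\<^sup>2 + a ^ 3 / 2" by simp
    have "c * a\<^sup>2 \<le> bil v v + N * (ip v q)\<^sup>2" unfolding a_def by (rule co[OF v orth])
    also have "\<dots> \<le> 2 * dG + K3 / 3 * a ^ 3 + N * (2 * dQ\<^sup>2 + a ^ 3 / 2)"
      unfolding b q using cub mult_left_mono[OF q2 c(2)] by linarith
    also have "\<dots> = 2 * dG + 2 * N * dQ\<^sup>2 + (M * a) * a\<^sup>2"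
      by (simp add: M_def power2_eq_square power3_eq_cube algebra_simps)
    also have "(M * a) * a\<^sup>2 \<le> (c / 2) * a\<^sup>2"
      using mult_left_mono[OF a(2) M] rM by (intro mult_right_mono) auto
    finally have "c / 2 * a\<^sup>2 \<le> 2 * dG + 2 * N * dQ\<^sup>2" by simp
    then have "c / 4 * a\<^sup>2 \<le> \<bar>dG\<bar> + N * dQ\<^sup>2" by linarith
    then show "c / 4 * (Xn v)\<^sup>2 \<le> \<bar>G (\<lambda>x. \<psi> x + v x) - G \<psi>\<bar> + N * (Q (\<lambda>x. \<psi> x + v x) - Q \<psi>)\<^sup>2"
      by (simp add: a_def dG_def dQ_def)
  qed (use r c in auto)
qed

text \<open>Continuity is needed at the wave alone, to make the Lyapunov quantity small initially; a
  linear bound on the unit ball suffices.\<close>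

lemma conserved_continuous:
  obtains K where "K \<ge> 0"
    "\<And>v. v \<in> X \<Longrightarrow> Xn v \<le> 1 \<Longrightarrow> \<bar>G (\<lambda>x. \<psi> x + v x) - G \<psi>\<bar> \<le> K * Xn v \<and> \<bar>Q (\<lambda>x. \<psi> x + v x) - Q \<psi>\<bar> \<le> K * Xn v"
proof -
  obtain K3 where K3: "K3 \<ge> 0" "\<And>v. v \<in> X \<Longrightarrow> N3 v \<le> K3 * (Xn v) ^ 3"
    by (rule cubic_bound[OF X_cubic]) blast+
  obtain K1 where K1: "K1 > 0" "\<And>v. v \<in> X \<Longrightarrow> T v v \<le> K1 * (Xn v)\<^sup>2" by (rule Xn_bound) blast
  define n where "n = sqrt (ip q q)"
  define K where "K = K1 + qC + K3 + n + 1"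
  have n: "n \<ge> 0" by (simp add: n_def l2_nonneg)
  note C0 = C_nonneg
  show ?thesis
  proof (rule that[of K])
    show "K \<ge> 0" using K1(1) K3(1) n C0 by (simp add: K_def)
    fix v assume v: "v \<in> X" and small: "Xn v \<le> 1"
    define a where "a = Xn v"
    have a: "0 \<le> a" "a \<le> 1" using small H_norm_nonneg[OF L] by (simp_all add: a_def)
    have a2: "a\<^sup>2 \<le> a" "a ^ 3 \<le> a"
      using power_decreasing[of 1 2 a] power_decreasing[of 1 3 a] a by simp_all
    have I: "0 \<le> ip v v" "ip v v \<le> a\<^sup>2"
      using l2_nonneg L2_norm_le_H_norm[OF L _ v] m_pos by (simp_all add: a_def l2_self)
    have "\<bar>int_per (\<lambda>x. (v x) ^ 3)\<bar> \<le> N3 v"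
      unfolding N3_def by (rule order_trans[OF integral_abs_bound]) (simp add: power_abs)
    also have "\<dots> \<le> K3 * a ^ 3" using K3(2)[OF v] by (simp add: a_def)
    also have "\<dots> \<le> K3 * a" using a2(2) K3(1) by (rule mult_left_mono)
    finally have cub: "\<bar>int_per (\<lambda>x. (v x) ^ 3)\<bar> \<le> K3 * a" .
    have Tv: "T v v \<le> K1 * a" using K1(2)[OF v] mult_left_mono[OF a2(1) less_imp_le[OF K1(1)]] by (simp add: a_def)
    have Ia: "ip v v \<le> a" using I(2) a2(1) by linarith
    have Cv: "qC * ip v v \<le> qC * a" using Ia C0 by (rule mult_left_mono)
    have bv: "\<bar>bil v v\<bar> \<le> K1 * a + qC * a"
      using bil_bounds[OF v] Tv Cv T_nonneg[of v] by linarith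
    have nonneg: "0 \<le> K1 * a" "0 \<le> qC * a" "0 \<le> K3 * a" "0 \<le> n * a" using a K1(1) K3(1) n C0 by simp_all
    have Ka: "K * a = K1 * a + qC * a + K3 * a + n * a + a" by (simp add: K_def algebra_simps)
    have "\<bar>G (\<lambda>x. \<psi> x + v x) - G \<psi>\<bar> \<le> K * a"
      unfolding G_expand[OF v] Ka using bv cub nonneg a by linarith
    moreover have "\<bar>ip v q\<bar> \<le> n * a"
    proof -
      have "\<bar>ip v q\<bar> \<le> sqrt (ip v v) * n"
        using L2_cauchy_schwarz[OF X_L2[OF v] q_L2] unfolding n_def l2_self by (simp add: l2_def)
      also have "\<dots> \<le> a * n" using I a n by (intro mult_right_mono real_le_lsqrt) auto
      finally show ?thesis by (simp add: mult.commute)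
    qed
    then have "\<bar>Q (\<lambda>x. \<psi> x + v x) - Q \<psi>\<bar> \<le> K * a"
      unfolding Q_expand[OF v] Ka using Ia I(1) nonneg a by linarith
    ultimately show "\<bar>G (\<lambda>x. \<psi> x + v x) - G \<psi>\<bar> \<le> K * Xn v \<and> \<bar>Q (\<lambda>x. \<psi> x + v x) - Q \<psi>\<bar> \<le> K * Xn v"
      by (simp add: a_def)
  qed
qed

theorem stability: "orbitally_stable L \<theta> (m / 2) \<psi>"
  unfolding orbitally_stable_def
proof (intro allI impI)
  fix \<epsilon> :: real assume \<epsilon>: "\<epsilon> > 0"
  obtain r c K where rc: "r > 0" "c > 0" "K \<ge> 0"
    and lyap: "\<And>v. v \<in> X \<Longrightarrow> ip v \<psi>' = 0 \<Longrightarrow> Xn v \<le> r \<Longrightarrow>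
      c * (Xn v)\<^sup>2 \<le> \<bar>G (\<lambda>x. \<psi> x + v x) - G \<psi>\<bar> + K * (Q (\<lambda>x. \<psi> x + v x) - Q \<psi>)\<^sup>2"
    by (rule lyapunov) blast
  obtain K' where K': "K' \<ge> 0"
    "\<And>v. v \<in> X \<Longrightarrow> Xn v \<le> 1 \<Longrightarrow> \<bar>G (\<lambda>x. \<psi> x + v x) - G \<psi>\<bar> \<le> K' * Xn v \<and> \<bar>Q (\<lambda>x. \<psi> x + v x) - Q \<psi>\<bar> \<le> K' * Xn v"
    by (rule conserved_continuous) blast
  obtain \<eta> where \<eta>: "\<eta> > 0" and comp: "\<And>u y y1. u \<in> X \<Longrightarrow> Xn (\<lambda>x. u (x + y1) - \<psi> x) < \<eta> \<Longrightarrow>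
      ip (\<lambda>x. u (x + y) - \<psi> x) (\<lambda>x. u (x + y) - \<psi> x) \<le> ip (\<lambda>x. u (x + y1) - \<psi> x) (\<lambda>x. u (x + y1) - \<psi> x) \<Longrightarrow>
      Xn (\<lambda>x. u (x + y) - \<psi> x) \<le> r"
    by (rule shift_comparison[OF rc(1)]) blast
  \<comment> \<open>Keeping \<open>\<epsilon>'\<close> strictly below \<open>\<eta>\<close> leaves a
    gap: \<open>key\<close> applies at distance \<open>\<epsilon>'\<close> as well, so that value
    can never be taken.\<close>
  define \<epsilon>' where "\<epsilon>' = min \<epsilon> (\<eta> / 2)"
  have \<epsilon>': "0 < \<epsilon>'" "\<epsilon>' \<le> \<epsilon>" "\<epsilon>' < \<eta>" using \<epsilon> \<eta> by (auto simp: \<epsilon>'_def)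
  \<comment> \<open>By \<open>conserved_continuous\<close> the product \<open>D * \<delta>\<close>
    bounds the Lyapunov quantity of the initial value, and \<open>\<delta>\<close> is chosen to keep
    it below \<open>c * \<epsilon>'^2\<close>.\<close>
  define D where "D = K' + K * K'\<^sup>2 + 1"
  have D: "D > 0" unfolding D_def using K'(1) rc(3) by (simp add: add_nonneg_pos)
  define \<delta> where "\<delta> = min (min 1 \<epsilon>') (c * \<epsilon>'\<^sup>2 / (2 * D))"
  have \<delta>: "0 < \<delta>" "\<delta> \<le> 1" "\<delta> \<le> \<epsilon>'" "D * \<delta> \<le> c * \<epsilon>'\<^sup>2 / 2"
  proof -
    show "0 < \<delta>" "\<delta> \<le> 1" "\<delta> \<le> \<epsilon>'" using \<epsilon>' rc D by (auto simp: \<delta>_def)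
    have "D * \<delta> \<le> D * (c * \<epsilon>'\<^sup>2 / (2 * D))" using D by (intro mult_left_mono) (auto simp: \<delta>_def)
    then show "D * \<delta> \<le> c * \<epsilon>'\<^sup>2 / 2" using D by simp
  qed
  show "\<exists>\<delta>>0. \<forall>u0\<in>X. \<forall>u. Xn (\<lambda>x. u0 x - \<psi> x) < \<delta> \<and> solution_from L \<theta> (m / 2) u0 u \<longrightarrow>
      (\<forall>t. orbit_dist L (m / 2) (u t) \<psi> < \<epsilon>)"
  proof (intro exI[of _ \<delta>] conjI ballI allI impI)
    fix u0 u t
    assume u0: "u0 \<in> X" and as: "Xn (\<lambda>x. u0 x - \<psi> x) < \<delta> \<and> solution_from L \<theta> (m / 2) u0 u"
    then have sol: "solution L \<theta> (m / 2) u" and ae: "AE x in lborel. u 0 x = u0 x" by (auto simp: solution_from_def)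
    have uX: "u t \<in> X" for t using sol by (simp add: solution_def)
    \<comment> \<open>The perturbation is formed with \<open>u 0\<close>, which equals the datum
      only almost everywhere; both have the same Fourier coefficients and hence the same
      norm.\<close>
    define v0 where "v0 = (\<lambda>x. u 0 x - \<psi> x)"
    have v0X: "v0 \<in> X" unfolding v0_def by (rule H_per_diff[OF uX psi_X])
    have "fc v0 k = fc (\<lambda>x. u0 x - \<psi> x) k" for k
    proof (rule fourier_coeff_cong_AE)
      show "AE x in per L. v0 x = u0 x - \<psi> x"
        using AE_perI[OF ae] by (rule AE_mp) (auto intro!: AE_I2 simp: v0_def)
    qed (use L2_perD(2)[OF X_L2[OF v0X]] L2_perD(2)[OF X_L2[OF H_per_diff[OF u0 psi_X]]] in auto)
    then have "Xn v0 = Xn (\<lambda>x. u0 x - \<psi> x)" by (simp add: H_norm_eq wip_self)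
    then have v0n: "Xn v0 < \<delta>" using as by simp
    have G0: "G (u t) = G (\<lambda>x. \<psi> x + v0 x)" and Q0: "Q (u t) = Q (\<lambda>x. \<psi> x + v0 x)" for t
      using cons sol unfolding conserves_EFM_def G_def Q_def v0_def by (metis (no_types, lifting) add_diff_cancel_left' add_diff_eq diff_add_cancel ext)+
    have K0: "\<bar>G (\<lambda>x. \<psi> x + v0 x) - G \<psi>\<bar> \<le> K' * Xn v0" "\<bar>Q (\<lambda>x. \<psi> x + v0 x) - Q \<psi>\<bar> \<le> K' * Xn v0"
      using K'(2)[OF v0X] v0n \<delta>(2) by auto
    have total: "\<bar>G (u t) - G \<psi>\<bar> + K * (Q (u t) - Q \<psi>)\<^sup>2 \<le> D * \<delta>" for t
    proof -
      have 1: "K' * Xn v0 \<le> K' * \<delta>" using v0n K'(1) by (intro mult_left_mono) auto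
      have "(Q (u t) - Q \<psi>)\<^sup>2 \<le> (K' * \<delta>)\<^sup>2"
        unfolding Q0 using K0(2) 1 by (intro abs_le_square_iff[THEN iffD1]) (use K'(1) \<delta>(1) in \<open>simp add: abs_mult\<close>)
      also have "\<dots> = K'\<^sup>2 * (\<delta> * \<delta>)" by (simp add: power2_eq_square)
      also have "\<dots> \<le> K'\<^sup>2 * (1 * \<delta>)" using \<delta> by (intro mult_left_mono mult_right_mono) auto
      finally have "K * (Q (u t) - Q \<psi>)\<^sup>2 \<le> K * (K'\<^sup>2 * \<delta>)" using rc(3) by (intro mult_left_mono) auto
      moreover have "\<bar>G (u t) - G \<psi>\<bar> \<le> K' * \<delta>" unfolding G0 using K0(1) 1 by linarith
      moreover have "D * \<delta> = K' * \<delta> + K * (K'\<^sup>2 * \<delta>) + \<delta>" by (simp add: D_def algebra_simps)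
      ultimately show ?thesis using \<delta>(1) by linarith
    qed
    define d where "d t = orbit_dist L (m / 2) (u t) \<psi>" for t
    have key: "d t < \<epsilon>'" if dt: "d t < \<eta>" for t
    proof -
      \<comment> \<open>The shift \<open>y1\<close> comes from the infimum and is close in
        \<open>X\<close>, while the L2-optimal \<open>y\<close> supplies orthogonality;
        \<open>comp\<close> transfers the closeness from the first to the second.\<close>
      obtain y1 where y1: "Xn (\<lambda>x. u t (x + y1) - \<psi> x) < \<eta>"
        using dt unfolding d_def by (rule orbit_dist_less)
      obtain y where y: "ip (\<lambda>x. u t (x + y) - \<psi> x) \<psi>' = 0"
        "\<And>y'. ip (\<lambda>x. u t (x + y) - \<psi> x) (\<lambda>x. u t (x + y) - \<psi> x) \<le> ip (\<lambda>x. u t (x + y') - \<psi> x) (\<lambda>x. u t (x + y') - \<psi> x)"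
        by (rule best_shift_X[OF uX]) blast
      define v where "v = (\<lambda>x. u t (x + y) - \<psi> x)"
      have vX: "v \<in> X" unfolding v_def by (rule H_per_diff[OF H_per_shift(1)[OF L uX] psi_X])
      have vr: "Xn v \<le> r" unfolding v_def by (rule comp[OF uX y1 y(2)])
      have uv: "(\<lambda>x. \<psi> x + v x) = (\<lambda>x. u t (x + y))" by (simp add: v_def)
      have "c * (Xn v)\<^sup>2 \<le> \<bar>G (\<lambda>x. \<psi> x + v x) - G \<psi>\<bar> + K * (Q (\<lambda>x. \<psi> x + v x) - Q \<psi>)\<^sup>2"
        by (rule lyap[OF vX _ vr]) (use y(1) in \<open>simp add: v_def\<close>)
      also have "\<dots> \<le> D * \<delta>" unfolding uv GQ_shift[OF uX] by (rule total)
      also have "\<dots> < c * \<epsilon>'\<^sup>2"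
      proof -
        have "0 < c * \<epsilon>'\<^sup>2" using rc(2) \<epsilon>'(1) by simp
        then show ?thesis using \<delta>(4) by linarith
      qed
      finally have "(Xn v)\<^sup>2 < \<epsilon>'\<^sup>2" using rc(2) by simp
      then have "Xn v < \<epsilon>'" by (rule power2_less_imp_less) (use \<epsilon>'(1) in simp)
      then show ?thesis using orbit_dist_le[OF uX, of t y] by (simp add: d_def v_def)
    qed
    have d0: "d 0 < \<epsilon>'"
      using orbit_dist_le[OF uX, of 0 0] v0n \<delta>(3) by (simp add: d_def v0_def)
    have "d t < \<epsilon>'"
    proof (rule ccontr)
      assume nd: "\<not> d t < \<epsilon>'"
      \<comment> \<open>The set of distances over all times, past and future, is an interval; it
        would have to contain \<open>\<epsilon>'\<close>.\<close>
      have con: "connected (range d)"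
        unfolding d_def by (rule connected_continuous_image[OF orbit_dist_continuous[OF sol]]) simp
      have "\<epsilon>' \<in> range d"
        by (rule connectedD_interval[OF con rangeI[of d 0] rangeI[of d t]]) (use d0 nd in simp_all)
      then obtain t' where "d t' = \<epsilon>'" by auto
      then show False using key[of t'] \<epsilon>'(3) by simp
    qed
    then show "orbit_dist L (m / 2) (u t) \<psi> < \<epsilon>" using \<epsilon>'(2) by (simp add: d_def)
  qed (rule \<delta>(1))
qed

end

theorem theorem2p2:
  fixes L0 m2 \<omega>0 A0 :: real and \<theta> \<psi> :: "real \<Rightarrow> real"
  assumes "L0 > 0"
    and "multiplier_of_order L0 m2 \<theta>"
    and "assumption_H L0 m2 \<theta> \<omega>0 A0 \<psi>"
    and "\<forall>s\<ge>m2/2. globally_well_posed L0 \<theta> s"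
    and "conserves_EFM L0 m2 \<theta>"
    and "(1 / L0) * (LINT x:{0..L0}|lborel. \<psi> x) > \<omega>0" and "\<omega>0 > 0"
  shows "orbitally_stable L0 \<theta> (m2/2) \<psi>"
proof -
  interpret wave_setting L0 m2 \<theta> \<omega>0 A0 \<psi>
    using assms by unfold_locales auto
  show ?thesis by (rule stability)
qed

end
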